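(* If $\alpha_0>0$ and condition $\mathbf{H}$ is not satisfied, then the second moment of the solution of the stochastic equation (S) is unbounded.
   Context: Let $a,b,\sigma_0,\sigma_1,\sigma_2\in\mathbb{R}$ be constants, with $\sigma_1,\sigma_2$ not both zero. The delay kernel $K:[0,+\infty)\to[0,+\infty)$ is piecewise continuous with $\int_0^{+\infty}K(s)\,ds=1$, and there is $\mu>0$ with $\int_0^{+\infty}e^{\mu s}K(s)\,ds<+\infty$. $BC((-\infty,0],\mathbb{R})$ is the space of bounded continuous functions $\phi:(-\infty,0]\to\mathbb{R}$ with norm $\|\phi\|=\sup_{\theta\le 0}|\phi(\theta)|$; it is the space of initial functions. The stochastic equation (S), in the Itô sense, with $W_t$ a one-dimensional Wiener process, is $$dx(t)=\Big(ax(t)+b\int_0^{+\infty}K(s)x(t-s)\,ds\Big)dt+\Big(\sigma_0+\sigma_1x(t)+\sigma_2\int_0^{+\infty}K(s)x(t-s)\,ds\Big)dW_t .$$ $x(t;\phi)$ denotes its solution with initial function $\phi\in BC((-\infty,0],\mathbb{R})$, and $E$ denotes expectation. With $\mathcal{L}(K)(\lambda)=\int_0^{+\infty}e^{-\lambda t}K(t)\,dt$, let $h(\lambda)=\lambda-a-b\,\mathcal{L}(K)(\lambda)$ (well defined and analytic for $\mathrm{Re}(\lambda)\ge-\mu$), and $\alpha_0=\sup\{\mathrm{Re}(\lambda):h(\lambda)=0,\ \lambda\in\mathbb{C}\}$. The second moment of $x(t;\phi)$ is $M(t)=E\big(|x(t;\phi)-E(x(t;\phi))|^2\big)$. The second moment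 of the solution of (S) is said to be bounded if there is a positive constant $\tilde R=\tilde R(\|\phi\|^2)$ such that $M(t)\le\tilde R$ for all $t\ge0$, for all $\phi\in BC((-\infty,0],\mathbb{R})$; otherwise it is said to be unbounded. Condition $\mathbf{H}$: $\sigma_0=0$, and there is a (complex) constant $\lambda$ such that $h(\lambda)=0$ and $\sigma_1+\sigma_2\mathcal{L}(K)(\lambda)=0$. *)

theory Defs
  imports "HOL-Probability.Probability"
begin

section \<open>The delay kernel and the characteristic function\<close>

text \<open>Piecewise continuity on the half-line: every bounded interval contains only finitely many
  discontinuities, and at each of them the one-sided limits exist and are finite.  At \<open>0\<close> only the
  limit from the right is required.\<close>

definition piecewise_continuous_halfline :: "(real \<Rightarrow> real) \<Rightarrow> bool" where
  "piecewise_continuous_halfline K \<longleftrightarrow>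
     (\<forall>T>0. \<exists>S. finite S \<and> continuous_on ({0..T} - S) K) \<and>
     (\<forall>t\<ge>0. \<exists>l. (K \<longlongrightarrow> l) (at_right t)) \<and>
     (\<forall>t>0. \<exists>l. (K \<longlongrightarrow> l) (at_left t))"

definition delay_kernel :: "real \<Rightarrow> (real \<Rightarrow> real) \<Rightarrow> bool" where
  "delay_kernel \<mu> K \<longleftrightarrow>
     0 < \<mu> \<and>
     (\<forall>s\<ge>0. 0 \<le> K s) \<and>
     piecewise_continuous_halfline K \<and>
     set_integrable lborel {0..} K \<and>
     (LINT s:{0..}|lborel. K s) = 1 \<and>
     set_integrable lborel {0..} (\<lambda>s. exp (\<mu> * s) * K s)"

definition laplace :: "(real \<Rightarrow> real) \<Rightarrow> complex \<Rightarrow> complex" where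
  "laplace K z =
     (LINT t:{0..}|lborel. exp (- z * complex_of_real t) * complex_of_real (K t))"

definition char_fun :: "real \<Rightarrow> real \<Rightarrow> (real \<Rightarrow> real) \<Rightarrow> complex \<Rightarrow> complex" where
  "char_fun a b K z = z - complex_of_real a - complex_of_real b * laplace K z"

text \<open>The roots are taken in the half-plane \<open>Re z \<ge> -\<mu>\<close>, where the Laplace integral converges;
  elsewhere the Bochner integral may take the default value \<open>0\<close>, which would create spurious
  roots.\<close>

definition char_roots :: "real \<Rightarrow> real \<Rightarrow> real \<Rightarrow> (real \<Rightarrow> real) \<Rightarrow> complex set" where
  "char_roots \<mu> a b K = {z. - \<mu> \<le> Re z \<and> char_fun a b K z = 0}"

text \<open>The supremum is extended-real valued, so that it is \<open>-\<infinity>\<close> when there is no root.\<close>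

definition alpha0 :: "real \<Rightarrow> real \<Rightarrow> real \<Rightarrow> (real \<Rightarrow> real) \<Rightarrow> ereal" where
  "alpha0 \<mu> a b K = (SUP z\<in>char_roots \<mu> a b K. ereal (Re z))"

definition condition_H ::
    "real \<Rightarrow> real \<Rightarrow> real \<Rightarrow> (real \<Rightarrow> real) \<Rightarrow> real \<Rightarrow> real \<Rightarrow> real \<Rightarrow> bool" where
  "condition_H \<mu> a b K \<sigma>0 \<sigma>1 \<sigma>2 \<longleftrightarrow>
     \<sigma>0 = 0 \<and>
     (\<exists>z\<in>char_roots \<mu> a b K.
        complex_of_real \<sigma>1 + complex_of_real \<sigma>2 * laplace K z = 0)"


section \<open>Initial functions\<close>

text \<open>Elements of \<open>BC((-\<infinity>,0],\<real>)\<close> are represented by total functions; their values on \<open>(0,\<infinity>)\<close> are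
  irrelevant.\<close>

definition BC :: "(real \<Rightarrow> real) set" where
  "BC = {\<phi>. continuous_on {..0} \<phi> \<and> bounded (\<phi> ` {..0})}"

definition BC_norm :: "(real \<Rightarrow> real) \<Rightarrow> real" where
  "BC_norm \<phi> = (SUP \<theta>\<in>{..0}. \<bar>\<phi> \<theta>\<bar>)"


section \<open>Wiener process and It\^o integral\<close>

text \<open>A filtration is indexed by all of \<open>\<real>\<close> because of the library locale; any filtration indexed by
  \<open>[0,\<infinity>)\<close> extends by \<open>F t = F 0\<close> for \<open>t < 0\<close>, and only times \<open>t \<ge> 0\<close> are used.\<close>

definition filtered_prob_space :: "'w measure \<Rightarrow> (real \<Rightarrow> 'w measure) \<Rightarrow> bool" where
  "filtered_prob_space M F \<longleftrightarrow>
     prob_space M \<and> filtration (space M) F \<and> (\<forall>t. subalgebra M (F t))"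

definition wiener_process ::
    "'w measure \<Rightarrow> (real \<Rightarrow> 'w measure) \<Rightarrow> (real \<Rightarrow> 'w \<Rightarrow> real) \<Rightarrow> bool" where
  "wiener_process M F W \<longleftrightarrow>
     (\<forall>t\<ge>0. W t \<in> borel_measurable (F t)) \<and>
     (AE w in M. W 0 w = 0) \<and>
     (AE w in M. continuous_on {0..} (\<lambda>t. W t w)) \<and>
     (\<forall>s\<ge>0. \<forall>t>s.
        distributed M lborel (\<lambda>w. W t w - W s w) (normal_density 0 (sqrt (t - s))) \<and>
        prob_space.indep_set M (sets (F s))
          (sets (vimage_algebra (space M) (\<lambda>w. W t w - W s w) borel)))"

text \<open>A simple process on \<open>[0,T]\<close> takes the bounded \<open>F (\<tau> i)\<close>-measurable value \<open>\<xi> i\<close> on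
  \<open>(\<tau> i, \<tau> (i+1)]\<close>, where \<open>0 = \<tau> 0 \<le> \<dots> \<le> \<tau> m = T\<close>.\<close>

definition simple_process ::
    "'w measure \<Rightarrow> (real \<Rightarrow> 'w measure) \<Rightarrow> real \<Rightarrow> nat \<Rightarrow> (nat \<Rightarrow> real) \<Rightarrow> (nat \<Rightarrow> 'w \<Rightarrow> real) \<Rightarrow> bool"
  where
  "simple_process M F T m \<tau> \<xi> \<longleftrightarrow>
     \<tau> 0 = 0 \<and> \<tau> m = T \<and> (\<forall>i<m. \<tau> i \<le> \<tau> (Suc i)) \<and>
     (\<forall>i<m. \<xi> i \<in> borel_measurable (F (\<tau> i)) \<and> (\<exists>B. \<forall>w\<in>space M. \<bar>\<xi> i w\<bar> \<le> B))"

definition simple_value ::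
    "nat \<Rightarrow> (nat \<Rightarrow> real) \<Rightarrow> (nat \<Rightarrow> 'w \<Rightarrow> real) \<Rightarrow> real \<Rightarrow> 'w \<Rightarrow> real" where
  "simple_value m \<tau> \<xi> t w = (\<Sum>i<m. \<xi> i w * indicator {\<tau> i<..\<tau> (Suc i)} t)"

definition simple_integral ::
    "(real \<Rightarrow> 'w \<Rightarrow> real) \<Rightarrow> nat \<Rightarrow> (nat \<Rightarrow> real) \<Rightarrow> (nat \<Rightarrow> 'w \<Rightarrow> real) \<Rightarrow> 'w \<Rightarrow> real" where
  "simple_integral W m \<tau> \<xi> w = (\<Sum>i<m. \<xi> i w * (W (\<tau> (Suc i)) w - W (\<tau> i) w))"

text \<open>\<open>I\<close> is (a version of) the It\^o integral of \<open>f\<close> over \<open>[0,T]\<close> in the usual sense for integrands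
  that are almost surely square integrable in time: for some sequence of simple processes \<open>f\<^sub>n\<close>, both
  \<open>\<integral>\<^sub>0\<^sup>T \<bar>f\<^sub>n - f\<bar>\<^sup>2 dt \<rightarrow> 0\<close> and \<open>\<integral>\<^sub>0\<^sup>T f\<^sub>n dW \<rightarrow> I\<close> in probability.  The first integral is
  taken in \<open>[0,\<infinity>]\<close>.\<close>

definition has_ito_integral ::
    "'w measure \<Rightarrow> (real \<Rightarrow> 'w measure) \<Rightarrow> (real \<Rightarrow> 'w \<Rightarrow> real) \<Rightarrow>
     (real \<Rightarrow> 'w \<Rightarrow> real) \<Rightarrow> real \<Rightarrow> ('w \<Rightarrow> real) \<Rightarrow> bool" where
  "has_ito_integral M F W f T I \<longleftrightarrow>
     (\<lambda>(t, w). f t w) \<in> borel_measurable (lborel \<Otimes>\<^sub>M M) \<and>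
     I \<in> borel_measurable M \<and>
     (\<exists>m \<tau> \<xi>.
        (\<forall>n. simple_process M F T (m n) (\<tau> n) (\<xi> n)) \<and>
        (\<forall>\<epsilon>>0. (\<lambda>n. measure M {w \<in> space M.
             ennreal \<epsilon> < (\<integral>\<^sup>+t\<in>{0..T}.
                ennreal ((simple_value (m n) (\<tau> n) (\<xi> n) t w - f t w)\<^sup>2) \<partial>lborel)})
           \<longlonglongrightarrow> 0) \<and>
        (\<forall>\<epsilon>>0. (\<lambda>n. measure M {w \<in> space M.
             \<epsilon> < \<bar>simple_integral W (m n) (\<tau> n) (\<xi> n) w - I w\<bar>})
           \<longlonglongrightarrow> 0))"


section \<open>The stochastic delay equation\<close>

definition delay_term :: "(real \<Rightarrow> real) \<Rightarrow> (real \<Rightarrow> 'w \<Rightarrow> real) \<Rightarrow> real \<Rightarrow> 'w \<Rightarrow> real" where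
  "delay_term K x t w = (LINT s:{0..}|lborel. K s * x (t - s) w)"

text \<open>The equation is understood in integrated form, at each time almost surely.\<close>

definition sdde_solution ::
    "'w measure \<Rightarrow> (real \<Rightarrow> 'w measure) \<Rightarrow> (real \<Rightarrow> 'w \<Rightarrow> real) \<Rightarrow>
     real \<Rightarrow> real \<Rightarrow> (real \<Rightarrow> real) \<Rightarrow> real \<Rightarrow> real \<Rightarrow> real \<Rightarrow>
     (real \<Rightarrow> real) \<Rightarrow> (real \<Rightarrow> 'w \<Rightarrow> real) \<Rightarrow> bool" where
  "sdde_solution M F W a b K \<sigma>0 \<sigma>1 \<sigma>2 \<phi> x \<longleftrightarrow>
     (\<forall>w\<in>space M. \<forall>\<theta>\<le>0. x \<theta> w = \<phi> \<theta>) \<and>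
     (\<lambda>(t, w). x t w) \<in> borel_measurable (lborel \<Otimes>\<^sub>M M) \<and>
     (\<forall>t\<ge>0. x t \<in> borel_measurable (F t)) \<and>
     (AE w in M. continuous_on {0..} (\<lambda>t. x t w)) \<and>
     (\<forall>t\<ge>0. \<exists>I.
        has_ito_integral M F W (\<lambda>s w. \<sigma>0 + \<sigma>1 * x s w + \<sigma>2 * delay_term K x s w) t I \<and>
        (AE w in M. x t w =
           \<phi> 0 + (LINT s:{0..t}|lborel. a * x s w + b * delay_term K x s w) + I w))"


section \<open>Second moment\<close>

text \<open>The expectation of the nonnegative variable \<open>\<bar>x(t) - E x(t)\<bar>\<^sup>2\<close> is taken in \<open>[0,\<infinity>]\<close>.  It is
  \<open>\<infinity>\<close> exactly when \<open>x(t)\<close> is not square integrable, also when \<open>x(t)\<close> is not integrable and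
  its Bochner integral has the default value \<open>0\<close>.\<close>

definition second_moment :: "'w measure \<Rightarrow> (real \<Rightarrow> 'w \<Rightarrow> real) \<Rightarrow> real \<Rightarrow> ennreal" where
  "second_moment M x t =
     (\<integral>\<^sup>+w. ennreal (\<bar>x t w - prob_space.expectation M (x t)\<bar>\<^sup>2) \<partial>M)"

definition second_moment_bounded ::
    "'w measure \<Rightarrow> ((real \<Rightarrow> real) \<Rightarrow> real \<Rightarrow> 'w \<Rightarrow> real) \<Rightarrow> bool" where
  "second_moment_bounded M x \<longleftrightarrow>
     (\<exists>R :: real \<Rightarrow> real. (\<forall>r. 0 < R r) \<and>
        (\<forall>\<phi>\<in>BC. \<forall>t\<ge>0. second_moment M (x \<phi>) t \<le> ennreal (R ((BC_norm \<phi>)\<^sup>2))))"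

end

theory Submission
  imports Defs
begin

text \<open>Fix an initial function and suppose that the second moment of the solution \<open>x\<close> is bounded.  For
  \<open>r \<ge> 0\<close> the correlation \<open>c t = E (x t * W r)\<close> is then a bounded function of \<open>t\<close>, and it solves the
  deterministic delay equation with zero initial function, forced by the mean noise intensity
  \<open>\<gamma> s = \<sigma>0 + \<sigma>1 E (x s) + \<sigma>2 \<integral> K u E (x (s - u)) du\<close> for \<open>s \<le> r\<close> and by \<open>0\<close> afterwards.  At a
  characteristic root \<open>z\<close> with \<open>Re z > 0\<close> the Laplace transform of this equation loses its unknown
  and reads \<open>\<integral> s in 0..r. exp (- z s) \<gamma> s = 0\<close>.  Since \<open>r\<close> is arbitrary and \<open>\<gamma>\<close> is continuous,
  \<open>\<gamma> 0 = 0\<close>, which is a linear condition on the initial function alone.  The initial function \<open>0\<close>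
  gives \<open>\<sigma>0 = 0\<close>, and the real and imaginary parts of \<open>exp (z t)\<close> give \<open>\<sigma>1 + \<sigma>2 L(K)(z) = 0\<close>.\<close>

section \<open>Square integrable functions\<close>

text \<open>The mean of \<open>x t\<close> may grow like \<open>exp (Re z * t)\<close>, so the
  transform of \<gamma> over the whole half-line may diverge. Pairing with \<open>W r\<close> avoids
  this. Since \<open>W r\<close> has mean 0, the mean of \<open>x t\<close> drops out of the
  correlation, and Cauchy-Schwarz bounds it by the variance alone; for the same reason the initial
  function leaves no trace in it. The forcing stops at r because the part of the stochastic integral
  after time r is uncorrelated with \<open>W r\<close>. Boundedness of c and Re z > 0 make its
  transform converge, and the factor of that transform in the equation is the characteristic
  function at z, which is 0. The obstacle is integrability. An Ito integral is only a limit in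
  probability of integrals of simple processes whose second moments are not controlled, and the
  assumed bound concerns centred variables, so it says nothing directly about the mean. Strong L2
  convergence is never established: bounds in L2 together with convergence in probability already
  give convergence of the pairings with one fixed square integrable variable.\<close>

definition square_integrable :: "'w measure \<Rightarrow> ('w \<Rightarrow> real) \<Rightarrow> bool" where
  "square_integrable M f \<longleftrightarrow> f \<in> borel_measurable M \<and> integrable M (\<lambda>w. (f w)\<^sup>2)"

lemma square_integrable_square: "square_integrable M f \<Longrightarrow> integrable M (\<lambda>w. (f w)\<^sup>2)"
  by (auto simp: square_integrable_def)

lemma square_integrable_mult:
  assumes "square_integrable M f" "square_integrable M g"
  shows "integrable M (\<lambda>w. f w * g w)"
proof (rule Bochner_Integration.integrable_bound)
  show "integrable M (\<lambda>w. (f w)\<^sup>2 + (g w)\<^sup>2)"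
    using assms by (auto simp: square_integrable_def)
  show "(\<lambda>w. f w * g w) \<in> borel_measurable M"
    using assms by (auto simp: square_integrable_def)
  have "norm (f w * g w) \<le> norm ((f w)\<^sup>2 + (g w)\<^sup>2)" for w
  proof -
    have "2 * (\<bar>f w\<bar> * \<bar>g w\<bar>) \<le> (f w)\<^sup>2 + (g w)\<^sup>2"
      using sum_squares_bound[of "\<bar>f w\<bar>" "\<bar>g w\<bar>"] by simp
    moreover have "0 \<le> \<bar>f w\<bar> * \<bar>g w\<bar>" by simp
    ultimately have "\<bar>f w\<bar> * \<bar>g w\<bar> \<le> (f w)\<^sup>2 + (g w)\<^sup>2" by linarith
    then show ?thesis by (simp add: abs_mult)
  qed
  then show "AE w in M. norm (f w * g w) \<le> norm ((f w)\<^sup>2 + (g w)\<^sup>2)" by simp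
qed

lemma square_integrable_add:
  assumes "square_integrable M f" "square_integrable M g"
  shows "square_integrable M (\<lambda>w. f w + g w)"
  using assms square_integrable_mult[OF assms]
  by (auto simp: square_integrable_def power2_sum mult.assoc)

lemma square_integrable_cmult:
  assumes "square_integrable M f"
  shows "square_integrable M (\<lambda>w. c * f w)"
  using assms by (auto simp: square_integrable_def power_mult_distrib)

lemma square_integrable_diff:
  assumes "square_integrable M f" "square_integrable M g"
  shows "square_integrable M (\<lambda>w. f w - g w)"
  using square_integrable_add[OF assms(1) square_integrable_cmult[OF assms(2), of "-1"]] by simp

lemma square_integrable_cong_AE:
  assumes "square_integrable M f" "AE w in M. f w = g w" "g \<in> borel_measurable M"
  shows "square_integrable M g"
proof -
  have "integrable M (\<lambda>w. (f w)\<^sup>2) \<longleftrightarrow> integrable M (\<lambda>w. (g w)\<^sup>2)"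
    using assms by (intro integrable_cong_AE) (auto simp: square_integrable_def)
  then show ?thesis using assms by (auto simp: square_integrable_def)
qed

lemma square_integrable_bounded_mult:
  assumes "square_integrable M f" "g \<in> borel_measurable M" "\<And>w. w \<in> space M \<Longrightarrow> \<bar>g w\<bar> \<le> B"
  shows "square_integrable M (\<lambda>w. g w * f w)"
  unfolding square_integrable_def
proof
  have m: "f \<in> borel_measurable M" using assms(1) by (simp add: square_integrable_def)
  show "(\<lambda>w. g w * f w) \<in> borel_measurable M" using m assms(2) by simp
  show "integrable M (\<lambda>w. (g w * f w)\<^sup>2)"
  proof (rule Bochner_Integration.integrable_bound)
    show "integrable M (\<lambda>w. B\<^sup>2 * (f w)\<^sup>2)" using assms(1) by (simp add: square_integrable_def)
    show "(\<lambda>w. (g w * f w)\<^sup>2) \<in> borel_measurable M" using m assms(2) by simp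
    show "AE w in M. norm ((g w * f w)\<^sup>2) \<le> norm (B\<^sup>2 * (f w)\<^sup>2)"
    proof (rule AE_I2)
      fix w assume "w \<in> space M"
      then have "(g w)\<^sup>2 \<le> B\<^sup>2" using assms(3)[of w] by (simp add: abs_le_square_iff[symmetric])
      then show "norm ((g w * f w)\<^sup>2) \<le> norm (B\<^sup>2 * (f w)\<^sup>2)"
        by (simp add: power_mult_distrib mult_right_mono)
    qed
  qed
qed

lemma (in finite_measure) square_integrable_const: "square_integrable M (\<lambda>w. c)"
  by (simp add: square_integrable_def)

lemma (in finite_measure) square_integrable_integrable:
  "square_integrable M f \<Longrightarrow> integrable M f"
  by (auto simp: square_integrable_def intro: square_integrable_imp_integrable)

lemma Cauchy_Schwarz_square_integrable:
  assumes "square_integrable M f" "square_integrable M g"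
  shows "(\<integral>w. f w * g w \<partial>M)\<^sup>2 \<le> (\<integral>w. (f w)\<^sup>2 \<partial>M) * (\<integral>w. (g w)\<^sup>2 \<partial>M)"
proof -
  let ?A = "\<integral>w. (f w)\<^sup>2 \<partial>M" and ?B = "\<integral>w. (g w)\<^sup>2 \<partial>M" and ?C = "\<integral>w. f w * g w \<partial>M"
  note i = assms[THEN square_integrable_square] square_integrable_mult[OF assms]
  have q: "0 \<le> ?A - 2 * s * ?C + s\<^sup>2 * ?B" for s
  proof -
    have "0 \<le> (\<integral>w. (f w - s * g w)\<^sup>2 \<partial>M)" by simp
    also have "(\<integral>w. (f w - s * g w)\<^sup>2 \<partial>M)
        = (\<integral>w. (f w)\<^sup>2 - 2 * s * (f w * g w) + s\<^sup>2 * (g w)\<^sup>2 \<partial>M)"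
      by (intro Bochner_Integration.integral_cong refl) (simp add: power2_eq_square algebra_simps)
    also have "\<dots> = ?A - 2 * s * ?C + s\<^sup>2 * ?B"
      using i by simp
    finally show ?thesis .
  qed
  have B0: "0 \<le> ?B" by simp
  show ?thesis
  proof (cases "?B = 0")
    case True
    have "?C = 0"
    proof (rule ccontr)
      assume "?C \<noteq> 0"
      \<comment> \<open>With vanishing quadratic term this choice of s makes the value A - (A + 1) =
        -1, which contradicts \<open>q\<close>.\<close>
      then show False using q[of "(?A + 1) / (2 * ?C)"] True by simp
    qed
    then show ?thesis using True by simp
  next
    case False
    then have "0 < ?B" using B0 by linarith
    \<comment> \<open>The minimum of the quadratic in s is at C / B.\<close>
    then show ?thesis using q[of "?C / ?B"]
      by (simp add: power2_eq_square field_simps)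
  qed
qed

text \<open>An L2-bounded sequence that tends to 0 in probability tends to 0 weakly in L2. Where |Y|
  is large, a weighted AM-GM inequality plays the L2 bound of Z against the small tail of Y;
  elsewhere Y is bounded and only values |Z| > 1 need the L2 bound. Convergence in probability is
  measured by the expectation of \<open>min 1 \<bar>Z n w\<bar>\<close>. All limits in the proof go
  through this lemma: Ito integrals, their time-integral counterparts, and the continuity of
  correlations in time.\<close>

lemma (in prob_space) tendsto_integral_mult_of_bounded_L2:
  fixes Z :: "nat \<Rightarrow> 'a \<Rightarrow> real"
  assumes Z: "\<And>n. square_integrable M (Z n)" and C: "\<And>n. expectation (\<lambda>w. (Z n w)\<^sup>2) \<le> C"
    and lim: "(\<lambda>n. expectation (\<lambda>w. min 1 \<bar>Z n w\<bar>)) \<longlonglongrightarrow> 0"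
    and Y: "square_integrable M Y"
  shows "(\<lambda>n. expectation (\<lambda>w. \<bar>Z n w * Y w\<bar>)) \<longlonglongrightarrow> 0"
proof (rule LIMSEQ_I)
  fix e :: real assume e: "0 < e"
  have Zm[measurable]: "Z n \<in> borel_measurable M" for n using Z by (simp add: square_integrable_def)
  have Ym[measurable]: "Y \<in> borel_measurable M" using Y by (simp add: square_integrable_def)
  have C0: "0 \<le> C" using C[of 0] by (rule order_trans[rotated]) simp
  \<comment> \<open>The AM-GM weight is chosen so that the quadratic part contributes at most e / 4;
    the + 1 keeps the denominator positive when C = 0.\<close>
  define h where "h = e / (4 * (C + 1))"
  have h: "0 < h" using e C0 by (simp add: h_def)
  have hC: "h * C \<le> e / 4" using e C0 by (simp add: h_def field_simps)
  \<comment> \<open>Dominated convergence makes the tail of Y small. The target is h * (e / 4)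
    because AM-GM divides the tail by h.\<close>
  have "(\<lambda>N. expectation (\<lambda>w. (Y w)\<^sup>2 * indicator {w. real N < \<bar>Y w\<bar>} w))
      \<longlonglongrightarrow> expectation (\<lambda>w. 0)"
  proof (rule integral_dominated_convergence[where w="\<lambda>w. (Y w)\<^sup>2"])
    show "AE w in M. (\<lambda>N. (Y w)\<^sup>2 * indicator {w. real N < \<bar>Y w\<bar>} w) \<longlonglongrightarrow> 0"
    proof (rule AE_I2)
      fix w
      obtain N0 :: nat where "\<bar>Y w\<bar> < real N0" using reals_Archimedean2 by blast
      then have "\<forall>\<^sub>F N in sequentially. (Y w)\<^sup>2 * indicator {w. real N < \<bar>Y w\<bar>} w = 0"
        by (intro eventually_sequentiallyI[of N0]) (auto simp: indicator_def)
      then show "(\<lambda>N. (Y w)\<^sup>2 * indicator {w. real N < \<bar>Y w\<bar>} w) \<longlonglongrightarrow> 0"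
        by (rule tendsto_eventually)
    qed
  qed (use Y in \<open>auto simp: square_integrable_def indicator_def\<close>)
  then have "\<forall>\<^sub>F N in sequentially. expectation (\<lambda>w. (Y w)\<^sup>2 * indicator {w. real N < \<bar>Y w\<bar>} w) < h * (e / 4)"
    using h e by (intro order_tendstoD(2)) auto
  then obtain N where N: "expectation (\<lambda>w. (Y w)\<^sup>2 * indicator {w. real N < \<bar>Y w\<bar>} w) < h * (e / 4)"
    by (auto simp: eventually_sequentially)
  \<comment> \<open>K serves both cases with \<bar>y\<bar> \<le> N: the summand N covers
    \<bar>z\<bar> \<le> 1, and N^2 / h is the AM-GM remainder when \<bar>z\<bar> > 1, where the
    minimum equals 1.\<close>
  define K where "K = real N + (real N)\<^sup>2 / h"
  have K0: "0 \<le> K" using h by (simp add: K_def)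
  have pt: "\<bar>z * y\<bar> \<le> K * min 1 \<bar>z\<bar> + h * z\<^sup>2 + y\<^sup>2 * indicator {y. real N < \<bar>y\<bar>} y / h"
    for z y :: real
  proof -
    have am: "\<bar>z\<bar> * b \<le> h * z\<^sup>2 + b\<^sup>2 / h" if "0 \<le> b" for b
    proof -
      have "2 * (h * \<bar>z\<bar>) * b \<le> (h * \<bar>z\<bar>)\<^sup>2 + b\<^sup>2" using sum_squares_bound[of "h * \<bar>z\<bar>" b] by simp
      moreover have "0 \<le> h * \<bar>z\<bar> * b" using that h by simp
      ultimately have "h * (\<bar>z\<bar> * b) \<le> h * (h * z\<^sup>2 + b\<^sup>2 / h)"
        using h by (simp add: power_mult_distrib power2_eq_square algebra_simps)
      then show ?thesis using h by simp
    qed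
    show ?thesis
    proof (cases "real N < \<bar>y\<bar>")
      case True
      have "0 \<le> K * min 1 \<bar>z\<bar>" using K0 by simp
      then show ?thesis using am[of "\<bar>y\<bar>"] True by (simp add: abs_mult)
    next
      case False
      then have 1: "\<bar>z * y\<bar> \<le> \<bar>z\<bar> * real N" by (simp add: abs_mult mult_left_mono)
      show ?thesis
      proof (cases "\<bar>z\<bar> \<le> 1")
        case True
        have "\<bar>z\<bar> * real N \<le> K * \<bar>z\<bar>" using h by (simp add: K_def algebra_simps)
        moreover have "0 \<le> h * z\<^sup>2" using h by simp
        ultimately have "\<bar>z * y\<bar> \<le> K * \<bar>z\<bar> + h * z\<^sup>2" using 1 by linarith
        then show ?thesis using True False by (simp add: min_def)
      next
        case F2: False
        have "\<bar>z\<bar> * real N \<le> h * z\<^sup>2 + K" using am[of "real N"] by (simp add: K_def)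
        then show ?thesis using 1 F2 False by simp
      qed
    qed
  qed
  have int: "integrable M (\<lambda>w. min 1 \<bar>Z n w\<bar>)" for n
    by (rule integrable_const_bound[where B=1]) auto
  have intY: "integrable M (\<lambda>w. (Y w)\<^sup>2 * indicator {w. real N < \<bar>Y w\<bar>} w)"
    by (rule Bochner_Integration.integrable_bound[where f="\<lambda>w. (Y w)\<^sup>2"])
       (use Y in \<open>auto simp: square_integrable_def indicator_def\<close>)
  have bd: "expectation (\<lambda>w. \<bar>Z n w * Y w\<bar>)
      \<le> K * expectation (\<lambda>w. min 1 \<bar>Z n w\<bar>) + h * C + e / 4" for n
  proof -
    have "expectation (\<lambda>w. \<bar>Z n w * Y w\<bar>) \<le> expectation (\<lambda>w. K * min 1 \<bar>Z n w\<bar> + h * (Z n w)\<^sup>2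
        + (Y w)\<^sup>2 * indicator {w. real N < \<bar>Y w\<bar>} w / h)"
      using pt[of "Z n _" "Y _"] int intY Z square_integrable_mult[OF Z Y]
      by (intro integral_mono) (auto simp: square_integrable_def indicator_def)
    also have "\<dots> = K * expectation (\<lambda>w. min 1 \<bar>Z n w\<bar>) + h * expectation (\<lambda>w. (Z n w)\<^sup>2)
       + expectation (\<lambda>w. (Y w)\<^sup>2 * indicator {w. real N < \<bar>Y w\<bar>} w) / h"
      using int intY Z by (simp add: square_integrable_def)
    also have "\<dots> \<le> K * expectation (\<lambda>w. min 1 \<bar>Z n w\<bar>) + h * C + e / 4"
    proof -
      have "h * expectation (\<lambda>w. (Z n w)\<^sup>2) \<le> h * C" using C[of n] h by simp
      moreover have "expectation (\<lambda>w. (Y w)\<^sup>2 * indicator {w. real N < \<bar>Y w\<bar>} w) / h \<le> e / 4"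
        using N h by (simp add: field_simps)
      ultimately show ?thesis by linarith
    qed
    finally show ?thesis .
  qed
  have "(\<lambda>n. K * expectation (\<lambda>w. min 1 \<bar>Z n w\<bar>)) \<longlonglongrightarrow> K * 0"
    by (intro tendsto_mult lim tendsto_const)
  then have "\<forall>\<^sub>F n in sequentially. K * expectation (\<lambda>w. min 1 \<bar>Z n w\<bar>) < e / 4"
    using e by (intro order_tendstoD(2)) auto
  then obtain n0 where n0: "\<And>n. n \<ge> n0 \<Longrightarrow> K * expectation (\<lambda>w. min 1 \<bar>Z n w\<bar>) < e / 4"
    by (auto simp: eventually_sequentially)
  have "norm (expectation (\<lambda>w. \<bar>Z n w * Y w\<bar>) - 0) < e" if "n \<ge> n0" for n
  proof -
    have "0 \<le> expectation (\<lambda>w. \<bar>Z n w * Y w\<bar>)" by simp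
    then show ?thesis using bd[of n] n0[OF that] hC e by simp
  qed
  then show "\<exists>n0. \<forall>n\<ge>n0. norm (expectation (\<lambda>w. \<bar>Z n w * Y w\<bar>) - 0) < e" by blast
qed

text \<open>Splitting at the level e translates convergence in probability, as it occurs in
  \<open>has_ito_integral\<close>, into the truncated expectations used above.\<close>

lemma (in prob_space) expectation_min_le_prob:
  assumes [measurable]: "Z \<in> borel_measurable M" and e: "0 \<le> e"
  shows "expectation (\<lambda>w. min 1 \<bar>Z w\<bar>) \<le> e + prob {w \<in> space M. e < \<bar>Z w\<bar>}"
proof -
  have 1: "integrable M (\<lambda>w. min 1 \<bar>Z w\<bar>)"
    by (rule integrable_const_bound[where B=1]) auto
  have 2: "integrable M (\<lambda>w. e + indicator {w \<in> space M. e < \<bar>Z w\<bar>} w)"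
    by (intro Bochner_Integration.integrable_add integrable_real_indicator) (auto simp: emeasure_eq_measure)
  have "expectation (\<lambda>w. min 1 \<bar>Z w\<bar>) \<le> expectation (\<lambda>w. e + indicator {w \<in> space M. e < \<bar>Z w\<bar>} w)"
    using e by (intro integral_mono[OF 1 2]) (auto simp: indicator_def)
  also have "\<dots> = expectation (\<lambda>w. e) + expectation (indicator {w \<in> space M. e < \<bar>Z w\<bar>})"
    by (intro Bochner_Integration.integral_add integrable_real_indicator) (auto simp: emeasure_eq_measure)
  also have "\<dots> = e + prob ({w \<in> space M. e < \<bar>Z w\<bar>} \<inter> space M)"
    by (simp only: Bochner_Integration.integral_indicator) (simp add: prob_space)
  also have "{w \<in> space M. e < \<bar>Z w\<bar>} \<inter> space M = {w \<in> space M. e < \<bar>Z w\<bar>}" by auto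
  finally show ?thesis .
qed

lemma (in prob_space) tendsto_expectation_min_of_AE:
  assumes [measurable]: "\<And>n. Z n \<in> borel_measurable M" and "AE w in M. (\<lambda>n. Z n w) \<longlonglongrightarrow> (0::real)"
  shows "(\<lambda>n. expectation (\<lambda>w. min 1 \<bar>Z n w\<bar>)) \<longlonglongrightarrow> 0"
proof -
  have "(\<lambda>n. expectation (\<lambda>w. min 1 \<bar>Z n w\<bar>)) \<longlonglongrightarrow> expectation (\<lambda>w. 0)"
  proof (rule integral_dominated_convergence[where w="\<lambda>_. 1"])
    show "AE w in M. (\<lambda>n. min 1 \<bar>Z n w\<bar>) \<longlonglongrightarrow> 0"
      using assms(2)
    proof eventually_elim
      case (elim w)
      have "(\<lambda>n. min 1 \<bar>Z n w\<bar>) \<longlonglongrightarrow> min 1 \<bar>0\<bar>"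
        by (intro tendsto_intros elim)
      then show ?case by simp
    qed
  qed auto
  then show ?thesis by simp
qed

text \<open>Cauchy-Schwarz against the constant 1, stated in [0,\<infinity>] so that integrability
  of f need not be known beforehand: for a non-integrable f the Bochner integral is 0 and the
  inequality still holds.\<close>

lemma square_integral_le_finite:
  fixes f :: "'b \<Rightarrow> real"
  assumes "finite_measure N" and [measurable]: "f \<in> borel_measurable N"
  shows "ennreal ((\<integral>s. f s \<partial>N)\<^sup>2) \<le> ennreal (measure N (space N)) * (\<integral>\<^sup>+s. ennreal ((f s)\<^sup>2) \<partial>N)"
proof -
  interpret N: finite_measure N by fact
  have "ennreal ((\<integral>s. f s \<partial>N)\<^sup>2) = (ennreal (norm (\<integral>s. f s \<partial>N)))\<^sup>2"
    by (simp add: ennreal_power)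
  also have "\<dots> \<le> (\<integral>\<^sup>+s. ennreal (norm (f s)) * 1 \<partial>N)\<^sup>2"
  proof (cases "integrable N f")
    case True
    then show ?thesis using integral_norm_bound_ennreal[OF True] by (intro power_mono) auto
  next
    case False
    then show ?thesis by (simp add: not_integrable_integral_eq)
  qed
  also have "\<dots> \<le> (\<integral>\<^sup>+s. (ennreal (norm (f s)))\<^sup>2 \<partial>N) * (\<integral>\<^sup>+s. 1\<^sup>2 \<partial>N)"
    by (rule Cauchy_Schwarz_nn_integral) auto
  also have "\<dots> = ennreal (measure N (space N)) * (\<integral>\<^sup>+s. ennreal ((f s)\<^sup>2) \<partial>N)"
    by (simp add: ennreal_power N.emeasure_eq_measure mult.commute)
  finally show ?thesis .
qed

text \<open>Pathwise Cauchy-Schwarz followed by Fubini for nonnegative functions gives the two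
  square statements; \<bar>h Y\<bar> \<le> h^2 + Y^2 then justifies Fubini for the pairing with Y. N
  will be the kernel measure, for the delayed term, or Lebesgue measure on [0,t], for time
  integrals. The moment bound is required only almost everywhere in N because these measures live on
  part of the line, and the bound is available only there.\<close>

lemma
  fixes h :: "'b \<Rightarrow> 'a \<Rightarrow> real"
  assumes "prob_space M" and "finite_measure N"
    and hm: "(\<lambda>(s, w). h s w) \<in> borel_measurable (N \<Otimes>\<^sub>M M)"
    and C: "AE s in N. (\<integral>\<^sup>+w. ennreal ((h s w)\<^sup>2) \<partial>M) \<le> ennreal C" and C0: "0 \<le> C"
  shows square_integrable_integral: "square_integrable M (\<lambda>w. \<integral>s. h s w \<partial>N)"
    and expectation_square_integral_le:
      "(\<integral>w. (\<integral>s. h s w \<partial>N)\<^sup>2 \<partial>M) \<le> (measure N (space N))\<^sup>2 * C"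
    and expectation_integral_mult: "square_integrable M Y \<Longrightarrow>
      (\<integral>w. (\<integral>s. h s w \<partial>N) * Y w \<partial>M) = (\<integral>s. (\<integral>w. h s w * Y w \<partial>M) \<partial>N)"
proof -
  interpret M: prob_space M by fact
  interpret N: finite_measure N by fact
  interpret P: pair_sigma_finite N M ..
  interpret Q: pair_sigma_finite M N ..
  note hm[measurable]
  have m1[measurable]: "(\<lambda>s. h s w) \<in> borel_measurable N" if "w \<in> space M" for w
    using that by measurable
  have m2[measurable]: "(\<lambda>(w, s). h s w) \<in> borel_measurable (M \<Otimes>\<^sub>M N)"
    using measurable_compose[OF measurable_pair_swap' hm] by (simp add: case_prod_beta' comp_def)
  have m3[measurable]: "(\<lambda>w. \<integral>s. h s w \<partial>N) \<in> borel_measurable M"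
    by measurable
  let ?m = "measure N (space N)"
  have "(\<integral>\<^sup>+w. ennreal ((\<integral>s. h s w \<partial>N)\<^sup>2) \<partial>M)
      \<le> (\<integral>\<^sup>+w. ennreal ?m * (\<integral>\<^sup>+s. ennreal ((h s w)\<^sup>2) \<partial>N) \<partial>M)"
    using \<open>finite_measure N\<close> by (intro nn_integral_mono square_integral_le_finite) auto
  also have "\<dots> = ennreal ?m * (\<integral>\<^sup>+w. (\<integral>\<^sup>+s. ennreal ((h s w)\<^sup>2) \<partial>N) \<partial>M)"
    by (intro nn_integral_cmult) measurable
  also have "(\<integral>\<^sup>+w. (\<integral>\<^sup>+s. ennreal ((h s w)\<^sup>2) \<partial>N) \<partial>M) = (\<integral>\<^sup>+s. (\<integral>\<^sup>+w. ennreal ((h s w)\<^sup>2) \<partial>M) \<partial>N)"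
    by (intro P.Fubini') measurable
  also have "(\<integral>\<^sup>+s. (\<integral>\<^sup>+w. ennreal ((h s w)\<^sup>2) \<partial>M) \<partial>N) \<le> (\<integral>\<^sup>+s. ennreal C \<partial>N)"
    by (intro nn_integral_mono_AE C)
  also have "ennreal ?m * \<dots> = ennreal (?m\<^sup>2 * C)"
    using C0 by (simp add: N.emeasure_eq_measure ennreal_mult[symmetric] power2_eq_square ac_simps)
  finally have le: "(\<integral>\<^sup>+w. ennreal ((\<integral>s. h s w \<partial>N)\<^sup>2) \<partial>M) \<le> ennreal (?m\<^sup>2 * C)"
    by (simp add: mult_left_mono)
  have "integrable M (\<lambda>w. (\<integral>s. h s w \<partial>N)\<^sup>2)"
    using le by (intro integrableI_bounded) (auto simp: le_less_trans[OF _ ennreal_less_top])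
  then show "square_integrable M (\<lambda>w. \<integral>s. h s w \<partial>N)"
    by (simp add: square_integrable_def)
  show "(\<integral>w. (\<integral>s. h s w \<partial>N)\<^sup>2 \<partial>M) \<le> ?m\<^sup>2 * C"
    using le C0 by (intro integral_real_bounded) auto
  assume Y: "square_integrable M Y"
  then have Ym[measurable]: "Y \<in> borel_measurable M" by (simp add: square_integrable_def)
  have int: "integrable (N \<Otimes>\<^sub>M M) (\<lambda>(s, w). h s w * Y w)"
  proof (rule integrableI_bounded)
    have "(\<integral>\<^sup>+p. ennreal (norm (case p of (s, w) \<Rightarrow> h s w * Y w)) \<partial>(N \<Otimes>\<^sub>M M))
       = (\<integral>\<^sup>+s. \<integral>\<^sup>+w. ennreal (norm (h s w * Y w)) \<partial>M \<partial>N)"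
      by (subst M.nn_integral_fst[symmetric]) (auto simp: case_prod_beta')
    also have "\<dots> \<le> (\<integral>\<^sup>+s. ennreal (C + (\<integral>w. (Y w)\<^sup>2 \<partial>M)) \<partial>N)"
    proof (rule nn_integral_mono_AE)
      show "AE s in N. (\<integral>\<^sup>+w. ennreal (norm (h s w * Y w)) \<partial>M) \<le> ennreal (C + (\<integral>w. (Y w)\<^sup>2 \<partial>M))"
        using C AE_space
      proof eventually_elim
        case (elim s)
        have [measurable]: "h s \<in> borel_measurable M"
          using measurable_Pair2[OF hm elim(2)] by simp
        have "(\<integral>\<^sup>+w. ennreal (norm (h s w * Y w)) \<partial>M) \<le> (\<integral>\<^sup>+w. ennreal ((h s w)\<^sup>2) + ennreal ((Y w)\<^sup>2) \<partial>M)"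
        proof (rule nn_integral_mono)
          fix w
          have "2 * (\<bar>h s w\<bar> * \<bar>Y w\<bar>) \<le> (h s w)\<^sup>2 + (Y w)\<^sup>2"
            using sum_squares_bound[of "\<bar>h s w\<bar>" "\<bar>Y w\<bar>"] by simp
          then have "\<bar>h s w\<bar> * \<bar>Y w\<bar> \<le> (h s w)\<^sup>2 + (Y w)\<^sup>2"
            using mult_nonneg_nonneg[of "\<bar>h s w\<bar>" "\<bar>Y w\<bar>"] by linarith
          then show "ennreal (norm (h s w * Y w)) \<le> ennreal ((h s w)\<^sup>2) + ennreal ((Y w)\<^sup>2)"
            by (simp add: abs_mult ennreal_plus[symmetric] del: ennreal_plus)
        qed
        also have "\<dots> = (\<integral>\<^sup>+w. ennreal ((h s w)\<^sup>2) \<partial>M) + (\<integral>\<^sup>+w. ennreal ((Y w)\<^sup>2) \<partial>M)"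
          by (intro nn_integral_add) auto
        also have "\<dots> \<le> ennreal C + ennreal (\<integral>w. (Y w)\<^sup>2 \<partial>M)"
          using Y elim by (intro add_mono) (auto simp: square_integrable_def nn_integral_eq_integral)
        finally show ?case using C0 by (simp add: ennreal_plus)
      qed
    qed
    also have "\<dots> < \<infinity>"
      by (simp add: N.emeasure_eq_measure ennreal_mult_less_top)
    finally show "(\<integral>\<^sup>+p. ennreal (norm (case p of (s, w) \<Rightarrow> h s w * Y w)) \<partial>(N \<Otimes>\<^sub>M M)) < \<infinity>" .
  qed measurable
  have "(\<integral>w. (\<integral>s. h s w \<partial>N) * Y w \<partial>M) = (\<integral>w. (\<integral>s. h s w * Y w \<partial>N) \<partial>M)"
    by simp
  also have "\<dots> = (\<integral>s. (\<integral>w. h s w * Y w \<partial>M) \<partial>N)"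
    by (rule P.Fubini_integral[OF int])
  finally show "(\<integral>w. (\<integral>s. h s w \<partial>N) * Y w \<partial>M) = (\<integral>s. (\<integral>w. h s w * Y w \<partial>M) \<partial>N)" .
qed

section \<open>Integrals of simple processes\<close>

text \<open>A density keeps the whole line as underlying space and the Borel sets as measurable
  sets, so measurability passes over unchanged from \<open>lborel\<close>, while the measure becomes
  finite on bounded intervals and fits the preceding Fubini lemma.\<close>

definition lborel_on :: "real set \<Rightarrow> real measure" where
  "lborel_on A = density lborel (indicator A)"

lemma sets_lborel_on[simp, measurable_cong]: "sets (lborel_on A) = sets borel"
  and space_lborel_on[simp]: "space (lborel_on A) = UNIV"
  by (simp_all add: lborel_on_def)

lemma nn_integral_lborel_on:
  assumes [measurable]: "A \<in> sets borel" "f \<in> borel_measurable borel"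
  shows "(\<integral>\<^sup>+t. f t \<partial>lborel_on A) = (\<integral>\<^sup>+t\<in>A. f t \<partial>lborel)"
  unfolding lborel_on_def by (subst nn_integral_density) (auto simp: mult.commute)

lemma integral_lborel_on:
  fixes f :: "real \<Rightarrow> real"
  assumes [measurable]: "A \<in> sets borel" "f \<in> borel_measurable borel"
  shows "(\<integral>t. f t \<partial>lborel_on A) = (LINT t:A|lborel. f t)"
proof -
  have "lborel_on A = density lborel (\<lambda>t. ennreal (indicator A t))"
    by (simp add: lborel_on_def ennreal_indicator)
  then show ?thesis
    unfolding set_lebesgue_integral_def by (simp add: integral_density)
qed

lemma emeasure_lborel_on:
  assumes [measurable]: "A \<in> sets borel" "B \<in> sets borel"
  shows "emeasure (lborel_on A) B = emeasure lborel (A \<inter> B)"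
  unfolding lborel_on_def
  by (subst emeasure_density) (auto simp: indicator_inter_arith[symmetric])

lemma AE_lborel_on:
  assumes [measurable]: "A \<in> sets borel"
  shows "(AE t in lborel_on A. P t) \<longleftrightarrow> (AE t in lborel. t \<in> A \<longrightarrow> P t)"
  unfolding lborel_on_def by (subst AE_density) (auto simp: indicator_def)

lemma measure_lborel_on_Icc: "0 \<le> T \<Longrightarrow> measure (lborel_on {0..T}) UNIV = T"
  by (simp add: lborel_on_def measure_def emeasure_density)

lemma finite_measure_lborel_on_Icc: "finite_measure (lborel_on {0..T})"
  by (rule finite_measureI) (simp add: lborel_on_def emeasure_density emeasure_lborel_Icc_eq)

text \<open>For a simple process on [0,T] this is the integral over [0,T] of its squared path, that
  is, its quadratic variation against W.\<close>

definition energy :: "nat \<Rightarrow> (nat \<Rightarrow> real) \<Rightarrow> (nat \<Rightarrow> 'w \<Rightarrow> real) \<Rightarrow> 'w \<Rightarrow> real" where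
  "energy m \<tau> \<xi> w = (\<Sum>i<m. (\<xi> i w)\<^sup>2 * (\<tau> (Suc i) - \<tau> i))"

text \<open>A discrete stopping rule. The test looks at the energy including interval i itself,
  hence \<open>Suc i\<close>: the retained energy then never exceeds L, and the rule is still
  adapted because the coefficient of interval i is known at its left endpoint.\<close>

definition truncate_coeff ::
    "(nat \<Rightarrow> real) \<Rightarrow> (nat \<Rightarrow> 'w \<Rightarrow> real) \<Rightarrow> real \<Rightarrow> nat \<Rightarrow> 'w \<Rightarrow> real" where
  "truncate_coeff \<tau> \<xi> L i w = (if energy (Suc i) \<tau> \<xi> w \<le> L then \<xi> i w else 0)"

lemma energy_nonneg:
  assumes "\<forall>i<m. \<tau> i \<le> \<tau> (Suc i)"
  shows "0 \<le> energy m \<tau> \<xi> w"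
  unfolding energy_def by (rule sum_nonneg) (use assms in simp)

lemma energy_mono:
  assumes "\<forall>i<m. \<tau> i \<le> \<tau> (Suc i)" "k \<le> m"
  shows "energy k \<tau> \<xi> w \<le> energy m \<tau> \<xi> w"
  unfolding energy_def by (rule sum_mono2) (use assms in auto)

text \<open>The two bounds are proved together because a retained step needs the comparison with the
  full energy, which is at most L by the stopping test, to recover the bound L. A dropped step adds
  nothing.\<close>

lemma energy_truncate_coeff_le:
  assumes "\<forall>i<m. \<tau> i \<le> \<tau> (Suc i)" "0 \<le> L"
  shows "energy m \<tau> (truncate_coeff \<tau> \<xi> L) w \<le> min L (energy m \<tau> \<xi> w)"
  using assms(1)
proof (induction m)
  case 0
  then show ?case using assms(2) by (simp add: energy_def)
next
  case (Suc m)
  have IH: "energy m \<tau> (truncate_coeff \<tau> \<xi> L) w \<le> min L (energy m \<tau> \<xi> w)"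
    using Suc by simp
  have 1: "energy (Suc m) \<tau> (truncate_coeff \<tau> \<xi> L) w
    = energy m \<tau> (truncate_coeff \<tau> \<xi> L) w + (truncate_coeff \<tau> \<xi> L m w)\<^sup>2 * (\<tau> (Suc m) - \<tau> m)"
    by (simp add: energy_def)
  have 2: "energy (Suc m) \<tau> \<xi> w = energy m \<tau> \<xi> w + (\<xi> m w)\<^sup>2 * (\<tau> (Suc m) - \<tau> m)"
    by (simp add: energy_def)
  have 3: "energy m \<tau> \<xi> w \<le> energy (Suc m) \<tau> \<xi> w"
    using Suc.prems by (intro energy_mono) auto
  show ?case
  proof (cases "energy (Suc m) \<tau> \<xi> w \<le> L")
    case True
    then have "truncate_coeff \<tau> \<xi> L m w = \<xi> m w" by (simp add: truncate_coeff_def)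
    then show ?thesis using 1 2 IH True by simp
  next
    case False
    then have "truncate_coeff \<tau> \<xi> L m w = 0" by (simp add: truncate_coeff_def)
    then show ?thesis using 1 3 IH by simp
  qed
qed

lemma truncate_coeff_eq:
  assumes "\<forall>i<m. \<tau> i \<le> \<tau> (Suc i)" "energy m \<tau> \<xi> w \<le> L" "i < m"
  shows "truncate_coeff \<tau> \<xi> L i w = \<xi> i w"
  using energy_mono[OF assms(1), of "Suc i" \<xi> w] assms(2,3) by (simp add: truncate_coeff_def)

text \<open>The intervals are disjoint, so all cross terms vanish.\<close>

lemma simple_value_square:
  assumes "\<forall>i<m. \<tau> i \<le> \<tau> (Suc i)"
  shows "(simple_value m \<tau> \<xi> t w)\<^sup>2 = (\<Sum>i<m. (\<xi> i w)\<^sup>2 * indicator {\<tau> i<..\<tau> (Suc i)} t)"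
  using assms
proof (induction m)
  case 0
  then show ?case by (simp add: simple_value_def)
next
  case (Suc m)
  have "simple_value m \<tau> \<xi> t w * indicator {\<tau> m<..\<tau> (Suc m)} t = 0"
  proof (cases "t \<in> {\<tau> m<..\<tau> (Suc m)}")
    case True
    have "t \<notin> {\<tau> i<..\<tau> (Suc i)}" if "i < m" for i
    proof -
      have "\<tau> (Suc i) \<le> \<tau> m"
      proof (rule inc_induct[of "Suc i" m "\<lambda>k. \<tau> k \<le> \<tau> m"])
        fix n assume "n < m" "\<tau> (Suc n) \<le> \<tau> m"
        then show "\<tau> n \<le> \<tau> m" using Suc.prems by (meson less_Suc_eq order_trans)
      qed (use that in auto)
      then show ?thesis using True by auto
    qed
    then show ?thesis by (simp add: simple_value_def)
  qed simp
  moreover have "simple_value (Suc m) \<tau> \<xi> t w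
    = simple_value m \<tau> \<xi> t w + \<xi> m w * indicator {\<tau> m<..\<tau> (Suc m)} t"
    by (simp add: simple_value_def)
  ultimately have "(simple_value (Suc m) \<tau> \<xi> t w)\<^sup>2
    = (simple_value m \<tau> \<xi> t w)\<^sup>2 + (\<xi> m w)\<^sup>2 * indicator {\<tau> m<..\<tau> (Suc m)} t"
    by (cases "t \<in> {\<tau> m<..\<tau> (Suc m)}") auto
  then show ?case using Suc by simp
qed

lemma simple_process_mono:
  assumes "simple_process M F T m \<tau> \<xi>" "i \<le> j" "j \<le> m"
  shows "\<tau> i \<le> \<tau> j"
proof (rule inc_induct[OF assms(2), of "\<lambda>k. \<tau> k \<le> \<tau> j"])
  fix n assume "n < j" "\<tau> (Suc n) \<le> \<tau> j"
  moreover have "\<tau> n \<le> \<tau> (Suc n)" using assms \<open>n < j\<close> by (simp add: simple_process_def)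
  ultimately show "\<tau> n \<le> \<tau> j" by simp
qed simp

lemma simple_process_nonneg:
  assumes "simple_process M F T m \<tau> \<xi>" "i \<le> m"
  shows "0 \<le> \<tau> i" and "\<tau> i \<le> T"
  using simple_process_mono[OF assms(1), of 0 i] simple_process_mono[OF assms(1), of i m] assms
  by (auto simp: simple_process_def)

lemma nn_integral_simple_value_square:
  assumes S: "simple_process M F T m \<tau> \<xi>"
  shows "(\<integral>\<^sup>+t. ennreal ((simple_value m \<tau> \<xi> t w)\<^sup>2) \<partial>lborel_on {0..T}) = ennreal (energy m \<tau> \<xi> w)"
proof -
  have mono: "\<forall>i<m. \<tau> i \<le> \<tau> (Suc i)" using S by (simp add: simple_process_def)
  have "(\<integral>\<^sup>+t. ennreal ((simple_value m \<tau> \<xi> t w)\<^sup>2) \<partial>lborel_on {0..T})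
    = (\<integral>\<^sup>+t. (\<Sum>i<m. ennreal ((\<xi> i w)\<^sup>2) * indicator {\<tau> i<..\<tau> (Suc i)} t) \<partial>lborel_on {0..T})"
    by (intro nn_integral_cong)
      (simp add: simple_value_square[OF mono] sum_ennreal[symmetric] ennreal_mult ennreal_indicator del: sum_ennreal)
  also have "\<dots> = (\<Sum>i<m. ennreal ((\<xi> i w)\<^sup>2) * emeasure (lborel_on {0..T}) {\<tau> i<..\<tau> (Suc i)})"
    by (subst nn_integral_sum) (auto simp: nn_integral_cmult_indicator)
  also have "\<dots> = (\<Sum>i<m. ennreal ((\<xi> i w)\<^sup>2 * (\<tau> (Suc i) - \<tau> i)))"
  proof (rule sum.cong[OF refl])
    fix i assume "i \<in> {..<m}"
    then have i: "i < m" by simp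
    have le: "0 \<le> \<tau> i" "\<tau> i \<le> \<tau> (Suc i)" "\<tau> (Suc i) \<le> T"
      using simple_process_nonneg[OF S, of i] simple_process_nonneg[OF S, of "Suc i"] i mono by auto
    have "{0..T} \<inter> {\<tau> i<..\<tau> (Suc i)} = {\<tau> i<..\<tau> (Suc i)}" using le by auto
    then have "emeasure (lborel_on {0..T}) {\<tau> i<..\<tau> (Suc i)} = ennreal (\<tau> (Suc i) - \<tau> i)"
      using le by (simp add: emeasure_lborel_on)
    then show "ennreal ((\<xi> i w)\<^sup>2) * emeasure (lborel_on {0..T}) {\<tau> i<..\<tau> (Suc i)}
      = ennreal ((\<xi> i w)\<^sup>2 * (\<tau> (Suc i) - \<tau> i))"
      using le by (simp add: ennreal_mult)
  qed
  also have "\<dots> = ennreal (energy m \<tau> \<xi> w)"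
    unfolding energy_def by (rule sum_ennreal) (use mono in simp)
  finally show ?thesis .
qed

text \<open>Cutting both endpoints at r handles every position of r relative to the interval. The
  same difference of minima is the covariance of a Wiener increment with \<open>W r\<close>, which
  is how the two sides meet in \<open>expectation_simple_integral_mult_W\<close>.\<close>

lemma integral_simple_value:
  assumes S: "simple_process M F T m \<tau> \<xi>"
  shows "(\<integral>t. indicator {..r} t * simple_value m \<tau> \<xi> t w \<partial>lborel_on {0..T})
    = (\<Sum>i<m. \<xi> i w * (min (\<tau> (Suc i)) r - min (\<tau> i) r))"
proof -
  interpret finite_measure "lborel_on {0..T}" by (rule finite_measure_lborel_on_Icc)
  have mono: "\<forall>i<m. \<tau> i \<le> \<tau> (Suc i)" using S by (simp add: simple_process_def)
  have "(\<integral>t. indicator {..r} t * simple_value m \<tau> \<xi> t w \<partial>lborel_on {0..T})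
    = (\<integral>t. (\<Sum>i<m. \<xi> i w * indicator ({\<tau> i<..\<tau> (Suc i)} \<inter> {..r}) t) \<partial>lborel_on {0..T})"
    unfolding simple_value_def
    by (intro Bochner_Integration.integral_cong refl)
      (auto simp: sum_distrib_left indicator_def intro!: sum.cong)
  also have "\<dots> = (\<Sum>i<m. \<xi> i w * measure (lborel_on {0..T}) ({\<tau> i<..\<tau> (Suc i)} \<inter> {..r}))"
    by (subst Bochner_Integration.integral_sum)
      (auto intro!: integrable_mult_right integrable_real_indicator simp: emeasure_eq_measure)
  also have "\<dots> = (\<Sum>i<m. \<xi> i w * (min (\<tau> (Suc i)) r - min (\<tau> i) r))"
  proof (rule sum.cong[OF refl])
    fix i assume "i \<in> {..<m}"
    then have i: "i < m" by simp
    have le: "0 \<le> \<tau> i" "\<tau> i \<le> \<tau> (Suc i)" "\<tau> (Suc i) \<le> T"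
      using simple_process_nonneg[OF S, of i] simple_process_nonneg[OF S, of "Suc i"] i mono by auto
    have "{0..T} \<inter> ({\<tau> i<..\<tau> (Suc i)} \<inter> {..r}) = {min (\<tau> i) r<..min (\<tau> (Suc i)) r}"
      using le by auto
    then have "emeasure (lborel_on {0..T}) ({\<tau> i<..\<tau> (Suc i)} \<inter> {..r})
      = ennreal (min (\<tau> (Suc i)) r - min (\<tau> i) r)"
      using le by (simp add: emeasure_lborel_on)
    then have "measure (lborel_on {0..T}) ({\<tau> i<..\<tau> (Suc i)} \<inter> {..r}) = min (\<tau> (Suc i)) r - min (\<tau> i) r"
      using le by (simp add: measure_def)
    then show "\<xi> i w * measure (lborel_on {0..T}) ({\<tau> i<..\<tau> (Suc i)} \<inter> {..r})
        = \<xi> i w * (min (\<tau> (Suc i)) r - min (\<tau> i) r)" by simp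
  qed
  finally show ?thesis .
qed

section \<open>Wiener increments and the Ito isometry for simple processes\<close>

locale wiener_space = prob_space M for M :: "'w measure" +
  fixes F :: "real \<Rightarrow> 'w measure" and W :: "real \<Rightarrow> 'w \<Rightarrow> real"
  assumes filtered: "filtered_prob_space M F" and wiener: "wiener_process M F W"
begin

lemma subalgebra_F: "subalgebra M (F t)"
  using filtered by (simp add: filtered_prob_space_def)

lemma measurable_F: "f \<in> borel_measurable (F t) \<Longrightarrow> f \<in> borel_measurable M"
  using measurable_from_subalg[OF subalgebra_F] by blast

lemma measurable_F_mono:
  assumes "s \<le> t" "f \<in> borel_measurable (F s)"
  shows "f \<in> borel_measurable (F t)"
proof -
  interpret filtration "space M" F using filtered by (simp add: filtered_prob_space_def)
  have "subalgebra (F t) (F s)"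
    using sets_F_mono[OF assms(1)] by (simp add: subalgebra_def space_F)
  then show ?thesis using measurable_from_subalg assms(2) by blast
qed

lemma measurable_W: "0 \<le> s \<Longrightarrow> s \<le> t \<Longrightarrow> W s \<in> borel_measurable (F t)"
  using wiener measurable_F_mono[of s t "W s"] by (auto simp: wiener_process_def)

lemma W_measurable[measurable]: "0 \<le> s \<Longrightarrow> W s \<in> borel_measurable M"
  using measurable_W[of s s] measurable_F by auto

text \<open>The case s = t is treated apart because the law of an increment is prescribed only for s
  < t.\<close>

lemma
  assumes "0 \<le> s" "s \<le> t"
  shows square_integrable_increment: "square_integrable M (\<lambda>w. W t w - W s w)"
    and expectation_increment: "expectation (\<lambda>w. W t w - W s w) = 0"
    and expectation_increment_square: "expectation (\<lambda>w. (W t w - W s w)\<^sup>2) = t - s"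
proof -
  have "square_integrable M (\<lambda>w. W t w - W s w) \<and> expectation (\<lambda>w. W t w - W s w) = 0
    \<and> expectation (\<lambda>w. (W t w - W s w)\<^sup>2) = t - s"
  proof (cases "s = t")
    case True
    then show ?thesis by (simp add: square_integrable_def)
  next
    case False
    then have st: "s < t" using assms by simp
    have D: "distributed M lborel (\<lambda>w. W t w - W s w) (normal_density 0 (sqrt (t - s)))"
      using wiener assms st by (auto simp: wiener_process_def)
    have sg: "0 < sqrt (t - s)" using st by simp
    have e: "expectation (\<lambda>w. W t w - W s w) = 0"
      using normal_distributed_expectation[OF sg D] .
    have v: "expectation (\<lambda>w. (W t w - W s w)\<^sup>2) = t - s"
      using normal_distributed_variance[OF sg D] st by (simp add: e)
    have "integrable lborel (\<lambda>x. normal_density 0 (sqrt (t - s)) x * x\<^sup>2)"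
      using integrable_normal_moment[OF sg, of 0 2] by simp
    then have "integrable M (\<lambda>w. (W t w - W s w)\<^sup>2)"
      using distributed_integrable[OF D, of "\<lambda>x. x\<^sup>2"] by simp
    moreover have "(\<lambda>w. W t w - W s w) \<in> borel_measurable M"
      using assms by (intro borel_measurable_diff W_measurable) auto
    ultimately show ?thesis using e v by (simp add: square_integrable_def)
  qed
  then show "square_integrable M (\<lambda>w. W t w - W s w)" "expectation (\<lambda>w. W t w - W s w) = 0"
    "expectation (\<lambda>w. (W t w - W s w)\<^sup>2) = t - s" by auto
qed

lemma indep_var_increment:
  assumes "0 \<le> s" "s < t" and X: "X \<in> borel_measurable (F s)"
  shows "indep_var borel X borel (\<lambda>w. W t w - W s w)"
  unfolding indep_var_eq
proof (intro conjI)
  show Xm: "X \<in> borel_measurable M" using measurable_F X by blast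
  show Wm: "(\<lambda>w. W t w - W s w) \<in> borel_measurable M"
    using assms by (intro borel_measurable_diff W_measurable) auto
  have ind: "indep_set (sets (F s)) (sets (vimage_algebra (space M) (\<lambda>w. W t w - W s w) borel))"
    using wiener assms by (auto simp: wiener_process_def)
  have sp: "space (F s) = space M" using subalgebra_F by (simp add: subalgebra_def)
  have sub: "sigma_sets (space M) {X -` A \<inter> space M |A. A \<in> sets borel} \<subseteq> sets (F s)"
    using sets.sigma_sets_subset[of "{X -` A \<inter> space M |A. A \<in> sets borel}" "F s"] measurable_sets[OF X] sp
    by auto
  show "indep_set (sigma_sets (space M) {X -` A \<inter> space M |A. A \<in> sets borel})
     (sigma_sets (space M) {(\<lambda>w. W t w - W s w) -` A \<inter> space M |A. A \<in> sets borel})"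
    using ind sub unfolding indep_sets2_eq sets_vimage_algebra by blast
qed

text \<open>The conditional mean and variance of an increment given \<open>F s\<close>, tested
  against \<open>F s\<close>-measurable variables; this form takes the place of conditional
  expectations.\<close>

lemma
  assumes "0 \<le> s" "s \<le> t" and X: "X \<in> borel_measurable (F s)" "integrable M X"
  shows integrable_mult_increment: "integrable M (\<lambda>w. X w * (W t w - W s w))"
    and expectation_mult_increment: "expectation (\<lambda>w. X w * (W t w - W s w)) = 0"
    and integrable_mult_increment_square: "integrable M (\<lambda>w. X w * (W t w - W s w)\<^sup>2)"
    and expectation_mult_increment_square:
      "expectation (\<lambda>w. X w * (W t w - W s w)\<^sup>2) = expectation X * (t - s)"
proof -
  note sq = square_integrable_increment[OF assms(1,2)]
  have "integrable M (\<lambda>w. X w * (W t w - W s w)) \<and> expectation (\<lambda>w. X w * (W t w - W s w)) = 0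
    \<and> integrable M (\<lambda>w. X w * (W t w - W s w)\<^sup>2)
    \<and> expectation (\<lambda>w. X w * (W t w - W s w)\<^sup>2) = expectation X * (t - s)"
  proof (cases "s = t")
    case False
    then have st: "s < t" using assms by simp
    note iv = indep_var_increment[OF assms(1) st X(1)]
    have iv2: "indep_var borel X borel (\<lambda>w. (W t w - W s w)\<^sup>2)"
      using indep_var_compose[OF iv, of "\<lambda>x. x" borel "\<lambda>x. x\<^sup>2" borel] by (simp add: comp_def)
    show ?thesis
      using indep_var_integrable[OF iv X(2)] indep_var_lebesgue_integral[OF iv X(2)]
        indep_var_integrable[OF iv2 X(2)] indep_var_lebesgue_integral[OF iv2 X(2)]
        square_integrable_integrable[OF sq] square_integrable_square[OF sq]
        expectation_increment[OF assms(1,2)] expectation_increment_square[OF assms(1,2)]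
      by simp
  qed simp
  then show "integrable M (\<lambda>w. X w * (W t w - W s w))" "expectation (\<lambda>w. X w * (W t w - W s w)) = 0"
    "integrable M (\<lambda>w. X w * (W t w - W s w)\<^sup>2)"
    "expectation (\<lambda>w. X w * (W t w - W s w)\<^sup>2) = expectation X * (t - s)" by auto
qed

lemma
  assumes "0 \<le> t"
  shows square_integrable_W: "square_integrable M (W t)"
    and expectation_W: "expectation (W t) = 0"
proof -
  have ae: "AE w in M. W t w - W 0 w = W t w" using wiener by (auto simp: wiener_process_def)
  show "square_integrable M (W t)"
    using assms by (intro square_integrable_cong_AE[OF square_integrable_increment[of 0 t] ae]) auto
  have "expectation (W t) = expectation (\<lambda>w. W t w - W 0 w)"
    using ae assms by (intro integral_cong_AE) auto
  then show "expectation (W t) = 0" using expectation_increment[of 0 t] assms by simp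
qed

text \<open>For r \<le> u the variable \<open>X w * W r w\<close> is known at time u and the
  increment has mean 0. For r > u, write \<open>W r\<close> as \<open>W u\<close> plus an increment:
  the first part again contributes nothing, and the second meets the increment from u to v only on
  the overlap, which ends at \<open>min v r\<close>.\<close>

lemma
  assumes uv: "0 \<le> u" "u \<le> v" and r: "0 \<le> r"
    and X: "X \<in> borel_measurable (F u)" "\<And>w. w \<in> space M \<Longrightarrow> \<bar>X w\<bar> \<le> B"
  shows expectation_increment_mult_W:
    "expectation (\<lambda>w. X w * (W v w - W u w) * W r w) = expectation X * (min v r - min u r)"
proof -
  have Xm[measurable]: "X \<in> borel_measurable M" using measurable_F X by blast
  have intX: "integrable M X" by (rule integrable_const_bound[where B=B]) (use X in auto)
  have XY: "integrable M (\<lambda>w. X w * Y w)" if "square_integrable M Y" for Y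
    using square_integrable_integrable[OF square_integrable_bounded_mult[OF that Xm X(2)]] by simp
  show ?thesis
  proof (cases "r \<le> u")
    case True
    have "expectation (\<lambda>w. (X w * W r w) * (W v w - W u w)) = 0"
      using X measurable_W[OF r True] XY[OF square_integrable_W[OF r]]
      by (intro expectation_mult_increment uv) auto
    then show ?thesis using True uv by (simp add: min_def mult.assoc mult.commute mult.left_commute)
  next
    case False
    \<comment> \<open>The increments from u to v and from u to r are those from u to p and from u to
      q in some order, so ordering the endpoints spares a case distinction between v and r.\<close>
    define p q where "p = min v r" and "q = max v r"
    have pq: "u \<le> p" "p \<le> q" "0 \<le> p" using False uv by (auto simp: p_def q_def)
    have Xp: "X \<in> borel_measurable (F p)" using measurable_F_mono pq X by blast
    have up: "square_integrable M (\<lambda>w. W p w - W u w)" by (rule square_integrable_increment) (use uv pq in auto)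
    have m1: "(\<lambda>w. X w * W u w) \<in> borel_measurable (F u)" using X(1) measurable_W[of u u] uv by measurable
    have m2: "(\<lambda>w. X w * (W p w - W u w)) \<in> borel_measurable (F p)"
      using Xp measurable_W[of u p] measurable_W[of p p] uv pq by measurable
    note a = integrable_mult_increment_square[OF uv(1) pq(1) X(1) intX]
      expectation_mult_increment_square[OF uv(1) pq(1) X(1) intX]
    note b = integrable_mult_increment[OF pq(3,2) m2 XY[OF up]] expectation_mult_increment[OF pq(3,2) m2 XY[OF up]]
    note c = integrable_mult_increment[OF uv m1 XY[OF square_integrable_W[OF uv(1)]]]
       expectation_mult_increment[OF uv m1 XY[OF square_integrable_W[OF uv(1)]]]
    have "expectation (\<lambda>w. X w * (W v w - W u w) * W r w)
      = expectation (\<lambda>w. X w * (W p w - W u w)\<^sup>2 + X w * (W p w - W u w) * (W q w - W p w)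
          + X w * W u w * (W v w - W u w))"
    proof (rule Bochner_Integration.integral_cong[OF refl])
      fix w
      have "(W v w - W u w) * (W r w - W u w) = (W p w - W u w) * (W q w - W u w)"
        by (simp add: p_def q_def min_def max_def mult.commute)
      then have "X w * ((W v w - W u w) * (W r w - W u w)) = X w * ((W p w - W u w) * (W q w - W u w))"
        by simp
      then show "X w * (W v w - W u w) * W r w = X w * (W p w - W u w)\<^sup>2
          + X w * (W p w - W u w) * (W q w - W p w) + X w * W u w * (W v w - W u w)"
        by (simp add: algebra_simps power2_eq_square)
    qed
    also have "\<dots> = expectation X * (p - u)"
      using a b c by simp
    finally show ?thesis using False by (simp add: p_def min_def)
  qed
qed

text \<open>The Ito isometry, by induction on the number of intervals: the partial integral and the
  next coefficient are known at the left endpoint of the next increment, so the cross term has mean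
  0. Adaptedness and integrability are part of the induction because the next step uses
  them.\<close>

lemma simple_integral_facts:
  assumes S: "simple_process M F T m \<tau> \<xi>" and "k \<le> m"
  shows "simple_integral W k \<tau> \<xi> \<in> borel_measurable (F (\<tau> k))
    \<and> square_integrable M (simple_integral W k \<tau> \<xi>)
    \<and> integrable M (energy k \<tau> \<xi>)
    \<and> expectation (\<lambda>w. (simple_integral W k \<tau> \<xi> w)\<^sup>2) = expectation (energy k \<tau> \<xi>)"
  using assms(2)
proof (induction k)
  case 0
  have "simple_integral W 0 \<tau> \<xi> = (\<lambda>w. 0)" "energy 0 \<tau> \<xi> = (\<lambda>w. 0)"
    by (simp_all add: simple_integral_def energy_def fun_eq_iff)
  then show ?case by (simp add: square_integrable_def)
next
  case (Suc k)
  let ?J = "simple_integral W k \<tau> \<xi>"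
  let ?D = "\<lambda>w. W (\<tau> (Suc k)) w - W (\<tau> k) w"
  have IH: "?J \<in> borel_measurable (F (\<tau> k))" "square_integrable M ?J" "integrable M (energy k \<tau> \<xi>)"
    "expectation (\<lambda>w. (?J w)\<^sup>2) = expectation (energy k \<tau> \<xi>)" using Suc by auto
  have t: "0 \<le> \<tau> k" "\<tau> k \<le> \<tau> (Suc k)"
    using simple_process_nonneg[OF S, of k] simple_process_mono[OF S, of k "Suc k"] Suc.prems by auto
  obtain B where xm: "\<xi> k \<in> borel_measurable (F (\<tau> k))" and B: "\<And>w. w \<in> space M \<Longrightarrow> \<bar>\<xi> k w\<bar> \<le> B"
    using S Suc.prems unfolding simple_process_def by (metis Suc_le_eq)
  have xM: "\<xi> k \<in> borel_measurable M" using measurable_F xm by blast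
  have sqD: "square_integrable M ?D" by (rule square_integrable_increment[OF t])
  have sqx: "square_integrable M (\<lambda>w. \<xi> k w * ?D w)"
    by (rule square_integrable_bounded_mult[OF sqD xM B])
  have sqx1: "square_integrable M (\<xi> k)"
    using square_integrable_bounded_mult[OF square_integrable_const[of 1] xM B] by simp
  have rec: "simple_integral W (Suc k) \<tau> \<xi> = (\<lambda>w. ?J w + \<xi> k w * ?D w)"
    by (simp add: simple_integral_def fun_eq_iff)
  have recE: "energy (Suc k) \<tau> \<xi> = (\<lambda>w. energy k \<tau> \<xi> w + (\<xi> k w)\<^sup>2 * (\<tau> (Suc k) - \<tau> k))"
    by (simp add: energy_def fun_eq_iff)
  have m: "(\<lambda>w. ?J w + \<xi> k w * ?D w) \<in> borel_measurable (F (\<tau> (Suc k)))"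
    using measurable_F_mono[OF t(2) IH(1)] measurable_F_mono[OF t(2) xm] measurable_W[OF t]
      measurable_W[OF order_trans[OF t] order_refl]
    by (intro borel_measurable_add borel_measurable_times borel_measurable_diff)
  have m1: "(\<lambda>w. ?J w * \<xi> k w) \<in> borel_measurable (F (\<tau> k))" using IH(1) xm by measurable
  have m2: "(\<lambda>w. (\<xi> k w)\<^sup>2) \<in> borel_measurable (F (\<tau> k))" using xm by measurable
  have i1: "integrable M (\<lambda>w. ?J w * \<xi> k w)" by (rule square_integrable_mult[OF IH(2) sqx1])
  note i2 = square_integrable_square[OF sqx1]
  note c = integrable_mult_increment[OF t m1 i1] expectation_mult_increment[OF t m1 i1]
    integrable_mult_increment_square[OF t m2 i2] expectation_mult_increment_square[OF t m2 i2]
  have "expectation (\<lambda>w. (?J w + \<xi> k w * ?D w)\<^sup>2)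
    = expectation (\<lambda>w. (?J w)\<^sup>2 + 2 * (?J w * \<xi> k w * ?D w) + (\<xi> k w)\<^sup>2 * (?D w)\<^sup>2)"
    by (intro Bochner_Integration.integral_cong refl) (simp add: power2_eq_square algebra_simps)
  also have "\<dots> = expectation (energy k \<tau> \<xi>) + expectation (\<lambda>w. (\<xi> k w)\<^sup>2) * (\<tau> (Suc k) - \<tau> k)"
    using c IH(4) square_integrable_square[OF IH(2)] by simp
  also have "\<dots> = expectation (energy (Suc k) \<tau> \<xi>)"
    unfolding recE using IH(3) i2 by simp
  finally show ?case
    using m square_integrable_add[OF IH(2) sqx] IH(3) i2 unfolding rec recE by simp
qed

text \<open>The polarised isometry, with \<open>W r\<close> in the role of the integral of the
  indicator of (0,r].\<close>

lemma expectation_simple_integral_mult_W: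
  assumes S: "simple_process M F T m \<tau> \<xi>" and r: "0 \<le> r"
  shows "expectation (\<lambda>w. simple_integral W m \<tau> \<xi> w * W r w)
    = expectation (\<lambda>w. \<integral>t. indicator {..r} t * simple_value m \<tau> \<xi> t w \<partial>lborel_on {0..T})"
proof -
  have *: "integrable M (\<lambda>w. \<xi> i w * (W (\<tau> (Suc i)) w - W (\<tau> i) w) * W r w) \<and>
      integrable M (\<xi> i) \<and>
      expectation (\<lambda>w. \<xi> i w * (W (\<tau> (Suc i)) w - W (\<tau> i) w) * W r w)
      = expectation (\<xi> i) * (min (\<tau> (Suc i)) r - min (\<tau> i) r)" if i: "i < m" for i
  proof -
    have t: "0 \<le> \<tau> i" "\<tau> i \<le> \<tau> (Suc i)"
      using simple_process_nonneg[OF S, of i] simple_process_mono[OF S, of i "Suc i"] i by auto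
    obtain B where xm: "\<xi> i \<in> borel_measurable (F (\<tau> i))" and B: "\<And>w. w \<in> space M \<Longrightarrow> \<bar>\<xi> i w\<bar> \<le> B"
      using S i unfolding simple_process_def by metis
    have xM: "\<xi> i \<in> borel_measurable M" using measurable_F xm by blast
    have "square_integrable M (\<lambda>w. \<xi> i w * (W (\<tau> (Suc i)) w - W (\<tau> i) w))"
      by (rule square_integrable_bounded_mult[OF square_integrable_increment[OF t] xM B])
    then have "integrable M (\<lambda>w. \<xi> i w * (W (\<tau> (Suc i)) w - W (\<tau> i) w) * W r w)"
      by (rule square_integrable_mult[OF _ square_integrable_W[OF r]])
    moreover have "integrable M (\<xi> i)"
      by (rule integrable_const_bound[where B=B]) (use xM B in auto)
    ultimately show ?thesis using expectation_increment_mult_W[OF t r xm B] by simp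
  qed
  have "expectation (\<lambda>w. simple_integral W m \<tau> \<xi> w * W r w)
    = (\<Sum>i<m. expectation (\<xi> i) * (min (\<tau> (Suc i)) r - min (\<tau> i) r))"
    unfolding simple_integral_def sum_distrib_right
    using * by (subst Bochner_Integration.integral_sum) auto
  also have "\<dots> = expectation (\<lambda>w. \<integral>t. indicator {..r} t * simple_value m \<tau> \<xi> t w \<partial>lborel_on {0..T})"
    unfolding integral_simple_value[OF S]
    using * by (subst Bochner_Integration.integral_sum) auto
  finally show ?thesis .
qed

text \<open>Stopping preserves adaptedness: the energy tested on interval i involves only the
  coefficients with index j \<le> i, all measurable with respect to
  \<open>F (\<tau> i)\<close>.\<close>

lemma simple_process_truncate_coeff:
  assumes S: "simple_process M F T m \<tau> \<xi>"
  shows "simple_process M F T m \<tau> (truncate_coeff \<tau> \<xi> L)"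
  unfolding simple_process_def
proof (intro conjI allI impI)
  show "\<tau> 0 = 0" "\<tau> m = T" using S by (auto simp: simple_process_def)
  show "\<tau> i \<le> \<tau> (Suc i)" if "i < m" for i using S that by (auto simp: simple_process_def)
  fix i assume i: "i < m"
  have "\<xi> j \<in> borel_measurable (F (\<tau> i))" if "j \<le> i" for j
    using S i that simple_process_mono[OF S, of j i] measurable_F_mono[of "\<tau> j" "\<tau> i" "\<xi> j"]
    by (auto simp: simple_process_def)
  then have [measurable]: "energy (Suc i) \<tau> \<xi> \<in> borel_measurable (F (\<tau> i))" "\<xi> i \<in> borel_measurable (F (\<tau> i))"
    unfolding energy_def by (auto intro!: borel_measurable_sum borel_measurable_times borel_measurable_power simp: less_Suc_eq_le)
  show "truncate_coeff \<tau> \<xi> L i \<in> borel_measurable (F (\<tau> i))"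
    unfolding truncate_coeff_def by measurable
  obtain B where "\<And>w. w \<in> space M \<Longrightarrow> \<bar>\<xi> i w\<bar> \<le> B"
    using S i unfolding simple_process_def by metis
  then show "\<exists>B. \<forall>w\<in>space M. \<bar>truncate_coeff \<tau> \<xi> L i w\<bar> \<le> B"
    unfolding truncate_coeff_def by (intro exI[of _ "\<bar>B\<bar>"]) (auto intro: order_trans abs_ge_self)
qed

end

section \<open>The correlation of an It\^o integral with the Wiener process\<close>

lemma power2_diff_le: "(x - y)\<^sup>2 \<le> 2 * x\<^sup>2 + 2 * (y::real)\<^sup>2"
  using zero_le_power2[of "x + y"] by (simp add: power2_sum power2_diff)

lemma (in prob_space) expectation_square_diff_le:
  assumes "square_integrable M f" "square_integrable M g"
  shows "expectation (\<lambda>w. (f w - g w)\<^sup>2) \<le> 2 * expectation (\<lambda>w. (f w)\<^sup>2) + 2 * expectation (\<lambda>w. (g w)\<^sup>2)"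
proof -
  have "expectation (\<lambda>w. (f w - g w)\<^sup>2) \<le> expectation (\<lambda>w. 2 * (f w)\<^sup>2 + 2 * (g w)\<^sup>2)"
    using assms square_integrable_diff[OF assms]
    by (intro integral_mono power2_diff_le) (auto simp: square_integrable_def)
  then show ?thesis using assms by (simp add: square_integrable_def)
qed

lemma (in prob_space) square_integrable_of_nn_integral:
  assumes "f \<in> borel_measurable M" "(\<integral>\<^sup>+w. ennreal ((f w)\<^sup>2) \<partial>M) \<le> ennreal C" "0 \<le> C"
  shows "square_integrable M f" "expectation (\<lambda>w. (f w)\<^sup>2) \<le> C"
proof -
  have "integrable M (\<lambda>w. (f w)\<^sup>2)"
    using assms by (intro integrableI_bounded) (auto simp: le_less_trans[OF _ ennreal_less_top])
  then show "square_integrable M f" using assms by (simp add: square_integrable_def)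
  show "expectation (\<lambda>w. (f w)\<^sup>2) \<le> C" using assms by (intro integral_real_bounded) auto
qed

lemma (in prob_space) nn_integral_square_eq:
  "square_integrable M f \<Longrightarrow> (\<integral>\<^sup>+w. ennreal ((f w)\<^sup>2) \<partial>M) = ennreal (expectation (\<lambda>w. (f w)\<^sup>2))"
  by (auto simp: square_integrable_def nn_integral_eq_integral)

lemma (in prob_space) tendsto_of_expectation_abs_diff:
  fixes f :: "nat \<Rightarrow> 'a \<Rightarrow> real"
  assumes lim: "(\<lambda>k. expectation (\<lambda>w. \<bar>f k w - g w\<bar>)) \<longlonglongrightarrow> 0"
    and int: "\<And>k. integrable M (f k)" "integrable M g"
  shows "(\<lambda>k. expectation (f k)) \<longlonglongrightarrow> expectation g"
proof (rule Lim_transform2[OF tendsto_const], rule Lim_null_comparison[OF _ lim], intro always_eventually allI)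
  fix k
  have "norm (expectation (\<lambda>w. g w - f k w)) \<le> expectation (\<lambda>w. norm (g w - f k w))"
    by (rule integral_norm_bound)
  then show "norm (expectation g - expectation (f k)) \<le> expectation (\<lambda>w. \<bar>f k w - g w\<bar>)"
    using int by (simp add: abs_minus_commute)
qed

lemma integrable_indicator_mult:
  fixes f :: "'b \<Rightarrow> real"
  shows "A \<in> sets M \<Longrightarrow> integrable M f \<Longrightarrow> integrable M (\<lambda>x. indicator A x * f x)"
  using integrable_real_mult_indicator[of A M f] by (simp add: mult.commute)

context wiener_space begin

text \<open>The approximating simple processes of an It\^o integral converge only in probability.
  Stopping them as soon as their energy exceeds a level \<open>L\<close> changes them on a small event only and
  bounds their energy in mean, so that the limit can be taken in the pairing with \<open>W r\<close>.\<close>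

lemma expectation_ito_integral_mult_W:
  assumes I: "has_ito_integral M F W g T J" and T: "0 \<le> T" and r: "0 \<le> r"
    and J: "square_integrable M J"
    and fin: "(\<integral>\<^sup>+w. \<integral>\<^sup>+t. ennreal ((g t w)\<^sup>2) \<partial>lborel_on {0..T} \<partial>M) < \<infinity>"
  shows "expectation (\<lambda>w. J w * W r w)
    = expectation (\<lambda>w. \<integral>t. indicator {..r} t * g t w \<partial>lborel_on {0..T})"
proof -
  let ?\<nu> = "lborel_on {0..T}"
  interpret \<nu>: finite_measure ?\<nu> by (rule finite_measure_lborel_on_Icc)
  have mT: "measure ?\<nu> (space ?\<nu>) = T" using measure_lborel_on_Icc[OF T] by simp
  have gm: "(\<lambda>(t, w). g t w) \<in> borel_measurable (lborel \<Otimes>\<^sub>M M)"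
    using I by (simp add: has_ito_integral_def)
  have gm': "(\<lambda>(t, w). g t w) \<in> borel_measurable (?\<nu> \<Otimes>\<^sub>M M)"
    using gm by (simp cong: measurable_cong_sets sets_pair_measure_cong)
  have g2[measurable]: "(\<lambda>(w, t). g t w) \<in> borel_measurable (M \<Otimes>\<^sub>M ?\<nu>)"
    using measurable_compose[OF measurable_pair_swap' gm'] by (simp add: case_prod_beta' comp_def)
  have g1: "(\<lambda>t. g t w) \<in> borel_measurable borel" if "w \<in> space M" for w
    using measurable_Pair2[OF g2 that] by (simp cong: measurable_cong_sets)
  have g1': "(\<lambda>t. g t w) \<in> borel_measurable ?\<nu>" if "w \<in> space M" for w
    using g1[OF that] by (simp cong: measurable_cong_sets)
  obtain m \<tau> \<xi> where
    S: "\<And>n. simple_process M F T (m n) (\<tau> n) (\<xi> n)" and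
    D0: "\<And>\<epsilon>. \<epsilon> > 0 \<Longrightarrow> (\<lambda>n. measure M {w \<in> space M.
             ennreal \<epsilon> < (\<integral>\<^sup>+t\<in>{0..T}.
                ennreal ((simple_value (m n) (\<tau> n) (\<xi> n) t w - g t w)\<^sup>2) \<partial>lborel)}) \<longlonglongrightarrow> 0" and
    J0: "\<And>\<epsilon>. \<epsilon> > 0 \<Longrightarrow> (\<lambda>n. measure M {w \<in> space M.
             \<epsilon> < \<bar>simple_integral W (m n) (\<tau> n) (\<xi> n) w - J w\<bar>}) \<longlonglongrightarrow> 0"
    using I unfolding has_ito_integral_def by blast
  define D where "D n w = (\<integral>\<^sup>+t. ennreal ((simple_value (m n) (\<tau> n) (\<xi> n) t w - g t w)\<^sup>2) \<partial>?\<nu>)" for n w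
  define Q where "Q w = (\<integral>\<^sup>+t. ennreal ((g t w)\<^sup>2) \<partial>?\<nu>)" for w
  have Qm[measurable]: "Q \<in> borel_measurable M" unfolding Q_def by measurable
  define G where "G = enn2real (\<integral>\<^sup>+w. Q w \<partial>M)"
  have G: "0 \<le> G" "(\<integral>\<^sup>+w. Q w \<partial>M) = ennreal G"
    using fin unfolding G_def Q_def by (simp_all add: ennreal_enn2real less_top)
  have svm: "(\<lambda>t. simple_value k \<sigma> \<zeta> t w) \<in> borel_measurable borel" for k \<sigma> and \<zeta> :: "nat \<Rightarrow> 'w \<Rightarrow> real" and w
    unfolding simple_value_def by measurable
  have svm': "(\<lambda>t. simple_value k \<sigma> \<zeta> t w) \<in> borel_measurable ?\<nu>" for k \<sigma> and \<zeta> :: "nat \<Rightarrow> 'w \<Rightarrow> real" and w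
    using svm by (simp cong: measurable_cong_sets)
  have svm2: "(\<lambda>(w, t). simple_value k \<sigma> \<zeta> t w) \<in> borel_measurable (M \<Otimes>\<^sub>M ?\<nu>)"
    if "simple_process M F T k \<sigma> \<zeta>" for k \<sigma> \<zeta>
  proof -
    have "\<zeta> i \<in> borel_measurable M" if "i < k" for i
      using \<open>simple_process M F T k \<sigma> \<zeta>\<close> that measurable_F by (auto simp: simple_process_def)
    then have "(\<lambda>p. \<zeta> i (fst p) * indicator {\<sigma> i<..\<sigma> (Suc i)} (snd p)) \<in> borel_measurable (M \<Otimes>\<^sub>M ?\<nu>)"
      if "i < k" for i using that by measurable
    then show ?thesis unfolding simple_value_def case_prod_beta' by (intro borel_measurable_sum) auto
  qed
  have Dm[measurable]: "D n \<in> borel_measurable M" for n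
  proof -
    note [measurable] = svm2[OF S[of n]]
    show ?thesis unfolding D_def by measurable
  qed
  have D1: "(\<lambda>n. prob {w \<in> space M. ennreal \<epsilon> < D n w}) \<longlonglongrightarrow> 0" if "0 < \<epsilon>" for \<epsilon>
  proof -
    have "{w \<in> space M. ennreal \<epsilon> < D n w} = {w \<in> space M. ennreal \<epsilon> < (\<integral>\<^sup>+t\<in>{0..T}.
                ennreal ((simple_value (m n) (\<tau> n) (\<xi> n) t w - g t w)\<^sup>2) \<partial>lborel)}" for n
      unfolding D_def using g1 svm by (intro Collect_cong conj_cong refl) (subst nn_integral_lborel_on; simp)
    then show ?thesis using D0[OF that] by simp
  qed
  \<comment> \<open>A subsequence with an explicit rate: 1 / (k + 1) is both the tolerance and the
    bound on the probability of exceeding it.\<close>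
  have "\<forall>k. \<exists>n. prob {w \<in> space M. ennreal (1 / real (Suc k)) < D n w} \<le> 1 / real (Suc k)
     \<and> prob {w \<in> space M. 1 / real (Suc k) < \<bar>simple_integral W (m n) (\<tau> n) (\<xi> n) w - J w\<bar>} \<le> 1 / real (Suc k)"
  proof
    fix k
    have p: "0 < 1 / real (Suc k)" by simp
    have "\<forall>\<^sub>F n in sequentially. prob {w \<in> space M. ennreal (1 / real (Suc k)) < D n w} < 1 / real (Suc k)
     \<and> prob {w \<in> space M. 1 / real (Suc k) < \<bar>simple_integral W (m n) (\<tau> n) (\<xi> n) w - J w\<bar>} < 1 / real (Suc k)"
      using order_tendstoD(2)[OF D1[OF p] p] order_tendstoD(2)[OF J0[OF p] p] by (rule eventually_conj)
    then show "\<exists>n. prob {w \<in> space M. ennreal (1 / real (Suc k)) < D n w} \<le> 1 / real (Suc k)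
     \<and> prob {w \<in> space M. 1 / real (Suc k) < \<bar>simple_integral W (m n) (\<tau> n) (\<xi> n) w - J w\<bar>} \<le> 1 / real (Suc k)"
      by (auto simp: eventually_sequentially intro: less_imp_le)
  qed
  from choice[OF this] obtain n where
    nA: "\<And>k. prob {w \<in> space M. ennreal (1 / real (Suc k)) < D (n k) w} \<le> 1 / real (Suc k)" and
    nB: "\<And>k. prob {w \<in> space M. 1 / real (Suc k) < \<bar>simple_integral W (m (n k)) (\<tau> (n k)) (\<xi> (n k)) w - J w\<bar>} \<le> 1 / real (Suc k)"
    by blast
  \<comment> \<open>The stopping level tends to infinity, but only as fast as the exceptional
    probabilities decrease, so that \<open>L k * prob (A k) \<le> 1\<close>.\<close>
  define L where "L k = real (Suc k)" for k
  have L: "1 \<le> L k" "0 < L k" for k by (simp_all add: L_def)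
  define \<eta> where "\<eta> k = truncate_coeff (\<tau> (n k)) (\<xi> (n k)) (L k)" for k
  have H: "simple_process M F T (m (n k)) (\<tau> (n k)) (\<eta> k)" for k
    unfolding \<eta>_def by (rule simple_process_truncate_coeff[OF S])
  have mono: "\<forall>i<m (n k). \<tau> (n k) i \<le> \<tau> (n k) (Suc i)" for k using S by (simp add: simple_process_def)
  define e where "e k = energy (m (n k)) (\<tau> (n k)) (\<xi> (n k))" for k
  define e' where "e' k = energy (m (n k)) (\<tau> (n k)) (\<eta> k)" for k
  have e0: "0 \<le> e k w" "0 \<le> e' k w" for k w unfolding e_def e'_def by (rule energy_nonneg[OF mono])+
  have e'le: "e' k w \<le> min (L k) (e k w)" for k w
    unfolding e_def e'_def \<eta>_def using L[of k] by (intro energy_truncate_coeff_le mono) auto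
  note facts = simple_integral_facts[OF S order_refl, of "n k" for k, folded e_def]
  note facts' = simple_integral_facts[OF H order_refl, of k for k, folded e'_def]
  have [measurable]: "e k \<in> borel_measurable M" "e' k \<in> borel_measurable M" for k
    using facts facts' by (auto intro: borel_measurable_integrable)
  define A where "A k = {w \<in> space M. ennreal (1 / L k) < D (n k) w}" for k
  define E where "E k = {w \<in> space M. L k < e k w}" for k
  have [measurable]: "A k \<in> sets M" "E k \<in> sets M" for k unfolding A_def E_def by measurable
  have PA: "prob (A k) \<le> 1 / L k" for k using nA[of k] by (simp add: A_def L_def)
  \<comment> \<open>A majorant of the energy capped at \<open>L k\<close> whose mean is bounded in
    k. Off \<open>A k\<close> the squared distance D is at most 1, so the energy is at most 2 Q + 2;
    on \<open>A k\<close> the cap takes over and costs at most 1 in mean. This gives the total 2 G +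
    3.\<close>
  define U where "U k w = 2 * Q w + 2 + ennreal (L k) * indicator (A k) w" for k w
  have eQD: "ennreal (e k w) \<le> 2 * Q w + 2 * D (n k) w" if w: "w \<in> space M" for k w
  proof -
    note [measurable] = g1'[OF w] svm'
    have "ennreal (e k w) = (\<integral>\<^sup>+t. ennreal ((simple_value (m (n k)) (\<tau> (n k)) (\<xi> (n k)) t w)\<^sup>2) \<partial>?\<nu>)"
      unfolding e_def by (rule nn_integral_simple_value_square[OF S, symmetric])
    also have "\<dots> \<le> (\<integral>\<^sup>+t. 2 * ennreal ((g t w)\<^sup>2)
        + 2 * ennreal ((simple_value (m (n k)) (\<tau> (n k)) (\<xi> (n k)) t w - g t w)\<^sup>2) \<partial>?\<nu>)"
    proof (rule nn_integral_mono)
      fix t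
      let ?v = "simple_value (m (n k)) (\<tau> (n k)) (\<xi> (n k)) t w"
      have "?v\<^sup>2 \<le> 2 * (g t w)\<^sup>2 + 2 * (?v - g t w)\<^sup>2"
        using power2_diff_le[of "g t w" "g t w - ?v"] by (simp add: power2_commute)
      then have "ennreal (?v\<^sup>2) \<le> ennreal (2 * (g t w)\<^sup>2 + 2 * (?v - g t w)\<^sup>2)" by (rule ennreal_leI)
      also have "\<dots> = 2 * ennreal ((g t w)\<^sup>2) + 2 * ennreal ((?v - g t w)\<^sup>2)"
        by (simp add: ennreal_plus ennreal_mult)
      finally show "ennreal (?v\<^sup>2) \<le> 2 * ennreal ((g t w)\<^sup>2) + 2 * ennreal ((?v - g t w)\<^sup>2)" .
    qed
    also have "\<dots> = 2 * Q w + 2 * D (n k) w"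
      unfolding Q_def D_def by (subst nn_integral_add) (auto simp: nn_integral_cmult)
    finally show ?thesis .
  qed
  have eU: "ennreal (min (L k) (e k w)) \<le> U k w" if w: "w \<in> space M" for k w
  proof (cases "w \<in> A k")
    case True
    have "ennreal (min (L k) (e k w)) \<le> ennreal (L k)" by (intro ennreal_leI) simp
    also have "\<dots> \<le> U k w" using True by (simp add: U_def)
    finally show ?thesis .
  next
    case False
    then have "D (n k) w \<le> ennreal (1 / L k)" using w by (simp add: A_def not_less)
    also have "\<dots> \<le> 1" using L[of k] by (simp add: ennreal_le_1)
    finally have D: "D (n k) w \<le> 1" .
    have "ennreal (min (L k) (e k w)) \<le> ennreal (e k w)" by (intro ennreal_leI) simp
    also have "\<dots> \<le> 2 * Q w + 2 * D (n k) w" by (rule eQD[OF w])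
    also have "\<dots> \<le> 2 * Q w + 2 * 1" using D by (intro add_mono mult_left_mono) auto
    also have "\<dots> \<le> U k w" by (simp add: U_def)
    finally show ?thesis .
  qed
  have intU: "(\<integral>\<^sup>+w. U k w \<partial>M) \<le> ennreal (2 * G + 3)" for k
  proof -
    have "(\<integral>\<^sup>+w. U k w \<partial>M) = (\<integral>\<^sup>+w. 2 * Q w + 2 \<partial>M) + (\<integral>\<^sup>+w. ennreal (L k) * indicator (A k) w \<partial>M)"
      unfolding U_def by (subst nn_integral_add) auto
    also have "(\<integral>\<^sup>+w. 2 * Q w + 2 \<partial>M) = 2 * (\<integral>\<^sup>+w. Q w \<partial>M) + 2"
      by (subst nn_integral_add) (auto simp: nn_integral_cmult emeasure_space_1)
    also have "\<dots> = ennreal (2 * G + 2)" using G by (simp add: ennreal_plus ennreal_mult)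
    also have "(\<integral>\<^sup>+w. ennreal (L k) * indicator (A k) w \<partial>M) = ennreal (L k * prob (A k))"
      using L[of k] by (simp add: nn_integral_cmult_indicator emeasure_eq_measure ennreal_mult)
    also have "ennreal (L k * prob (A k)) \<le> ennreal 1"
      using PA[of k] L[of k] by (intro ennreal_leI) (simp add: field_simps)
    also have "ennreal (2 * G + 2) + ennreal 1 = ennreal (2 * G + 3)"
      using G(1) by (subst ennreal_plus[symmetric]) auto
    finally show ?thesis by (simp add: add_left_mono)
  qed
  \<comment> \<open>Markov's inequality for \<open>U k\<close>: on \<open>E k\<close> the capped
    energy equals \<open>L k\<close>.\<close>
  have PE: "prob (E k) \<le> (2 * G + 3) / L k" for k
  proof -
    have "ennreal (L k * prob (E k)) = (\<integral>\<^sup>+w. ennreal (L k) * indicator (E k) w \<partial>M)"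
      using L[of k] by (simp add: nn_integral_cmult_indicator emeasure_eq_measure ennreal_mult)
    also have "\<dots> \<le> (\<integral>\<^sup>+w. U k w \<partial>M)"
    proof (rule nn_integral_mono)
      fix w assume w: "w \<in> space M"
      show "ennreal (L k) * indicator (E k) w \<le> U k w"
        using eU[OF w, of k] by (cases "w \<in> E k") (auto simp: E_def min_def)
    qed
    also note intU
    finally have "L k * prob (E k) \<le> 2 * G + 3" using G(1) by (subst (asm) ennreal_le_iff) auto
    then show ?thesis using L[of k] by (simp add: field_simps)
  qed
  \<comment> \<open>Through the isometry this is an L2 bound, uniform in k, for the integrals of the
    stopped processes.\<close>
  have Ee': "expectation (e' k) \<le> 2 * G + 3" for k
  proof -
    have "ennreal (expectation (e' k)) = (\<integral>\<^sup>+w. ennreal (e' k w) \<partial>M)"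
      using facts'[of k] e0 by (intro nn_integral_eq_integral[symmetric]) auto
    also have "\<dots> \<le> (\<integral>\<^sup>+w. U k w \<partial>M)"
      using eU e'le by (intro nn_integral_mono) (meson ennreal_leI order_trans)
    also note intU
    finally show ?thesis using G(1) by (subst (asm) ennreal_le_iff) auto
  qed
  have same: "\<eta> k i w = \<xi> (n k) i w" if "w \<in> space M" "w \<notin> E k" "i < m (n k)" for k i w
    unfolding \<eta>_def using that by (intro truncate_coeff_eq[OF mono]) (auto simp: E_def e_def)
  have limL: "(\<lambda>k. c / L k) \<longlonglongrightarrow> 0" for c :: real
    unfolding L_def by (intro lim_const_over_n[THEN LIMSEQ_Suc])
  let ?I = "\<lambda>k. simple_integral W (m (n k)) (\<tau> (n k)) (\<eta> k)"
  let ?Ku = "\<lambda>k. simple_integral W (m (n k)) (\<tau> (n k)) (\<xi> (n k))"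
  have I2: "square_integrable M (?I k)" "expectation (\<lambda>w. (?I k w)\<^sup>2) \<le> 2 * G + 3" for k
    using facts'[of k] Ee'[of k] by auto
  have [measurable]: "?I k \<in> borel_measurable M" "?Ku k \<in> borel_measurable M" "J \<in> borel_measurable M" for k
    using facts'[of k] facts[of k] J by (auto simp: square_integrable_def)
  have "(\<lambda>k. expectation (\<lambda>w. \<bar>(?I k w - J w) * W r w\<bar>)) \<longlonglongrightarrow> 0"
  proof (rule tendsto_integral_mult_of_bounded_L2)
    show "square_integrable M (\<lambda>w. ?I k w - J w)" for k
      by (rule square_integrable_diff[OF I2(1) J])
    show "expectation (\<lambda>w. (?I k w - J w)\<^sup>2) \<le> 2 * (2 * G + 3) + 2 * expectation (\<lambda>w. (J w)\<^sup>2)" for k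
      using expectation_square_diff_le[OF I2(1)[of k] J] I2(2)[of k] by simp
    show "square_integrable M (W r)" by (rule square_integrable_W[OF r])
    show "(\<lambda>k. expectation (\<lambda>w. min 1 \<bar>?I k w - J w\<bar>)) \<longlonglongrightarrow> 0"
    \<comment> \<open>The stopped and original integrals agree off \<open>E k\<close>, which costs 2
      G + 3; the tolerance and the exceptional probability of the original integral cost 1 each, all
      divided by \<open>L k\<close>.\<close>
    proof (rule tendsto_sandwich[OF _ _ tendsto_const limL[of "2 * G + 5"]])
      show "\<forall>\<^sub>F k in sequentially. 0 \<le> expectation (\<lambda>w. min 1 \<bar>?I k w - J w\<bar>)" by simp
      have "expectation (\<lambda>w. min 1 \<bar>?I k w - J w\<bar>) \<le> (2 * G + 5) / L k" for k
      proof -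
        have i1: "integrable M (\<lambda>w. min 1 \<bar>?I k w - J w\<bar>)" "integrable M (\<lambda>w. min 1 \<bar>?Ku k w - J w\<bar>)"
          by (rule integrable_const_bound[where B=1]; simp)+
        have i2: "integrable M (indicator (E k) :: _ \<Rightarrow> real)"
          by (rule integrable_real_indicator) (auto simp: emeasure_eq_measure)
        have "expectation (\<lambda>w. min 1 \<bar>?I k w - J w\<bar>)
            \<le> expectation (\<lambda>w. indicator (E k) w + min 1 \<bar>?Ku k w - J w\<bar>)"
        proof (rule integral_mono[OF i1(1) Bochner_Integration.integrable_add[OF i2 i1(2)]])
          fix w assume w: "w \<in> space M"
          show "min 1 \<bar>?I k w - J w\<bar> \<le> indicator (E k) w + min 1 \<bar>?Ku k w - J w\<bar>"
          proof (cases "w \<in> E k")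
            case False
            then have "?I k w = ?Ku k w"
              unfolding simple_integral_def by (intro sum.cong refl) (use same[OF w] in simp)
            then show ?thesis by simp
          qed simp
        qed
        also have "\<dots> = prob (E k) + expectation (\<lambda>w. min 1 \<bar>?Ku k w - J w\<bar>)"
          using i1(2) i2 by (simp add: Bochner_Integration.integral_indicator)
        also have "expectation (\<lambda>w. min 1 \<bar>?Ku k w - J w\<bar>) \<le> 1 / L k + 1 / L k"
          using expectation_min_le_prob[of "\<lambda>w. ?Ku k w - J w" "1 / L k"] nB[of k] L[of k]
          by (simp add: L_def)
        also have "prob (E k) + (1 / L k + 1 / L k) \<le> (2 * G + 5) / L k"
          using PE[of k] by (simp add: add_divide_distrib)
        finally show ?thesis by simp
      qed
      then show "\<forall>\<^sub>F k in sequentially. expectation (\<lambda>w. min 1 \<bar>?I k w - J w\<bar>) \<le> (2 * G + 5) / L k" by simp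
    qed
  qed
  then have l1: "(\<lambda>k. expectation (\<lambda>w. ?I k w * W r w)) \<longlonglongrightarrow> expectation (\<lambda>w. J w * W r w)"
    by (intro tendsto_of_expectation_abs_diff square_integrable_mult I2 J square_integrable_W r)
      (simp add: left_diff_distrib)
  \<comment> \<open>The isometry replaces the pairing of the stopped integral with
    \<open>W r\<close> by the mean of a time integral. It remains to take the limit of these
    means.\<close>
  define V where "V w = (\<integral>t. indicator {..r} t * g t w \<partial>?\<nu>)" for w
  define V' where "V' k w = (\<integral>t. indicator {..r} t * simple_value (m (n k)) (\<tau> (n k)) (\<eta> k) t w \<partial>?\<nu>)" for k w
  have Vm[measurable]: "V \<in> borel_measurable M" unfolding V_def by measurable
  have V'm[measurable]: "V' k \<in> borel_measurable M" for k
  proof -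
    note [measurable] = svm2[OF H[of k]]
    show ?thesis unfolding V'_def by measurable
  qed
  have cs: "ennreal ((\<integral>t. indicator {..r} t * f t \<partial>?\<nu>)\<^sup>2) \<le> ennreal T * (\<integral>\<^sup>+t. ennreal ((f t)\<^sup>2) \<partial>?\<nu>)"
    if [measurable]: "f \<in> borel_measurable ?\<nu>" for f :: "real \<Rightarrow> real"
  proof -
    have "ennreal ((\<integral>t. indicator {..r} t * f t \<partial>?\<nu>)\<^sup>2)
       \<le> ennreal (measure ?\<nu> (space ?\<nu>)) * (\<integral>\<^sup>+t. ennreal ((indicator {..r} t * f t)\<^sup>2) \<partial>?\<nu>)"
      by (rule square_integral_le_finite[OF finite_measure_lborel_on_Icc]) measurable
    also have "\<dots> \<le> ennreal T * (\<integral>\<^sup>+t. ennreal ((f t)\<^sup>2) \<partial>?\<nu>)"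
      unfolding mT by (intro mult_left_mono nn_integral_mono ennreal_leI) (auto simp: indicator_def)
    finally show ?thesis .
  qed
  have V2: "square_integrable M V" "expectation (\<lambda>w. (V w)\<^sup>2) \<le> T * G"
  proof -
    have "(\<integral>\<^sup>+w. ennreal ((V w)\<^sup>2) \<partial>M) \<le> (\<integral>\<^sup>+w. ennreal T * Q w \<partial>M)"
      unfolding V_def Q_def by (intro nn_integral_mono cs g1')
    also have "\<dots> = ennreal (T * G)" using G T by (simp add: nn_integral_cmult ennreal_mult)
    finally show "square_integrable M V" "expectation (\<lambda>w. (V w)\<^sup>2) \<le> T * G"
      using square_integrable_of_nn_integral[OF Vm, of "T * G"] T G by auto
  qed
  have V'2: "square_integrable M (V' k)" "expectation (\<lambda>w. (V' k w)\<^sup>2) \<le> T * (2 * G + 3)" for k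
  proof -
    have "(\<integral>\<^sup>+w. ennreal ((V' k w)\<^sup>2) \<partial>M) \<le> (\<integral>\<^sup>+w. ennreal T * ennreal (e' k w) \<partial>M)"
      unfolding V'_def e'_def nn_integral_simple_value_square[OF H, symmetric]
      by (intro nn_integral_mono cs svm')
    also have "\<dots> = ennreal T * ennreal (expectation (e' k))"
      using facts'[of k] e0 by (subst nn_integral_cmult) (auto simp: nn_integral_eq_integral)
    also have "\<dots> \<le> ennreal (T * (2 * G + 3))"
      using T G(1) Ee'[of k] by (simp add: ennreal_mult'[symmetric] mult_left_mono ennreal_leI)
    finally show "square_integrable M (V' k)" "expectation (\<lambda>w. (V' k w)\<^sup>2) \<le> T * (2 * G + 3)"
      using square_integrable_of_nn_integral[OF V'm, of k "T * (2 * G + 3)"] T G by auto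
  qed
  \<comment> \<open>Finite energy of the path of g makes it integrable in time. Only then is
    \<open>V' k w - V w\<close> the integral of the difference, as a non-integrable path would have
    the default integral 0.\<close>
  have AEQ: "AE w in M. Q w \<noteq> \<infinity>"
    by (rule nn_integral_PInf_AE) (use G in auto)
  \<comment> \<open>The weak limit lemma with the constant 1 as test variable: it turns convergence
    in probability plus the L2 bounds into convergence of means.\<close>
  have "(\<lambda>k. expectation (\<lambda>w. \<bar>(V' k w - V w) * 1\<bar>)) \<longlonglongrightarrow> 0"
  proof (rule tendsto_integral_mult_of_bounded_L2)
    show "square_integrable M (\<lambda>w. V' k w - V w)" for k
      by (rule square_integrable_diff[OF V'2(1) V2(1)])
    show "expectation (\<lambda>w. (V' k w - V w)\<^sup>2) \<le> 2 * (T * (2 * G + 3)) + 2 * (T * G)" for k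
      using expectation_square_diff_le[OF V'2(1)[of k] V2(1)] V'2(2)[of k] V2(2) by linarith
    show "square_integrable M (\<lambda>w. 1)" by (rule square_integrable_const)
    \<comment> \<open>The exceptional sets \<open>E k\<close> and \<open>A k\<close> cost (2 G + 3)
      / L k and 1 / L k. Outside them D is at most 1 / L k, and Cauchy-Schwarz over [0,T] turns this
      into the square root.\<close>
    have lim: "(\<lambda>k. (2 * G + 4) / L k + sqrt (T / L k)) \<longlonglongrightarrow> 0 + sqrt 0"
      by (intro tendsto_add tendsto_real_sqrt limL)
    show "(\<lambda>k. expectation (\<lambda>w. min 1 \<bar>V' k w - V w\<bar>)) \<longlonglongrightarrow> 0"
    proof (rule tendsto_sandwich[OF _ _ tendsto_const lim[simplified]])
      show "\<forall>\<^sub>F k in sequentially. 0 \<le> expectation (\<lambda>w. min 1 \<bar>V' k w - V w\<bar>)" by simp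
      have "expectation (\<lambda>w. min 1 \<bar>V' k w - V w\<bar>) \<le> (2 * G + 4) / L k + sqrt (T / L k)" for k
      proof -
        have i1: "integrable M (\<lambda>w. min 1 \<bar>V' k w - V w\<bar>)"
          by (rule integrable_const_bound[where B=1]; simp)
        have i2: "integrable M (indicator (E k) :: _ \<Rightarrow> real)" "integrable M (indicator (A k) :: _ \<Rightarrow> real)"
          by (rule integrable_real_indicator; auto simp: emeasure_eq_measure)+
        have "expectation (\<lambda>w. min 1 \<bar>V' k w - V w\<bar>)
            \<le> expectation (\<lambda>w. indicator (E k) w + indicator (A k) w + sqrt (T / L k))"
        proof (rule integral_mono_AE[OF i1])
          show "integrable M (\<lambda>w. indicator (E k) w + indicator (A k) w + sqrt (T / L k))"
            using i2 by simp
          show "AE w in M. min 1 \<bar>V' k w - V w\<bar> \<le> indicator (E k) w + indicator (A k) w + sqrt (T / L k)"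
            using AEQ AE_space
          proof eventually_elim
            case (elim w)
            then have w: "w \<in> space M" by simp
            note [measurable] = g1'[OF w] svm'
            have s0: "0 \<le> sqrt (T / L k)" using T L[of k] by simp
            show ?case
            proof (cases "w \<in> E k \<or> w \<in> A k")
              case True
              then have "(1::real) \<le> indicator (E k) w + indicator (A k) w" by (auto simp: indicator_def)
              then show ?thesis using s0 by linarith
            next
              case False
              let ?v = "\<lambda>t. simple_value (m (n k)) (\<tau> (n k)) (\<xi> (n k)) t w"
              have vv: "simple_value (m (n k)) (\<tau> (n k)) (\<eta> k) t w = ?v t" for t
                unfolding simple_value_def by (intro sum.cong refl) (use same[OF w] False in simp)
              have ig: "integrable ?\<nu> (\<lambda>t. f t)" if "(\<integral>\<^sup>+t. ennreal ((f t)\<^sup>2) \<partial>?\<nu>) < \<infinity>"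
                 and [measurable]: "f \<in> borel_measurable ?\<nu>" for f :: "real \<Rightarrow> real"
              proof (rule \<nu>.square_integrable_imp_integrable)
                show "integrable ?\<nu> (\<lambda>t. (f t)\<^sup>2)" using that(1) by (intro integrableI_bounded) auto
              qed fact
              have "integrable ?\<nu> (\<lambda>t. indicator {..r} t * ?v t)"
                using ig[of ?v] nn_integral_simple_value_square[OF S[of "n k"], of w]
                by (intro integrable_indicator_mult) auto
              moreover have "integrable ?\<nu> (\<lambda>t. indicator {..r} t * g t w)"
                using ig[of "\<lambda>t. g t w"] elim(1)
                by (intro integrable_indicator_mult) (auto simp: Q_def less_top)
              ultimately have "V' k w - V w = (\<integral>t. indicator {..r} t * (?v t - g t w) \<partial>?\<nu>)"
                unfolding V'_def V_def vv
                by (subst Bochner_Integration.integral_diff[symmetric]) (auto simp: right_diff_distrib)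
              then have "ennreal ((V' k w - V w)\<^sup>2) \<le> ennreal T * D (n k) w"
                unfolding D_def using cs[of "\<lambda>t. ?v t - g t w"] by simp
              also have "\<dots> \<le> ennreal T * ennreal (1 / L k)"
                using False w by (intro mult_left_mono) (auto simp: A_def not_less)
              also have "\<dots> = ennreal (T / L k)"
                using T L[of k] by (simp add: ennreal_mult[symmetric])
              finally have "(V' k w - V w)\<^sup>2 \<le> T / L k" using T L[of k] by simp
              then have "\<bar>V' k w - V w\<bar> \<le> sqrt (T / L k)" by (metis real_sqrt_abs real_sqrt_le_iff)
              then show ?thesis using False by simp
            qed
          qed
        qed
        also have "\<dots> = prob (E k) + prob (A k) + sqrt (T / L k)"
          using i2 by (simp add: Bochner_Integration.integral_indicator prob_space)
        also have "\<dots> \<le> (2 * G + 4) / L k + sqrt (T / L k)"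
          using PE[of k] PA[of k] by (simp add: add_divide_distrib)
        finally show ?thesis .
      qed
      then show "\<forall>\<^sub>F k in sequentially. expectation (\<lambda>w. min 1 \<bar>V' k w - V w\<bar>)
          \<le> (2 * G + 4) / L k + sqrt (T / L k)" by simp
    qed
  qed
  then have l2: "(\<lambda>k. expectation (V' k)) \<longlonglongrightarrow> expectation V"
    by (intro tendsto_of_expectation_abs_diff square_integrable_integrable V'2 V2) simp
  have "expectation (\<lambda>w. ?I k w * W r w) = expectation (V' k)" for k
    unfolding V'_def by (rule expectation_simple_integral_mult_W[OF H r])
  then show ?thesis using LIMSEQ_unique[OF l1] l2 unfolding V_def by simp
qed

end

section \<open>Laplace transforms\<close>

lemma exp_decay_tendsto_0:
  assumes "0 < \<alpha>"
  shows "((\<lambda>t. exp (- \<alpha> * t)) \<longlongrightarrow> (0::real)) at_top"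
  using assms
  by (intro filterlim_compose[OF exp_at_bot] filterlim_tendsto_neg_mult_at_bot[OF tendsto_const _ filterlim_ident]) auto

lemma
  assumes "0 < \<alpha>"
  shows set_integrable_exp_atLeast: "set_integrable lborel {r..} (\<lambda>t::real. exp (- \<alpha> * t))"
    and set_integral_exp_atLeast: "(LINT t:{r..}|lborel. exp (- \<alpha> * t)) = exp (- \<alpha> * r) / \<alpha>"
proof -
  have nn: "(\<integral>\<^sup>+t. ennreal (exp (- \<alpha> * t)) * indicator {r..} t \<partial>lborel) = ennreal (0 - (- exp (- \<alpha> * r) / \<alpha>))"
  proof (rule nn_integral_FTC_atLeast)
    show "((\<lambda>t. - exp (- \<alpha> * t) / \<alpha>) has_real_derivative exp (- \<alpha> * t)) (at t)" for t
      using assms by (auto intro!: derivative_eq_intros)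
    have "((\<lambda>t. - exp (- \<alpha> * t) / \<alpha>) \<longlongrightarrow> - 0 / \<alpha>) at_top"
      using assms by (intro tendsto_divide tendsto_minus tendsto_const exp_decay_tendsto_0) auto
    then show "((\<lambda>t. - exp (- \<alpha> * t) / \<alpha>) \<longlongrightarrow> 0) at_top" by simp
  qed (use assms in auto)
  have nn': "(\<integral>\<^sup>+t. ennreal (indicator {r..} t *\<^sub>R exp (- \<alpha> * t)) \<partial>lborel) = ennreal (exp (- \<alpha> * r) / \<alpha>)"
    using nn by (simp add: ennreal_mult' ennreal_indicator mult.commute)
  show "set_integrable lborel {r..} (\<lambda>t::real. exp (- \<alpha> * t))"
    unfolding set_integrable_def using nn' by (intro integrableI_nonneg) auto
  show "(LINT t:{r..}|lborel. exp (- \<alpha> * t)) = exp (- \<alpha> * r) / \<alpha>"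
    unfolding set_lebesgue_integral_def using nn' assms by (intro integral_eq_nn_integral[THEN trans]) auto
qed

lemma norm_exp_mult_of_real: "norm (exp (- z * complex_of_real t)) = exp (- Re z * t)"
  by (simp add: norm_exp_eq_Re)

lemma
  assumes z: "0 < Re z"
  shows set_integrable_cexp_atLeast: "set_integrable lborel {r..} (\<lambda>t. exp (- z * complex_of_real t))"
    and set_integral_cexp_atLeast:
      "(LINT t:{r..}|lborel. exp (- z * complex_of_real t)) = exp (- z * complex_of_real r) / z"
proof -
  show int: "set_integrable lborel {r..} (\<lambda>t. exp (- z * complex_of_real t))"
    unfolding set_integrable_def
  proof (rule Bochner_Integration.integrable_bound)
    show "integrable lborel (\<lambda>t. indicator {r..} t *\<^sub>R exp (- Re z * t))"
      using set_integrable_exp_atLeast[OF z] by (simp add: set_integrable_def)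
  qed (auto simp: norm_exp_mult_of_real indicator_def norm_exp_eq_Re)
  have z0: "z \<noteq> 0" using z by auto
  have l1: "((\<lambda>b. LINT t:{r..b}|lborel. exp (- z * complex_of_real t))
      \<longlongrightarrow> (LINT t:{r..}|lborel. exp (- z * complex_of_real t))) at_top"
    by (rule tendsto_set_lebesgue_integral_at_top[OF _ int]) auto
  have ev: "(LINT t:{r..b}|lborel. exp (- z * complex_of_real t))
     = exp (- z * complex_of_real r) / z - exp (- z * complex_of_real b) / z" if "r \<le> b" for b
  proof -
    have "(\<integral>t. indicator {r..b} t *\<^sub>R exp (- z * complex_of_real t) \<partial>lborel)
      = - exp (- z * complex_of_real b) / z - (- exp (- z * complex_of_real r) / z)"
    proof (rule integral_FTC_Icc[OF that])
      show "((\<lambda>t. - exp (- z * complex_of_real t) / z) has_vector_derivative exp (- z * complex_of_real t))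
         (at t within {r..b})" for t
        using z0 by (auto intro!: derivative_eq_intros has_vector_derivative_real_field simp: )
      show "continuous_on {r..b} (\<lambda>t. exp (- z * complex_of_real t))" by (intro continuous_intros)
    qed
    then show ?thesis by (simp add: set_lebesgue_integral_def)
  qed
  have l0: "((\<lambda>b. exp (- z * complex_of_real b)) \<longlongrightarrow> 0) at_top"
  proof (rule tendsto_norm_zero_cancel)
    show "((\<lambda>b. norm (exp (- z * complex_of_real b))) \<longlongrightarrow> 0) at_top"
      unfolding norm_exp_mult_of_real by (rule exp_decay_tendsto_0[OF z])
  qed
  have l2': "((\<lambda>b. exp (- z * complex_of_real r) / z - exp (- z * complex_of_real b) / z)
    \<longlongrightarrow> exp (- z * complex_of_real r) / z) at_top"
    using tendsto_diff[OF tendsto_const tendsto_divide[OF l0 tendsto_const z0], of "exp (- z * complex_of_real r) / z"]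
    by simp
  have l2: "((\<lambda>b. LINT t:{r..b}|lborel. exp (- z * complex_of_real t))
      \<longlongrightarrow> exp (- z * complex_of_real r) / z) at_top"
    by (rule Lim_transform_eventually[OF l2'])
      (use ev in \<open>auto simp: eventually_at_top_linorder intro!: exI[of _ r]\<close>)
  show "(LINT t:{r..}|lborel. exp (- z * complex_of_real t)) = exp (- z * complex_of_real r) / z"
    by (rule tendsto_unique[OF _ l1 l2]) simp
qed

lemma set_integrable_laplace:
  assumes z: "0 < Re z" and [measurable]: "g \<in> borel_measurable borel" and B: "\<And>t. 0 \<le> t \<Longrightarrow> \<bar>g t\<bar> \<le> B"
  shows "set_integrable lborel {0..} (\<lambda>t. exp (- z * complex_of_real t) * complex_of_real (g t))"
  unfolding set_integrable_def
proof (rule Bochner_Integration.integrable_bound)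
  show "integrable lborel (\<lambda>t. B *\<^sub>R (indicator {0..} t *\<^sub>R exp (- Re z * t)))"
    using set_integrable_exp_atLeast[OF z, of 0] by (simp add: set_integrable_def)
  have "norm (indicator {0..} t *\<^sub>R (exp (- z * complex_of_real t) * complex_of_real (g t)))
     \<le> norm (B *\<^sub>R (indicator {0..} t *\<^sub>R exp (- Re z * t)))" for t
  proof (cases "0 \<le> t")
    case True
    have "\<bar>g t\<bar> \<le> \<bar>B\<bar>" using B[OF True] by simp
    then show ?thesis using True by (simp add: norm_mult norm_exp_mult_of_real norm_exp_eq_Re abs_mult)
  qed simp
  then show "AE t in lborel. norm (indicator {0..} t *\<^sub>R (exp (- z * complex_of_real t) * complex_of_real (g t)))
     \<le> norm (B *\<^sub>R (indicator {0..} t *\<^sub>R exp (- Re z * t)))" by simp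
qed measurable

lemma laplace_add:
  assumes "set_integrable lborel {0..} (\<lambda>t. exp (- z * complex_of_real t) * complex_of_real (f t))"
    "set_integrable lborel {0..} (\<lambda>t. exp (- z * complex_of_real t) * complex_of_real (g t))"
  shows "laplace (\<lambda>t. f t + g t) z = laplace f z + laplace g z"
  unfolding laplace_def using set_integral_add(2)[OF assms] by (simp add: distrib_left)

lemma laplace_cmult: "laplace (\<lambda>t. c * f t) z = complex_of_real c * laplace f z"
  unfolding laplace_def set_integral_mult_right[symmetric]
  by (simp add: mult.left_commute)

text \<open>Fubini on the triangle 0 \<le> s \<le> t: for fixed s, the integral of exp (-z t) over t
  \<ge> s is exp (-z s) / z.\<close>

lemma laplace_primitive:
  assumes z: "0 < Re z" and f[measurable]: "f \<in> borel_measurable borel" and B: "\<And>t. 0 \<le> t \<Longrightarrow> \<bar>f t\<bar> \<le> B"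
  shows "laplace (\<lambda>t. \<integral>s. f s \<partial>lborel_on {0..t}) z = laplace f z / z"
proof -
  define h where "h s t = (if 0 \<le> s \<and> s \<le> t then exp (- z * complex_of_real t) * complex_of_real (f s) else 0)" for s t
  have hm[measurable]: "case_prod h \<in> borel_measurable (lborel \<Otimes>\<^sub>M lborel)"
    unfolding h_def by measurable
  have h1: "h s = (\<lambda>t. (indicator {s..} t *\<^sub>R exp (- z * complex_of_real t)) * (indicator {0..} s *\<^sub>R complex_of_real (f s)))" for s
    by (auto simp: h_def fun_eq_iff)
  have hn: "(\<lambda>t. norm (h s t)) = (\<lambda>t. (indicator {s..} t *\<^sub>R exp (- Re z * t)) * (indicator {0..} s * \<bar>f s\<bar>))" for s
    by (auto simp: h_def fun_eq_iff norm_mult norm_exp_mult_of_real norm_exp_eq_Re)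
  have i1: "integrable lborel (h s)" for s
    unfolding h1 using set_integrable_cexp_atLeast[OF z, of s] unfolding set_integrable_def
    by (intro integrable_mult_left) auto
  have e1: "(\<integral>t. h s t \<partial>lborel) = indicator {0..} s *\<^sub>R (exp (- z * complex_of_real s) * complex_of_real (f s)) / z" for s
  proof -
    have "(\<integral>t. h s t \<partial>lborel)
      = (\<integral>t. indicator {s..} t *\<^sub>R exp (- z * complex_of_real t) \<partial>lborel) * (indicator {0..} s *\<^sub>R complex_of_real (f s))"
      unfolding h1 by (rule integral_mult_left_zero)
    also have "\<dots> = exp (- z * complex_of_real s) / z * (indicator {0..} s *\<^sub>R complex_of_real (f s))"
      using set_integral_cexp_atLeast[OF z, of s] unfolding set_lebesgue_integral_def by simp
    finally show ?thesis by (simp add: indicator_def)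
  qed
  have e2: "(\<integral>t. norm (h s t) \<partial>lborel) = indicator {0..} s *\<^sub>R (exp (- Re z * s) * \<bar>f s\<bar> / Re z)" for s
    unfolding hn using set_integral_exp_atLeast[OF z, of s] unfolding set_lebesgue_integral_def
    by (simp add: indicator_def)
  have int: "integrable (lborel \<Otimes>\<^sub>M lborel) (case_prod h)"
  proof (rule lborel_pair.Fubini_integrable)
    \<comment> \<open>Integrating the modulus over t produces 1 / Re z, not 1 / \<bar>z\<bar>; the
      factor z / Re z makes the known integrable function match it.\<close>
    have "integrable lborel (\<lambda>s. norm (indicator {0..} s *\<^sub>R (exp (- z * complex_of_real s) * complex_of_real (f s)) / z * (z / Re z)))"
      using set_integrable_laplace[OF z f B] unfolding set_integrable_def
      by (intro integrable_norm integrable_mult_left integrable_divide)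
    also have "(\<lambda>s. norm (indicator {0..} s *\<^sub>R (exp (- z * complex_of_real s) * complex_of_real (f s)) / z * (z / Re z)))
       = (\<lambda>s. indicator {0..} s *\<^sub>R (exp (- Re z * s) * \<bar>f s\<bar> / Re z))"
      using z by (auto simp: fun_eq_iff norm_mult norm_divide norm_exp_mult_of_real norm_exp_eq_Re indicator_def)
    finally show "integrable lborel (\<lambda>s. \<integral>t. norm (case (s, t) of (s, t) \<Rightarrow> h s t) \<partial>lborel)"
      by (simp only: prod.case e2)
  qed (use i1 in auto)
  have "laplace f z / z = (\<integral>s. (\<integral>t. h s t \<partial>lborel) \<partial>lborel)"
    unfolding e1 laplace_def set_lebesgue_integral_def by simp
  also have "\<dots> = (\<integral>t. (\<integral>s. h s t \<partial>lborel) \<partial>lborel)"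
    by (rule lborel_pair.Fubini_integral[OF int, symmetric])
  also have "\<dots> = laplace (\<lambda>t. \<integral>s. f s \<partial>lborel_on {0..t}) z"
    unfolding laplace_def set_lebesgue_integral_def
  proof (intro Bochner_Integration.integral_cong refl)
    fix t
    have "(\<integral>s. h s t \<partial>lborel) = (\<integral>s. exp (- z * complex_of_real t) * complex_of_real (indicator {0..t} s *\<^sub>R f s) \<partial>lborel)"
      by (intro Bochner_Integration.integral_cong refl) (simp add: h_def indicator_def)
    also have "\<dots> = exp (- z * complex_of_real t) * complex_of_real (\<integral>s. indicator {0..t} s *\<^sub>R f s \<partial>lborel)"
      by (simp del: of_real_mult)
    also have "\<dots> = indicator {0..} t *\<^sub>R (exp (- z * complex_of_real t) * complex_of_real (\<integral>s. f s \<partial>lborel_on {0..t}))"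
    proof (cases "0 \<le> t")
      case False
      then show ?thesis by simp
    qed (simp add: integral_lborel_on set_lebesgue_integral_def)
    finally show "(\<integral>s. h s t \<partial>lborel) = indicator {0..} t *\<^sub>R (exp (- z * complex_of_real t) * complex_of_real (\<integral>s. f s \<partial>lborel_on {0..t}))" .
  qed
  finally show ?thesis by simp
qed

text \<open>The law of a random delay with density K. The indicator is part of the density because
  nothing is known about K at negative arguments. Delay integrals become expectations, to which the
  finite-measure Fubini lemma applies.\<close>

definition kernel_measure :: "(real \<Rightarrow> real) \<Rightarrow> real measure" where
  "kernel_measure K = density lborel (\<lambda>s. ennreal (indicator {0..} s * K s))"

lemma sets_kernel_measure[simp, measurable_cong]: "sets (kernel_measure K) = sets borel"
  and space_kernel_measure[simp]: "space (kernel_measure K) = UNIV"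
  by (simp_all add: kernel_measure_def)

lemma delay_kernel_measurable:
  assumes "delay_kernel \<mu> K"
  shows "(\<lambda>s. indicator {0..} s * K s) \<in> borel_measurable borel"
  using assms borel_measurable_integrable[of lborel "\<lambda>s. indicator {0..} s * K s"]
  by (simp add: delay_kernel_def set_integrable_def)

lemma delay_kernelD:
  assumes "delay_kernel \<mu> K"
  shows "0 \<le> indicator {0..} s * K s" "integrable lborel (\<lambda>s. indicator {0..} s * K s)"
    "(\<integral>s. indicator {0..} s * K s \<partial>lborel) = 1"
proof -
  show "0 \<le> indicator {0..} s * K s"
    using assms unfolding delay_kernel_def by (cases "0 \<le> s") simp_all
  show "integrable lborel (\<lambda>s. indicator {0..} s * K s)" "(\<integral>s. indicator {0..} s * K s \<partial>lborel) = 1"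
    using assms by (simp_all add: delay_kernel_def set_integrable_def set_lebesgue_integral_def)
qed

lemma prob_space_kernel_measure:
  assumes K: "delay_kernel \<mu> K"
  shows "prob_space (kernel_measure K)"
proof (rule prob_spaceI)
  note [measurable] = delay_kernel_measurable[OF K]
  have "emeasure (kernel_measure K) (space (kernel_measure K)) = (\<integral>\<^sup>+s. ennreal (indicator {0..} s * K s) \<partial>lborel)"
    unfolding kernel_measure_def by (simp add: emeasure_density)
  also have "\<dots> = ennreal (\<integral>s. indicator {0..} s * K s \<partial>lborel)"
    using delay_kernelD[OF K] by (intro nn_integral_eq_integral) simp_all
  finally show "emeasure (kernel_measure K) (space (kernel_measure K)) = 1"
    by (simp add: delay_kernelD[OF K])
qed

lemma integral_kernel_measure:
  fixes f :: "real \<Rightarrow> 'b::{banach, second_countable_topology}"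
  assumes K: "delay_kernel \<mu> K" and [measurable]: "f \<in> borel_measurable borel"
  shows "(\<integral>s. f s \<partial>kernel_measure K) = (LINT s:{0..}|lborel. K s *\<^sub>R f s)"
proof -
  note [measurable] = delay_kernel_measurable[OF K]
  have "(\<integral>s. f s \<partial>kernel_measure K) = (\<integral>s. (indicator {0..} s * K s) *\<^sub>R f s \<partial>lborel)"
    unfolding kernel_measure_def
    using delay_kernelD(1)[OF K] by (intro integral_density) simp_all
  then show ?thesis by (simp add: set_lebesgue_integral_def)
qed

lemma AE_kernel_measure:
  assumes K: "delay_kernel \<mu> K"
  shows "AE s in kernel_measure K. 0 \<le> s"
proof -
  note [measurable] = delay_kernel_measurable[OF K]
  show ?thesis unfolding kernel_measure_def
  proof (subst AE_density)
    show "(\<lambda>s. ennreal (indicator {0..} s * K s)) \<in> borel_measurable lborel" by measurable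
  qed (simp add: indicator_def)
qed

lemma laplace_kernel:
  assumes K: "delay_kernel \<mu> K"
  shows "laplace K z = (\<integral>s. exp (- z * complex_of_real s) \<partial>kernel_measure K)"
  unfolding laplace_def
  by (subst integral_kernel_measure[OF K]) (auto simp: scaleR_conv_of_real mult.commute)

text \<open>Averaging over the delay commutes with the transform by Fubini, so only a shift by a
  fixed s \<ge> 0 has to be computed. Boundedness of c together with Re z > 0 gives the integrable
  majorant.\<close>

lemma laplace_convolution:
  assumes K: "delay_kernel \<mu> K" and z: "0 < Re z"
    and c[measurable]: "c \<in> borel_measurable borel" and B: "\<And>t. \<bar>c t\<bar> \<le> B" and c0: "\<And>t. t < 0 \<Longrightarrow> c t = 0"
  shows "laplace (\<lambda>t. \<integral>s. c (t - s) \<partial>kernel_measure K) z = laplace K z * laplace c z"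
proof -
  let ?\<kappa> = "kernel_measure K"
  interpret \<kappa>: prob_space ?\<kappa> by (rule prob_space_kernel_measure[OF K])
  interpret P: pair_sigma_finite lborel ?\<kappa> ..
  define h where "h t s = indicator {0..} t *\<^sub>R (exp (- z * complex_of_real t) * complex_of_real (c (t - s)))" for t s
  have hm[measurable]: "case_prod h \<in> borel_measurable (lborel \<Otimes>\<^sub>M ?\<kappa>)"
    unfolding h_def by measurable
  have nb: "norm (h t s) \<le> B * (indicator {0..} t *\<^sub>R exp (- Re z * t))" for t s
    using B[of "t - s"] by (simp add: h_def indicator_def norm_mult norm_exp_mult_of_real norm_exp_eq_Re mult.commute)
  have int: "integrable (lborel \<Otimes>\<^sub>M ?\<kappa>) (case_prod h)"
  proof (rule Bochner_Integration.integrable_bound[OF _ hm])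
    show "integrable (lborel \<Otimes>\<^sub>M ?\<kappa>) (\<lambda>(t, s). B * (indicator {0..} t *\<^sub>R exp (- Re z * t)))"
    proof (rule P.Fubini_integrable)
      have "integrable lborel (\<lambda>t. norm (B * (indicator {0..} t *\<^sub>R exp (- Re z * t))))"
        using set_integrable_exp_atLeast[OF z, of 0] unfolding set_integrable_def
        by (intro integrable_norm integrable_mult_right)
      then show "integrable lborel (\<lambda>t. \<integral>s. norm (case (t, s) of (t, s) \<Rightarrow> B * (indicator {0..} t *\<^sub>R exp (- Re z * t))) \<partial>?\<kappa>)"
        by (simp add: \<kappa>.prob_space)
    qed auto
    show "AE p in lborel \<Otimes>\<^sub>M ?\<kappa>. norm (case_prod h p) \<le> norm (case p of (t, s) \<Rightarrow> B * (indicator {0..} t *\<^sub>R exp (- Re z * t)))"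
      using order_trans[OF nb[of "fst _" "snd _"] abs_ge_self]
      by (intro AE_I2) (simp only: case_prod_beta' real_norm_def)
  qed
  \<comment> \<open>Replacing t by t + s moves the range to t \<ge> -s; since c vanishes at negative
    times, only t \<ge> 0 contributes.\<close>
  have inner: "(\<integral>t. h t s \<partial>lborel) = exp (- z * complex_of_real s) * laplace c z" if s: "0 \<le> s" for s
  proof -
    have "(\<integral>t. h t s \<partial>lborel) = (\<integral>t. h (t + s) s \<partial>lborel)"
      using lborel_integral_real_affine[of 1 "\<lambda>t. h t s" s] by (simp add: add.commute)
    also have "\<dots> = (\<integral>t. exp (- z * complex_of_real s) * (indicator {0..} t *\<^sub>R (exp (- z * complex_of_real t) * complex_of_real (c t))) \<partial>lborel)"
    proof (rule Bochner_Integration.integral_cong[OF refl])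
      fix t
      show "h (t + s) s = exp (- z * complex_of_real s) * (indicator {0..} t *\<^sub>R (exp (- z * complex_of_real t) * complex_of_real (c t)))"
      proof (cases "0 \<le> t")
        case True
        have "exp (- z * complex_of_real (t + s)) = exp (- z * complex_of_real s) * exp (- z * complex_of_real t)"
          by (simp add: mult_exp_exp algebra_simps)
        then show ?thesis using True s by (simp only: h_def) simp
      qed (use c0[of t] in \<open>simp add: h_def\<close>)
    qed
    also have "\<dots> = exp (- z * complex_of_real s) * laplace c z"
      unfolding laplace_def set_lebesgue_integral_def by (rule integral_mult_right_zero)
    finally show ?thesis .
  qed
  have "laplace K z * laplace c z = (\<integral>s. exp (- z * complex_of_real s) * laplace c z \<partial>?\<kappa>)"
    by (simp add: laplace_kernel[OF K])
  also have "\<dots> = (\<integral>s. (\<integral>t. h t s \<partial>lborel) \<partial>?\<kappa>)"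
    using AE_kernel_measure[OF K] by (intro integral_cong_AE) (auto elim!: eventually_mono simp: inner)
  also have "\<dots> = (\<integral>t. (\<integral>s. h t s \<partial>?\<kappa>) \<partial>lborel)"
    by (rule P.Fubini_integral[OF int])
  also have "\<dots> = laplace (\<lambda>t. \<integral>s. c (t - s) \<partial>?\<kappa>) z"
    unfolding laplace_def set_lebesgue_integral_def h_def by simp
  finally show ?thesis by simp
qed

text \<open>The equation is transformed in integrated form, so no derivative of c is involved.
  Vanishing of c up to time 0 removes the past from the convolution, and the bounds on c and g make
  every transform a convergent integral for Re z > 0. The result is z L(c) = (a + b L(K)) L(c) +
  L(g), all at z, and the root equation cancels L(c).\<close>

lemma laplace_forcing_eq_0:
  assumes K: "delay_kernel \<mu> K" and z: "0 < Re z" and root: "char_fun a b K z = 0"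
    and c[measurable]: "c \<in> borel_measurable borel" and C: "\<And>t. \<bar>c t\<bar> \<le> C" and c0: "\<And>t. t \<le> 0 \<Longrightarrow> c t = 0"
    and g[measurable]: "g \<in> borel_measurable borel" and G: "\<And>t. 0 \<le> t \<Longrightarrow> \<bar>g t\<bar> \<le> G"
    and eq: "\<And>t. 0 \<le> t \<Longrightarrow>
      c t = (\<integral>s. a * c s + b * (\<integral>u. c (s - u) \<partial>kernel_measure K) + g s \<partial>lborel_on {0..t})"
  shows "laplace g z = 0"
proof -
  interpret \<kappa>: prob_space "kernel_measure K" by (rule prob_space_kernel_measure[OF K])
  define d where "d s = (\<integral>u. c (s - u) \<partial>kernel_measure K)" for s
  have d[measurable]: "d \<in> borel_measurable borel" unfolding d_def by measurable
  have D: "\<bar>d s\<bar> \<le> C" for s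
  proof -
    have "norm (d s) \<le> (\<integral>u. norm (c (s - u)) \<partial>kernel_measure K)"
      unfolding d_def by (rule integral_norm_bound)
    also have "\<dots> \<le> C"
      using C by (intro \<kappa>.integral_le_const \<kappa>.integrable_const_bound[where B=C]) auto
    finally show ?thesis by simp
  qed
  let ?f = "\<lambda>s. a * c s + b * d s + g s"
  have fb: "\<bar>?f s\<bar> \<le> \<bar>a\<bar> * C + \<bar>b\<bar> * C + G" if "0 \<le> s" for s
  proof -
    have "\<bar>a * c s\<bar> \<le> \<bar>a\<bar> * C" "\<bar>b * d s\<bar> \<le> \<bar>b\<bar> * C" using C[of s] D[of s] by (auto simp: abs_mult mult_left_mono)
    then show ?thesis using G[OF that] by linarith
  qed
  have "laplace c z = laplace (\<lambda>t. \<integral>s. ?f s \<partial>lborel_on {0..t}) z"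
    unfolding laplace_def using eq by (intro set_lebesgue_integral_cong) (auto simp: d_def)
  also have "\<dots> = laplace ?f z / z"
    by (rule laplace_primitive[OF z _ fb]) auto
  finally have 1: "z * laplace c z = laplace ?f z" using z by (auto simp: field_simps)
  have ic: "set_integrable lborel {0..} (\<lambda>t. exp (- z * complex_of_real t) * complex_of_real (k * c t))"
    "set_integrable lborel {0..} (\<lambda>t. exp (- z * complex_of_real t) * complex_of_real (k * d t))" for k
    by (rule set_integrable_laplace[OF z, where B="\<bar>k\<bar> * C"]; simp add: abs_mult mult_left_mono C D)+
  have "laplace ?f z = laplace (\<lambda>s. a * c s + b * d s) z + laplace g z"
    using ic[of a] ic[of b] set_integrable_laplace[OF z g G]
    by (intro laplace_add) (auto simp: distrib_left intro!: set_integral_add)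
  also have "laplace (\<lambda>s. a * c s + b * d s) z = complex_of_real a * laplace c z + complex_of_real b * laplace d z"
    using laplace_add[OF ic(1)[of a] ic(2)[of b]] by (simp add: laplace_cmult)
  also have "laplace d z = laplace K z * laplace c z"
    unfolding d_def using c0 by (intro laplace_convolution[OF K z c C]) auto
  finally have "z * laplace c z = (complex_of_real a + complex_of_real b * laplace K z) * laplace c z + laplace g z"
    using 1 by (simp add: algebra_simps)
  moreover have "complex_of_real a + complex_of_real b * laplace K z = z"
    using root by (simp add: char_fun_def algebra_simps)
  ultimately show ?thesis by simp
qed

section \<open>Solutions with bounded second moment\<close>

lemma bounded_real_image: "bounded (f ` A) \<longleftrightarrow> (\<exists>B. \<forall>x\<in>A. \<bar>f x :: real\<bar> \<le> B)"
  by (auto simp: bounded_iff)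

text \<open>One initial function at a time: R stands for the value of the bound at its norm.\<close>

locale bounded_sdde_solution = wiener_space M F W
  for M :: "'w measure" and F :: "real \<Rightarrow> 'w measure" and W :: "real \<Rightarrow> 'w \<Rightarrow> real" +
  fixes a b \<sigma>0 \<sigma>1 \<sigma>2 \<mu> :: real and K \<phi> :: "real \<Rightarrow> real" and X :: "real \<Rightarrow> 'w \<Rightarrow> real" and R :: real
  assumes kernel: "delay_kernel \<mu> K" and initial: "\<phi> \<in> BC"
    and solution: "sdde_solution M F W a b K \<sigma>0 \<sigma>1 \<sigma>2 \<phi> X"
    and R_nonneg: "0 \<le> R" and bounded: "\<And>t. 0 \<le> t \<Longrightarrow> second_moment M X t \<le> ennreal R"
begin

sublocale \<kappa>: prob_space "kernel_measure K"
  by (rule prob_space_kernel_measure[OF kernel])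

lemma X_initial: "w \<in> space M \<Longrightarrow> t \<le> 0 \<Longrightarrow> X t w = \<phi> t"
  using solution by (simp add: sdde_solution_def)

lemma X_joint_measurable: "(\<lambda>(t, w). X t w) \<in> borel_measurable (lborel \<Otimes>\<^sub>M M)"
  using solution by (simp add: sdde_solution_def)

lemma X_measurable[measurable]: "X t \<in> borel_measurable M"
  using measurable_Pair2[OF X_joint_measurable, of t] by simp

lemma X_continuous: "AE w in M. continuous_on {0..} (\<lambda>t. X t w)"
  using solution by (simp add: sdde_solution_def)

lemma initial_continuous: "continuous_on {..0} \<phi>"
  using initial by (simp add: BC_def)

lemma initial_bounded: "\<exists>B. \<forall>t\<le>0. \<bar>\<phi> t\<bar> \<le> B"
  using initial by (auto simp: BC_def bounded_iff)

definition mean :: "real \<Rightarrow> real" where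
  "mean t = expectation (X t)"

lemma expectation_X_mult_initial:
  assumes "t \<le> 0"
  shows "expectation (\<lambda>w. X t w * Y w) = \<phi> t * expectation Y"
proof -
  have "expectation (\<lambda>w. X t w * Y w) = expectation (\<lambda>w. \<phi> t * Y w)"
    using X_initial assms by (intro Bochner_Integration.integral_cong) auto
  then show ?thesis by simp
qed

text \<open>A finite value of the integral in [0,\<infinity>] gives square integrability of the
  centred variable for whatever real number \<open>mean t\<close> is, even a default value. That
  \<open>mean t\<close> is a genuine expectation follows afterwards, once the constant has been
  added back.\<close>

lemma
  assumes "0 \<le> t"
  shows square_integrable_centred: "square_integrable M (\<lambda>w. X t w - mean t)"
    and variance_le: "expectation (\<lambda>w. (X t w - mean t)\<^sup>2) \<le> R"
proof -
  have "(\<integral>\<^sup>+w. ennreal ((X t w - mean t)\<^sup>2) \<partial>M) \<le> ennreal R"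
    using bounded[OF assms] by (simp add: second_moment_def mean_def)
  then show "square_integrable M (\<lambda>w. X t w - mean t)" "expectation (\<lambda>w. (X t w - mean t)\<^sup>2) \<le> R"
    using square_integrable_of_nn_integral[of "\<lambda>w. X t w - mean t" R] R_nonneg by auto
qed

lemma square_integrable_X: "square_integrable M (X t)"
proof (cases "0 \<le> t")
  case True
  show ?thesis
    using square_integrable_add[OF square_integrable_centred[OF True] square_integrable_const[of "mean t"]] by simp
next
  case False
  then show ?thesis
    using X_initial[of _ t] by (intro square_integrable_cong_AE[OF square_integrable_const[of "\<phi> t"]]) auto
qed

lemma expectation_X_square:
  "expectation (\<lambda>w. (X t w)\<^sup>2) = expectation (\<lambda>w. (X t w - mean t)\<^sup>2) + (mean t)\<^sup>2"
  using square_integrable_integrable[OF square_integrable_X[of t]] square_integrable_square[OF square_integrable_X[of t]]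
  by (simp add: mean_def variance_eq)

lemma expectation_X_square_initial: "t \<le> 0 \<Longrightarrow> expectation (\<lambda>w. (X t w)\<^sup>2) = (\<phi> t)\<^sup>2"
proof -
  assume t: "t \<le> 0"
  have "expectation (\<lambda>w. (X t w)\<^sup>2) = expectation (\<lambda>w. (\<phi> t)\<^sup>2)"
    using X_initial t by (intro Bochner_Integration.integral_cong) auto
  then show ?thesis by (simp add: prob_space)
qed

text \<open>Continuous paths keep \<open>X t\<close> bounded in probability on compact intervals; with the bounded
  variance this controls the mean.\<close>

lemma mean_locally_bounded: "\<exists>C. \<forall>t\<in>{0..T}. \<bar>mean t\<bar> \<le> C"
proof (rule ccontr)
  assume "\<nexists>C. \<forall>t\<in>{0..T}. \<bar>mean t\<bar> \<le> C"
  then have "\<forall>n. \<exists>t. t \<in> {0..T} \<and> real (Suc n) < \<bar>mean t\<bar>"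
    by (meson not_le)
  from choice[OF this] obtain u where u: "\<And>n. u n \<in> {0..T}" "\<And>n. real (Suc n) < \<bar>mean (u n)\<bar>"
    by blast
  \<comment> \<open>Each continuous path is bounded on [0,T], so dividing by n + 1 sends it to 0
    even though the times \<open>u n\<close> vary.\<close>
  have "(\<lambda>n. expectation (\<lambda>w. min 1 \<bar>X (u n) w / real (Suc n)\<bar>)) \<longlonglongrightarrow> 0"
  proof (rule tendsto_expectation_min_of_AE)
    show "AE w in M. (\<lambda>n. X (u n) w / real (Suc n)) \<longlonglongrightarrow> 0"
      using X_continuous
    proof eventually_elim
      case (elim w)
      have "continuous_on {0..T} (\<lambda>t. X t w)" by (rule continuous_on_subset[OF elim]) auto
      then have "bounded ((\<lambda>t. X t w) ` {0..T})"
        by (intro compact_imp_bounded compact_continuous_image) auto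
      then obtain S where S: "\<And>t. t \<in> {0..T} \<Longrightarrow> \<bar>X t w\<bar> \<le> S"
        unfolding bounded_real_image by blast
      show ?case
      proof (rule Lim_null_comparison)
        show "(\<lambda>n. S / real (Suc n)) \<longlonglongrightarrow> 0" by (intro lim_const_over_n[THEN LIMSEQ_Suc])
        show "\<forall>\<^sub>F n in sequentially. norm (X (u n) w / real (Suc n)) \<le> S / real (Suc n)"
          using S[OF u(1)] by (intro always_eventually allI) (simp add: divide_right_mono)
      qed
    qed
  qed measurable
  moreover have "(\<lambda>n. 1 - (1 + R) / real (Suc n)) \<longlonglongrightarrow> 1 - 0"
    by (intro tendsto_diff tendsto_const lim_const_over_n[THEN LIMSEQ_Suc])
  \<comment> \<open>The opposite conclusion: with N = n + 1 below \<bar>mean\<bar>, the triangle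
    inequality and \<bar>d\<bar> \<le> 1 + d^2 give \<bar>X\<bar> \<ge> N - (1 + d^2), where d is
    the deviation from the mean and d^2 has expectation at most R. So the truncated expectations
    tend to 1.\<close>
  moreover have "1 - (1 + R) / real (Suc n) \<le> expectation (\<lambda>w. min 1 \<bar>X (u n) w / real (Suc n)\<bar>)" for n
  proof -
    let ?N = "real (Suc n)" and ?c = "\<lambda>w. X (u n) w - mean (u n)"
    have u0: "0 \<le> u n" using u(1)[of n] by simp
    note sq = square_integrable_square[OF square_integrable_centred[OF u0]]
    have "expectation (\<lambda>w. 1 - (1 + (?c w)\<^sup>2) / ?N) \<le> expectation (\<lambda>w. min 1 \<bar>X (u n) w / ?N\<bar>)"
    proof (rule integral_mono)
      show "integrable M (\<lambda>w. 1 - (1 + (?c w)\<^sup>2) / ?N)" using sq by simp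
      show "integrable M (\<lambda>w. min 1 \<bar>X (u n) w / ?N\<bar>)"
        by (rule integrable_const_bound[where B=1]) auto
      fix w
      have "\<bar>d\<bar> \<le> 1 + d\<^sup>2" for d :: real
        using zero_le_power2[of "\<bar>d\<bar> - 1"] abs_ge_zero[of d] unfolding power2_diff by simp
      from this[of "?c w"] have "?N - (1 + (?c w)\<^sup>2) \<le> \<bar>X (u n) w\<bar>" using u(2)[of n] by linarith
      then have "(?N - (1 + (?c w)\<^sup>2)) / ?N \<le> \<bar>X (u n) w\<bar> / ?N" by (rule divide_right_mono) simp
      then have "1 - (1 + (?c w)\<^sup>2) / ?N \<le> \<bar>X (u n) w / ?N\<bar>" by (simp add: diff_divide_distrib del: of_nat_Suc)
      moreover have "1 - (1 + (?c w)\<^sup>2) / ?N \<le> 1" by simp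
      ultimately show "1 - (1 + (?c w)\<^sup>2) / ?N \<le> min 1 \<bar>X (u n) w / ?N\<bar>" by simp
    qed
    also have "expectation (\<lambda>w. 1 - (1 + (?c w)\<^sup>2) / ?N) = 1 - (1 + expectation (\<lambda>w. (?c w)\<^sup>2)) / ?N"
      using sq by (simp add: prob_space)
    finally show ?thesis
      using variance_le[OF u0] by (smt (verit) divide_right_mono of_nat_0_le_iff)
  qed
  ultimately have "1 \<le> (0::real)"
    by (intro LIMSEQ_le[of "\<lambda>n. 1 - (1 + R) / real (Suc n)" 1]) auto
  then show False by simp
qed

text \<open>The bound covers all times up to T and not just [0,T], since the delayed term reaches
  arbitrarily far back; the past contributes the bound of the initial function.\<close>

lemma second_moment_locally_bounded: "\<exists>C\<ge>0. \<forall>t\<le>T. expectation (\<lambda>w. (X t w)\<^sup>2) \<le> C"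
proof -
  obtain B where B: "\<And>t. t \<le> 0 \<Longrightarrow> \<bar>\<phi> t\<bar> \<le> B" using initial_bounded by blast
  obtain C where C: "\<And>t. t \<in> {0..T} \<Longrightarrow> \<bar>mean t\<bar> \<le> C" using mean_locally_bounded by blast
  have "expectation (\<lambda>w. (X t w)\<^sup>2) \<le> B\<^sup>2 + R + C\<^sup>2" if "t \<le> T" for t
  proof (cases "t \<le> 0")
    case True
    have "(\<phi> t)\<^sup>2 \<le> B\<^sup>2" using B[OF True] by (simp add: abs_le_square_iff[symmetric])
    then show ?thesis using R_nonneg expectation_X_square_initial[OF True] zero_le_power2[of C] by linarith
  next
    case False
    then have "(mean t)\<^sup>2 \<le> C\<^sup>2" using C[of t] that by (simp add: abs_le_square_iff[symmetric])
    then show ?thesis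
      using variance_le[of t] False expectation_X_square[of t] zero_le_power2[of B] by linarith
  qed
  moreover have "0 \<le> B\<^sup>2 + R + C\<^sup>2" using R_nonneg by simp
  ultimately show ?thesis by blast
qed

text \<open>Path continuity gives convergence in probability along any sequence of times, and the
  local second moment bound lets the weak limit lemma pass to the pairing with Y. This covers t
  \<ge> 0; for t \<le> 0 the pairing is a multiple of \<phi>, and the two closed half-lines are
  glued at 0.\<close>

lemma continuous_expectation_X_mult:
  assumes Y: "square_integrable M Y"
  shows "continuous_on UNIV (\<lambda>t. expectation (\<lambda>w. X t w * Y w))"
proof -
  have "continuous_on {..0} (\<lambda>t. expectation (\<lambda>w. X t w * Y w))"
    using expectation_X_mult_initial
    by (subst continuous_on_cong[OF refl, of _ _ "\<lambda>t. \<phi> t * expectation Y"])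
      (auto intro!: continuous_intros initial_continuous)
  moreover have "continuous_on {0..} (\<lambda>t. expectation (\<lambda>w. X t w * Y w))"
    unfolding continuous_on_sequentially
  proof (intro allI ballI impI, elim conjE)
    fix u :: "nat \<Rightarrow> real" and t assume t: "t \<in> {0..}" and u: "\<forall>n. u n \<in> {0..}" and lim: "u \<longlonglongrightarrow> t"
    obtain T where T: "\<And>n. u n \<le> T"
      using convergent_imp_bounded[OF lim] by (auto simp: bounded_iff) (meson abs_le_D1)
    obtain C where C: "0 \<le> C" "\<And>t. t \<le> T \<Longrightarrow> expectation (\<lambda>w. (X t w)\<^sup>2) \<le> C"
      using second_moment_locally_bounded[of T] by blast
    have "(\<lambda>n. expectation (\<lambda>w. \<bar>(X (u n) w - X t w) * Y w\<bar>)) \<longlonglongrightarrow> 0"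
    proof (rule tendsto_integral_mult_of_bounded_L2[OF _ _ _ Y])
      show "square_integrable M (\<lambda>w. X (u n) w - X t w)" for n
        by (rule square_integrable_diff[OF square_integrable_X square_integrable_X])
      show "expectation (\<lambda>w. (X (u n) w - X t w)\<^sup>2) \<le> 2 * C + 2 * expectation (\<lambda>w. (X t w)\<^sup>2)" for n
        using expectation_square_diff_le[OF square_integrable_X[of "u n"] square_integrable_X[of t]] C(2)[OF T[of n]]
        by simp
      show "(\<lambda>n. expectation (\<lambda>w. min 1 \<bar>X (u n) w - X t w\<bar>)) \<longlonglongrightarrow> 0"
      proof (rule tendsto_expectation_min_of_AE)
        show "AE w in M. (\<lambda>n. X (u n) w - X t w) \<longlonglongrightarrow> 0"
          using X_continuous
        proof eventually_elim
          case (elim w)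
          have "(\<lambda>n. X (u n) w) \<longlonglongrightarrow> X t w"
            using elim t u lim unfolding continuous_on_sequentially comp_def by blast
          then show ?case by (simp add: LIM_zero)
        qed
      qed measurable
    qed
    then show "((\<lambda>t. expectation (\<lambda>w. X t w * Y w)) \<circ> u) \<longlonglongrightarrow> expectation (\<lambda>w. X t w * Y w)"
      unfolding comp_def
      by (intro tendsto_of_expectation_abs_diff square_integrable_mult square_integrable_X Y)
        (simp add: left_diff_distrib)
  qed
  ultimately have "continuous_on ({..0} \<union> {0..}) (\<lambda>t. expectation (\<lambda>w. X t w * Y w))"
    by (intro continuous_on_closed_Un) auto
  moreover have "{..0} \<union> {0..} = (UNIV :: real set)" by auto
  ultimately show ?thesis by simp
qed

lemma continuous_mean: "continuous_on UNIV mean"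
  using continuous_expectation_X_mult[OF square_integrable_const[of 1]] by (simp add: mean_def)

section \<open>Moments of the delayed term and of affine functionals of the solution\<close>

lemma delay_term_eq:
  assumes "w \<in> space M"
  shows "delay_term K X t w = (\<integral>s. X (t - s) w \<partial>kernel_measure K)"
proof -
  have [measurable]: "(\<lambda>t. X t w) \<in> borel_measurable borel"
    using measurable_Pair1[OF X_joint_measurable assms] by simp
  show ?thesis
    unfolding delay_term_def by (subst integral_kernel_measure[OF kernel]) auto
qed

lemma delay_joint_measurable:
  "(\<lambda>(t, w). \<integral>s. X (t - s) w \<partial>kernel_measure K) \<in> borel_measurable (lborel \<Otimes>\<^sub>M M)"
proof -
  have "(\<lambda>p. (fst (fst p) - snd p, snd (fst p))) \<in> ((lborel \<Otimes>\<^sub>M M) \<Otimes>\<^sub>M kernel_measure K) \<rightarrow>\<^sub>M (lborel \<Otimes>\<^sub>M M)"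
    by measurable
  from measurable_compose[OF this X_joint_measurable]
  have [measurable]: "(\<lambda>(p, s). X (fst p - s) (snd p)) \<in> borel_measurable ((lborel \<Otimes>\<^sub>M M) \<Otimes>\<^sub>M kernel_measure K)"
    by (simp add: case_prod_beta')
  show ?thesis unfolding case_prod_beta' by measurable
qed

abbreviation delayed :: "real \<Rightarrow> 'w \<Rightarrow> real" where
  "delayed t w \<equiv> \<integral>s. X (t - s) w \<partial>kernel_measure K"

text \<open>The kernel measure has mass 1 and charges only s \<ge> 0, so a second moment bound valid
  up to time t passes to the average over the past with the same constant.\<close>

lemma
  assumes C: "\<And>s. s \<le> t \<Longrightarrow> expectation (\<lambda>w. (X s w)\<^sup>2) \<le> C"
  shows square_integrable_delayed: "square_integrable M (delayed t)"
    and delayed_square_le: "expectation (\<lambda>w. (delayed t w)\<^sup>2) \<le> C"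
    and expectation_delayed_mult: "square_integrable M Y \<Longrightarrow>
      expectation (\<lambda>w. delayed t w * Y w) = (\<integral>s. expectation (\<lambda>w. X (t - s) w * Y w) \<partial>kernel_measure K)"
proof -
  have "0 \<le> expectation (\<lambda>w. (X t w)\<^sup>2)" by simp
  also have "\<dots> \<le> C" by (rule C) simp
  finally have C0: "0 \<le> C" .
  have "(\<lambda>p. (t - fst p, snd p)) \<in> (kernel_measure K \<Otimes>\<^sub>M M) \<rightarrow>\<^sub>M (lborel \<Otimes>\<^sub>M M)"
    by measurable
  from measurable_compose[OF this X_joint_measurable]
  have m: "(\<lambda>(s, w). X (t - s) w) \<in> borel_measurable (kernel_measure K \<Otimes>\<^sub>M M)"
    by (simp add: case_prod_beta')
  have bd: "AE s in kernel_measure K. (\<integral>\<^sup>+w. ennreal ((X (t - s) w)\<^sup>2) \<partial>M) \<le> ennreal C"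
    using AE_kernel_measure[OF kernel]
  proof eventually_elim
    case (elim s)
    then show ?case using C[of "t - s"]
      by (simp add: nn_integral_square_eq[OF square_integrable_X] ennreal_leI)
  qed
  note G = prob_space_axioms \<kappa>.finite_measure_axioms m bd C0
  show "square_integrable M (delayed t)" by (rule square_integrable_integral[OF G])
  show "expectation (\<lambda>w. (delayed t w)\<^sup>2) \<le> C"
    using expectation_square_integral_le[OF G] \<kappa>.prob_space by simp
  show "expectation (\<lambda>w. delayed t w * Y w) = (\<integral>s. expectation (\<lambda>w. X (t - s) w * Y w) \<partial>kernel_measure K)"
    if "square_integrable M Y"
    by (rule expectation_integral_mult[OF G that])
qed

text \<open>One affine integrand serves two purposes: p = 0 with A the whole line is the drift, and
  p = \<open>\<sigma>0\<close> with A = {..r} is the noise intensity cut at r.\<close>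

lemma
  assumes A[measurable]: "A \<in> sets borel"
  shows square_integrable_affine_integral:
      "square_integrable M (\<lambda>w. \<integral>s. indicator A s * (p + q * X s w + r * delayed s w) \<partial>lborel_on {0..t})" (is ?A)
    and affine_energy_finite:
      "(\<integral>\<^sup>+w. \<integral>\<^sup>+s. ennreal ((p + q * X s w + r * delayed s w)\<^sup>2) \<partial>lborel_on {0..t} \<partial>M) < \<infinity>" (is ?B)
    and expectation_affine_integral_mult: "square_integrable M Y \<Longrightarrow>
      expectation (\<lambda>w. (\<integral>s. indicator A s * (p + q * X s w + r * delayed s w) \<partial>lborel_on {0..t}) * Y w)
      = (\<integral>s. indicator A s * (p * expectation Y + q * expectation (\<lambda>w. X s w * Y w)
          + r * (\<integral>u. expectation (\<lambda>w. X (s - u) w * Y w) \<partial>kernel_measure K)) \<partial>lborel_on {0..t})"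
proof -
  let ?\<nu> = "lborel_on {0..t}"
  let ?g = "\<lambda>s w. p + q * X s w + r * delayed s w"
  interpret \<nu>: finite_measure ?\<nu> by (rule finite_measure_lborel_on_Icc)
  interpret P: pair_sigma_finite ?\<nu> M ..
  obtain C where C0: "0 \<le> C" and C: "\<And>s. s \<le> t \<Longrightarrow> expectation (\<lambda>w. (X s w)\<^sup>2) \<le> C"
    using second_moment_locally_bounded[of t] by blast
  have sets: "sets (?\<nu> \<Otimes>\<^sub>M M) = sets (lborel \<Otimes>\<^sub>M M)" by (rule sets_pair_measure_cong) simp_all
  have [measurable]: "(\<lambda>(s, w). X s w) \<in> borel_measurable (?\<nu> \<Otimes>\<^sub>M M)"
    "(\<lambda>(s, w). delayed s w) \<in> borel_measurable (?\<nu> \<Otimes>\<^sub>M M)"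
    using X_joint_measurable delay_joint_measurable measurable_cong_sets[OF sets refl] by blast+
  have gm[measurable]: "(\<lambda>(s, w). ?g s w) \<in> borel_measurable (?\<nu> \<Otimes>\<^sub>M M)" by measurable
  have m: "(\<lambda>(s, w). indicator A s * ?g s w) \<in> borel_measurable (?\<nu> \<Otimes>\<^sub>M M)" by measurable
  \<comment> \<open>Two applications of (x - y)^2 \<le> 2 x^2 + 2 y^2, one to split off the delayed
    term and one to split p + q X.\<close>
  define C' where "C' = 2 * (2 * p\<^sup>2 + 2 * (q\<^sup>2 * C)) + 2 * (r\<^sup>2 * C)"
  have C'0: "0 \<le> C'" using C0 by (simp add: C'_def)
  have g2: "square_integrable M (?g s) \<and> (\<integral>\<^sup>+w. ennreal ((?g s w)\<^sup>2) \<partial>M) \<le> ennreal C'" if s: "s \<le> t" for s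
  proof -
    have Cs: "\<And>u. u \<le> s \<Longrightarrow> expectation (\<lambda>w. (X u w)\<^sup>2) \<le> C" using C s by simp
    note d = square_integrable_delayed[OF Cs] delayed_square_le[OF Cs]
    have i: "square_integrable M (\<lambda>w. q * X s w)" "square_integrable M (\<lambda>w. r * delayed s w)"
      by (intro square_integrable_cmult square_integrable_X d)+
    have g: "square_integrable M (?g s)"
      by (intro square_integrable_add square_integrable_const i)
    have "expectation (\<lambda>w. (?g s w)\<^sup>2) \<le> expectation (\<lambda>w. 2 * (2 * p\<^sup>2 + 2 * (q\<^sup>2 * (X s w)\<^sup>2)) + 2 * (r\<^sup>2 * (delayed s w)\<^sup>2))"
    proof (rule integral_mono)
      show "integrable M (\<lambda>w. (?g s w)\<^sup>2)" using g by (simp add: square_integrable_def)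
      show "integrable M (\<lambda>w. 2 * (2 * p\<^sup>2 + 2 * (q\<^sup>2 * (X s w)\<^sup>2)) + 2 * (r\<^sup>2 * (delayed s w)\<^sup>2))"
        using square_integrable_square[OF square_integrable_X[of s]] square_integrable_square[OF d(1)] by simp
      fix w
      have "(?g s w)\<^sup>2 \<le> 2 * (p + q * X s w)\<^sup>2 + 2 * (r * delayed s w)\<^sup>2"
        using power2_diff_le[of "p + q * X s w" "- (r * delayed s w)"] by simp
      moreover have "(p + q * X s w)\<^sup>2 \<le> 2 * p\<^sup>2 + 2 * (q * X s w)\<^sup>2"
        using power2_diff_le[of p "- (q * X s w)"] by simp
      ultimately show "(?g s w)\<^sup>2 \<le> 2 * (2 * p\<^sup>2 + 2 * (q\<^sup>2 * (X s w)\<^sup>2)) + 2 * (r\<^sup>2 * (delayed s w)\<^sup>2)"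
        by (simp add: power_mult_distrib)
    qed
    also have "\<dots> = 2 * (2 * p\<^sup>2 + 2 * (q\<^sup>2 * expectation (\<lambda>w. (X s w)\<^sup>2))) + 2 * (r\<^sup>2 * expectation (\<lambda>w. (delayed s w)\<^sup>2))"
      using square_integrable_square[OF square_integrable_X[of s]] square_integrable_square[OF d(1)] by (simp add: prob_space)
    also have "\<dots> \<le> C'"
      unfolding C'_def using C[OF s] d(2) by (intro add_mono mult_left_mono order_refl) auto
    finally show ?thesis using g by (simp add: nn_integral_square_eq[OF g] ennreal_leI)
  qed
  have ae: "AE s in ?\<nu>. s \<in> {0..t}" by (subst AE_lborel_on) auto
  have bd: "AE s in ?\<nu>. (\<integral>\<^sup>+w. ennreal ((indicator A s * ?g s w)\<^sup>2) \<partial>M) \<le> ennreal C'"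
    using ae
  proof eventually_elim
    case (elim s)
    then show ?case using g2[of s] C'0 by (cases "s \<in> A") auto
  qed
  note G = prob_space_axioms finite_measure_lborel_on_Icc[of t] m bd C'0
  show ?A by (rule square_integrable_integral[OF G])
  have "(\<integral>\<^sup>+w. \<integral>\<^sup>+s. ennreal ((?g s w)\<^sup>2) \<partial>?\<nu> \<partial>M) = (\<integral>\<^sup>+s. \<integral>\<^sup>+w. ennreal ((?g s w)\<^sup>2) \<partial>M \<partial>?\<nu>)"
    by (rule P.Fubini') measurable
  also have "\<dots> \<le> (\<integral>\<^sup>+s. ennreal C' \<partial>?\<nu>)"
    by (intro nn_integral_mono_AE eventually_mono[OF ae]) (use g2 in auto)
  also have "\<dots> < \<infinity>" by (simp add: \<nu>.emeasure_eq_measure ennreal_mult_less_top)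
  finally show ?B .
  assume Y: "square_integrable M Y"
  have "expectation (\<lambda>w. (\<integral>s. indicator A s * ?g s w \<partial>?\<nu>) * Y w)
    = (\<integral>s. expectation (\<lambda>w. indicator A s * ?g s w * Y w) \<partial>?\<nu>)"
    by (rule expectation_integral_mult[OF G Y])
  also have "\<dots> = (\<integral>s. indicator A s * (p * expectation Y + q * expectation (\<lambda>w. X s w * Y w)
          + r * (\<integral>u. expectation (\<lambda>w. X (s - u) w * Y w) \<partial>kernel_measure K)) \<partial>?\<nu>)"
  proof (rule integral_cong_AE)
    have [measurable]: "(\<lambda>s. expectation (\<lambda>w. X s w * Y w)) \<in> borel_measurable borel"
      by (rule borel_measurable_continuous_onI[OF continuous_expectation_X_mult[OF Y]])
    have [measurable]: "Y \<in> borel_measurable M" using Y by (simp add: square_integrable_def)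
    show "(\<lambda>s. expectation (\<lambda>w. indicator A s * ?g s w * Y w)) \<in> borel_measurable ?\<nu>" by measurable
    show "(\<lambda>s. indicator A s * (p * expectation Y + q * expectation (\<lambda>w. X s w * Y w)
          + r * (\<integral>u. expectation (\<lambda>w. X (s - u) w * Y w) \<partial>kernel_measure K))) \<in> borel_measurable ?\<nu>"
      by measurable
    show "AE s in ?\<nu>. expectation (\<lambda>w. indicator A s * ?g s w * Y w)
       = indicator A s * (p * expectation Y + q * expectation (\<lambda>w. X s w * Y w)
          + r * (\<integral>u. expectation (\<lambda>w. X (s - u) w * Y w) \<partial>kernel_measure K))"
      using ae
    proof eventually_elim
      case (elim s)
      have Cs: "\<And>u. u \<le> s \<Longrightarrow> expectation (\<lambda>w. (X u w)\<^sup>2) \<le> C" using C elim by simp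
      note i = square_integrable_integrable[OF Y] square_integrable_mult[OF square_integrable_X Y, of s]
        square_integrable_mult[OF square_integrable_delayed[OF Cs] Y]
      have "expectation (\<lambda>w. indicator A s * ?g s w * Y w)
        = expectation (\<lambda>w. indicator A s * (p * Y w + q * (X s w * Y w) + r * (delayed s w * Y w)))"
        by (intro Bochner_Integration.integral_cong refl) (simp add: algebra_simps)
      also have "\<dots> = indicator A s * (p * expectation Y + q * expectation (\<lambda>w. X s w * Y w) + r * expectation (\<lambda>w. delayed s w * Y w))"
        using i by simp
      finally show ?case using expectation_delayed_mult[OF Cs Y] by simp
    qed
  qed
  finally show "expectation (\<lambda>w. (\<integral>s. indicator A s * ?g s w \<partial>?\<nu>) * Y w)
    = (\<integral>s. indicator A s * (p * expectation Y + q * expectation (\<lambda>w. X s w * Y w)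
          + r * (\<integral>u. expectation (\<lambda>w. X (s - u) w * Y w) \<partial>kernel_measure K)) \<partial>?\<nu>)" .
qed

section \<open>The mean noise intensity and the correlation with the Wiener process\<close>

definition mean_noise :: "real \<Rightarrow> real" where
  "mean_noise s = \<sigma>0 + \<sigma>1 * mean s + \<sigma>2 * (\<integral>u. mean (s - u) \<partial>kernel_measure K)"

lemma mean_bounded: "\<exists>C. \<forall>t\<le>T. \<bar>mean t\<bar> \<le> C"
proof -
  obtain C where C: "\<And>s. s \<le> T \<Longrightarrow> expectation (\<lambda>w. (X s w)\<^sup>2) \<le> C"
    using second_moment_locally_bounded[of T] by blast
  have "\<bar>mean t\<bar> \<le> sqrt C" if "t \<le> T" for t
  proof -
    have "0 \<le> expectation (\<lambda>w. (X t w - mean t)\<^sup>2)" by simp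
    then have "(mean t)\<^sup>2 \<le> C" using expectation_X_square[of t] C[OF that] by linarith
    then show ?thesis by (metis real_sqrt_abs real_sqrt_le_iff)
  qed
  then show ?thesis by blast
qed

text \<open>Dominated convergence under the kernel measure. A convergent sequence of times has an
  upper bound T, and the bound of the mean on (-\<infinity>,T] dominates all shifted
  functions.\<close>

lemma continuous_mean_noise: "continuous_on UNIV mean_noise"
proof -
  have [measurable]: "mean \<in> borel_measurable borel"
    by (rule borel_measurable_continuous_onI[OF continuous_mean])
  have "continuous_on UNIV (\<lambda>s. \<integral>u. mean (s - u) \<partial>kernel_measure K)"
    unfolding continuous_on_sequentially comp_def
  proof (intro allI ballI impI, elim conjE)
    fix v :: "nat \<Rightarrow> real" and s assume lim: "v \<longlonglongrightarrow> s"
    obtain T where T: "\<And>n. v n \<le> T"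
      using convergent_imp_bounded[OF lim] by (auto simp: bounded_iff) (meson abs_le_D1)
    obtain C where C: "\<And>t. t \<le> T \<Longrightarrow> \<bar>mean t\<bar> \<le> C" using mean_bounded[of T] by blast
    show "(\<lambda>n. \<integral>u. mean (v n - u) \<partial>kernel_measure K) \<longlonglongrightarrow> (\<integral>u. mean (s - u) \<partial>kernel_measure K)"
    proof (rule integral_dominated_convergence[where w="\<lambda>_. C"])
      have "(\<lambda>n. mean (v n - u)) \<longlonglongrightarrow> mean (s - u)" for u
        using continuous_on_tendsto_compose[OF continuous_mean tendsto_diff[OF lim tendsto_const]] by simp
      then show "AE u in kernel_measure K. (\<lambda>n. mean (v n - u)) \<longlonglongrightarrow> mean (s - u)" by simp
      show "AE u in kernel_measure K. norm (mean (v n - u)) \<le> C" for n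
        using AE_kernel_measure[OF kernel]
      proof eventually_elim
        case (elim u)
        then show ?case using C[of "v n - u"] T[of n] by simp
      qed
    qed auto
  qed
  then show ?thesis unfolding mean_noise_def
    by (intro continuous_intros continuous_mean)
qed

text \<open>The bound is uniform in t although the mean may be unbounded: \<open>W r\<close> has
  mean 0, so X may be replaced by its centred version, to which Cauchy-Schwarz and the variance
  bound R apply.\<close>

lemma expectation_W_mult_bounded:
  assumes r: "0 \<le> r"
  shows "\<bar>expectation (\<lambda>w. X t w * W r w)\<bar> \<le> sqrt (R * expectation (\<lambda>w. (W r w)\<^sup>2))"
proof (cases "t \<le> 0")
  case True
  then show ?thesis using expectation_X_mult_initial[OF True] expectation_W[OF r] R_nonneg by simp
next
  case False
  then have t: "0 \<le> t" by simp
  note sqW = square_integrable_W[OF r]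
  have "expectation (\<lambda>w. (X t w - mean t) * W r w) = expectation (\<lambda>w. X t w * W r w - mean t * W r w)"
    by (simp add: left_diff_distrib)
  also have "\<dots> = expectation (\<lambda>w. X t w * W r w)"
    using square_integrable_mult[OF square_integrable_X sqW] square_integrable_integrable[OF sqW]
      expectation_W[OF r] by simp
  finally have "(expectation (\<lambda>w. X t w * W r w))\<^sup>2
     \<le> expectation (\<lambda>w. (X t w - mean t)\<^sup>2) * expectation (\<lambda>w. (W r w)\<^sup>2)"
    using Cauchy_Schwarz_square_integrable[OF square_integrable_centred[OF t] sqW] by simp
  also have "\<dots> \<le> R * expectation (\<lambda>w. (W r w)\<^sup>2)"
    using variance_le[OF t] by (intro mult_right_mono) auto
  finally show ?thesis by (metis real_sqrt_abs real_sqrt_le_iff)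
qed

text \<open>The correlation of the solution with \<open>W r\<close> solves the deterministic delay equation, forced by
  the mean noise intensity up to time \<open>r\<close>.\<close>

lemma correlation_equation:
  assumes r: "0 \<le> r" and t: "0 \<le> t"
  shows "expectation (\<lambda>w. X t w * W r w) =
    (\<integral>s. a * expectation (\<lambda>w. X s w * W r w)
      + b * (\<integral>u. expectation (\<lambda>w. X (s - u) w * W r w) \<partial>kernel_measure K)
      + indicator {..r} s * mean_noise s \<partial>lborel_on {0..t})"
proof -
  let ?\<nu> = "lborel_on {0..t}"
  interpret \<nu>: finite_measure ?\<nu> by (rule finite_measure_lborel_on_Icc)
  let ?V = "\<lambda>w. \<integral>s. indicator UNIV s * (0 + a * X s w + b * delayed s w) \<partial>?\<nu>"
  let ?c = "\<lambda>s. expectation (\<lambda>w. X s w * W r w)"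
  let ?g = "\<lambda>s w. \<sigma>0 + \<sigma>1 * X s w + \<sigma>2 * delayed s w"
  note sqW = square_integrable_W[OF r]
  obtain J where J: "has_ito_integral M F W (\<lambda>s w. \<sigma>0 + \<sigma>1 * X s w + \<sigma>2 * delay_term K X s w) t J"
    and XJ: "AE w in M. X t w = \<phi> 0 + (LINT s:{0..t}|lborel. a * X s w + b * delay_term K X s w) + J w"
    using solution t unfolding sdde_solution_def by blast
  have V: "(LINT s:{0..t}|lborel. a * X s w + b * delay_term K X s w) = ?V w" if w: "w \<in> space M" for w
  proof -
    have [measurable]: "(\<lambda>s. X s w) \<in> borel_measurable borel" "(\<lambda>s. delayed s w) \<in> borel_measurable borel"
      using measurable_Pair1[OF X_joint_measurable w] measurable_Pair1[OF delay_joint_measurable w] by simp_all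
    show ?thesis by (subst integral_lborel_on) (simp_all add: delay_term_eq[OF w])
  qed
  have Jm: "J \<in> borel_measurable M" using J by (simp add: has_ito_integral_def)
  have XJ': "AE w in M. X t w - (\<phi> 0 + ?V w) = J w"
    using XJ AE_space
  proof eventually_elim
    case (elim w)
    have "x - (p + v) = j" if "x = p + v + j" for x p v j :: real using that by simp
    from this[OF elim(1)[unfolded V[OF elim(2)]]] show ?case .
  qed
  have sqV: "square_integrable M ?V" by (rule square_integrable_affine_integral) simp
  \<comment> \<open>The equation expresses the Ito integral through terms already known to be square
    integrable, so this comes without an isometry for J.\<close>
  have sqJ: "square_integrable M J"
    by (rule square_integrable_cong_AE[OF _ XJ' Jm])
      (intro square_integrable_diff square_integrable_add square_integrable_X square_integrable_const sqV)
  have EJ: "expectation (\<lambda>w. J w * W r w) = (\<integral>s. indicator {..r} s * mean_noise s \<partial>?\<nu>)"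
  proof -
    have dt: "(\<integral>\<^sup>+s. ennreal ((\<sigma>0 + \<sigma>1 * X s w + \<sigma>2 * delay_term K X s w)\<^sup>2) \<partial>?\<nu>) = (\<integral>\<^sup>+s. ennreal ((?g s w)\<^sup>2) \<partial>?\<nu>)"
      "(\<integral>s. indicator {..r} s * (\<sigma>0 + \<sigma>1 * X s w + \<sigma>2 * delay_term K X s w) \<partial>?\<nu>) = (\<integral>s. indicator {..r} s * ?g s w \<partial>?\<nu>)"
      if "w \<in> space M" for w
      by (simp_all only: delay_term_eq[OF that])
    have "expectation (\<lambda>w. J w * W r w)
      = expectation (\<lambda>w. \<integral>s. indicator {..r} s * (\<sigma>0 + \<sigma>1 * X s w + \<sigma>2 * delay_term K X s w) \<partial>?\<nu>)"
    proof (rule expectation_ito_integral_mult_W[OF J t r sqJ])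
      have "(\<integral>\<^sup>+w. \<integral>\<^sup>+s. ennreal ((\<sigma>0 + \<sigma>1 * X s w + \<sigma>2 * delay_term K X s w)\<^sup>2) \<partial>?\<nu> \<partial>M)
        = (\<integral>\<^sup>+w. \<integral>\<^sup>+s. ennreal ((?g s w)\<^sup>2) \<partial>?\<nu> \<partial>M)"
        by (rule nn_integral_cong) (rule dt)
      also have "\<dots> < \<infinity>" by (rule affine_energy_finite[of "{}"]) simp
      finally show "(\<integral>\<^sup>+w. \<integral>\<^sup>+s. ennreal ((\<sigma>0 + \<sigma>1 * X s w + \<sigma>2 * delay_term K X s w)\<^sup>2) \<partial>?\<nu> \<partial>M) < \<infinity>" .
    qed
    also have "\<dots> = expectation (\<lambda>w. (\<integral>s. indicator {..r} s * ?g s w \<partial>?\<nu>) * 1)"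
      \<comment> \<open>The constant 1 as test variable turns the general pairing formula into a
        formula for means, and so produces \<open>mean_noise\<close>.\<close>
      unfolding mult_1_right by (rule Bochner_Integration.integral_cong[OF refl]) (rule dt)
    also have "\<dots> = (\<integral>s. indicator {..r} s * (\<sigma>0 * expectation (\<lambda>w. 1) + \<sigma>1 * expectation (\<lambda>w. X s w * 1)
          + \<sigma>2 * (\<integral>u. expectation (\<lambda>w. X (s - u) w * 1) \<partial>kernel_measure K)) \<partial>?\<nu>)"
      by (rule expectation_affine_integral_mult) (simp_all add: square_integrable_const)
    finally show ?thesis by (simp add: mean_noise_def mean_def prob_space)
  qed
  have EV: "expectation (\<lambda>w. ?V w * W r w)
    = (\<integral>s. indicator UNIV s * (0 * expectation (W r) + a * ?c s + b * (\<integral>u. ?c (s - u) \<partial>kernel_measure K)) \<partial>?\<nu>)"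
    by (rule expectation_affine_integral_mult[OF _ sqW]) simp
  have "?c t = expectation (\<lambda>w. \<phi> 0 * W r w + ?V w * W r w + J w * W r w)"
  proof (rule integral_cong_AE)
    have [measurable]: "W r \<in> borel_measurable M" "?V \<in> borel_measurable M"
      using sqW sqV by (simp_all only: square_integrable_def)
    note [measurable] = Jm
    show "(\<lambda>w. X t w * W r w) \<in> borel_measurable M" by measurable
    show "(\<lambda>w. \<phi> 0 * W r w + ?V w * W r w + J w * W r w) \<in> borel_measurable M"
      by (intro borel_measurable_add borel_measurable_times borel_measurable_const) fact+
    show "AE w in M. X t w * W r w = \<phi> 0 * W r w + ?V w * W r w + J w * W r w"
      using XJ'
    proof eventually_elim
      case (elim w)
      then have "X t w = \<phi> 0 + ?V w + J w" by linarith
      then show ?case by (simp only: distrib_right)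
    qed
  qed
  also have "\<dots> = \<phi> 0 * expectation (W r) + expectation (\<lambda>w. ?V w * W r w) + expectation (\<lambda>w. J w * W r w)"
    using square_integrable_mult[OF sqV sqW] square_integrable_mult[OF sqJ sqW]
      square_integrable_integrable[OF sqW]
    by (subst Bochner_Integration.integral_add, simp, simp)+ simp
  also have "\<dots> = (\<integral>s. a * ?c s + b * (\<integral>u. ?c (s - u) \<partial>kernel_measure K) \<partial>?\<nu>)
     + (\<integral>s. indicator {..r} s * mean_noise s \<partial>?\<nu>)"
    unfolding EV EJ expectation_W[OF r] by simp
  also have "\<dots> = (\<integral>s. a * ?c s + b * (\<integral>u. ?c (s - u) \<partial>kernel_measure K) + indicator {..r} s * mean_noise s \<partial>?\<nu>)"
  proof (rule Bochner_Integration.integral_add[symmetric])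
    have [measurable]: "?c \<in> borel_measurable borel"
      by (rule borel_measurable_continuous_onI[OF continuous_expectation_X_mult[OF sqW]])
    have [measurable]: "mean_noise \<in> borel_measurable borel"
      by (rule borel_measurable_continuous_onI[OF continuous_mean_noise])
    define B where "B = sqrt (R * expectation (\<lambda>w. (W r w)\<^sup>2))"
    have B: "\<bar>?c s\<bar> \<le> B" for s unfolding B_def by (rule expectation_W_mult_bounded[OF r])
    have i1: "integrable ?\<nu> ?c" by (rule \<nu>.integrable_const_bound[where B=B]) (use B in auto)
    have "\<bar>\<integral>u. ?c (s - u) \<partial>kernel_measure K\<bar> \<le> B" for s
    proof -
      have "norm (\<integral>u. ?c (s - u) \<partial>kernel_measure K) \<le> (\<integral>u. norm (?c (s - u)) \<partial>kernel_measure K)"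
        by (rule integral_norm_bound)
      also have "\<dots> \<le> B"
        using B by (intro \<kappa>.integral_le_const \<kappa>.integrable_const_bound[where B=B]) auto
      finally show ?thesis by simp
    qed
    then have i2: "integrable ?\<nu> (\<lambda>s. \<integral>u. ?c (s - u) \<partial>kernel_measure K)"
      by (intro \<nu>.integrable_const_bound[where B=B]) auto
    show "integrable ?\<nu> (\<lambda>s. a * ?c s + b * (\<integral>u. ?c (s - u) \<partial>kernel_measure K))"
      using i1 i2 by simp
    have "bounded (mean_noise ` {0..t})"
      by (intro compact_imp_bounded compact_continuous_image continuous_on_subset[OF continuous_mean_noise]) auto
    then obtain G where G: "\<And>s. s \<in> {0..t} \<Longrightarrow> \<bar>mean_noise s\<bar> \<le> G"
      unfolding bounded_real_image by blast
    show "integrable ?\<nu> (\<lambda>s. indicator {..r} s * mean_noise s)"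
    proof (rule \<nu>.integrable_const_bound[where B=G])
      show "AE s in ?\<nu>. norm (indicator {..r} s * mean_noise s) \<le> G"
        unfolding AE_lborel_on[of "{0..t}", simplified]
      proof (intro AE_I2 impI)
        fix s assume "0 \<le> s \<and> s \<le> t"
        then show "norm (indicator {..r} s * mean_noise s) \<le> G"
          using G[of s] by (cases "s \<in> {..r}") auto
      qed
    qed measurable
  qed
  finally show ?thesis .
qed

lemma mean_noise_0:
  assumes z: "0 < Re z" and root: "char_fun a b K z = 0"
  shows "\<sigma>0 + \<sigma>1 * \<phi> 0 + \<sigma>2 * (LINT u:{0..}|lborel. K u * \<phi> (- u)) = 0"
proof -
  let ?f = "\<lambda>s. exp (- z * complex_of_real s) * complex_of_real (mean_noise s)"
  have [measurable]: "mean_noise \<in> borel_measurable borel"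
    by (rule borel_measurable_continuous_onI[OF continuous_mean_noise])
  have cont: "continuous_on S ?f" for S
    by (intro continuous_intros continuous_on_subset[OF continuous_mean_noise]) auto
  have int0: "integral {0..r} ?f = 0" if r: "0 \<le> r" for r
  proof -
    note sqW = square_integrable_W[OF r]
    let ?c = "\<lambda>t. expectation (\<lambda>w. X t w * W r w)"
    have "bounded (mean_noise ` {0..r})"
      by (intro compact_imp_bounded compact_continuous_image continuous_on_subset[OF continuous_mean_noise]) auto
    then obtain G where G: "\<And>s. s \<in> {0..r} \<Longrightarrow> \<bar>mean_noise s\<bar> \<le> G"
      unfolding bounded_real_image by blast
    have "laplace (\<lambda>s. indicator {..r} s * mean_noise s) z = 0"
    proof (rule laplace_forcing_eq_0[OF kernel z root, of ?c])
      show "?c \<in> borel_measurable borel"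
        by (rule borel_measurable_continuous_onI[OF continuous_expectation_X_mult[OF sqW]])
      show "\<bar>?c t\<bar> \<le> sqrt (R * expectation (\<lambda>w. (W r w)\<^sup>2))" for t
        by (rule expectation_W_mult_bounded[OF r])
      show "?c t = 0" if "t \<le> 0" for t
        using expectation_X_mult_initial[OF that] expectation_W[OF r] by simp
      show "\<bar>indicator {..r} t * mean_noise t\<bar> \<le> \<bar>G\<bar>" if "0 \<le> t" for t
        using G[of t] that by (cases "t \<le> r") auto
      show "?c t = (\<integral>s. a * ?c s + b * (\<integral>u. ?c (s - u) \<partial>kernel_measure K)
          + indicator {..r} s * mean_noise s \<partial>lborel_on {0..t})" if "0 \<le> t" for t
        by (rule correlation_equation[OF r that])
    qed measurable
    also have "laplace (\<lambda>s. indicator {..r} s * mean_noise s) z = (LINT s:{0..r}|lborel. ?f s)"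
      unfolding laplace_def set_lebesgue_integral_def
      by (intro Bochner_Integration.integral_cong refl) (auto split: split_indicator)
    also have "\<dots> = integral {0..r} ?f"
      by (intro set_borel_integral_eq_integral borel_integrable_atLeastAtMost' cont)
    finally show ?thesis by simp
  qed
  \<comment> \<open>The primitive vanishes on all of [0,1], so its one-sided derivative at 0 does
    too; by continuity that derivative is \<open>?f 0 = mean_noise 0\<close>. At this one time every
    value of the mean that enters is a value of \<phi>.\<close>
  have "((\<lambda>u. integral {0..u} ?f) has_vector_derivative ?f 0) (at 0 within {0..1})"
    by (rule integral_has_vector_derivative[OF cont]) simp
  moreover have "((\<lambda>u. integral {0..u} ?f) has_vector_derivative 0) (at 0 within {0..1})"
  proof (rule has_vector_derivative_transform[OF _ _ has_vector_derivative_const[of 0]])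
    show "integral {0..u} ?f = 0" if "u \<in> {0..1}" for u using that by (intro int0) simp
  qed simp
  moreover have "at (0::real) within {0..1} \<noteq> bot"
    by (simp add: trivial_limit_within islimpt_Icc)
  ultimately have "?f 0 = 0" by (intro vector_derivative_unique_within)
  then have "mean_noise 0 = 0" by simp
  moreover have mean_initial: "mean t = \<phi> t" if "t \<le> 0" for t
    using expectation_X_mult_initial[OF that, of "\<lambda>w. 1"] by (simp add: mean_def prob_space)
  moreover have "(\<integral>u. mean (0 - u) \<partial>kernel_measure K) = (LINT u:{0..}|lborel. K u * \<phi> (- u))"
  proof -
    have [measurable]: "mean \<in> borel_measurable borel"
      by (rule borel_measurable_continuous_onI[OF continuous_mean])
    have "(\<integral>u. mean (0 - u) \<partial>kernel_measure K) = (LINT u:{0..}|lborel. K u *\<^sub>R mean (0 - u))"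
      by (rule integral_kernel_measure[OF kernel]) measurable
    also have "\<dots> = (LINT u:{0..}|lborel. K u * \<phi> (- u))"
      by (rule set_lebesgue_integral_cong) (simp_all add: mean_initial)
    finally show ?thesis .
  qed
  ultimately show ?thesis by (simp add: mean_noise_def)
qed

end

section \<open>Unboundedness of the second moment\<close>

text \<open>K is real, so real and imaginary parts pass under the integral. The exponent is written
  z * (-u) so that the right-hand sides are the delay integrals at time 0 of the initial functions
  Re exp (z t) and Im exp (z t).\<close>

lemma laplace_Re_Im:
  assumes K: "delay_kernel \<mu> K" and z: "0 \<le> Re z"
  shows "Re (laplace K z) = (LINT u:{0..}|lborel. K u * Re (exp (z * complex_of_real (- u))))"
    and "Im (laplace K z) = (LINT u:{0..}|lborel. K u * Im (exp (z * complex_of_real (- u))))"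
proof -
  interpret \<kappa>: prob_space "kernel_measure K" by (rule prob_space_kernel_measure[OF K])
  have int: "integrable (kernel_measure K) (\<lambda>s. exp (z * complex_of_real (- s)))"
  proof (rule \<kappa>.integrable_const_bound[where B=1])
    show "AE s in kernel_measure K. norm (exp (z * complex_of_real (- s))) \<le> 1"
      using AE_kernel_measure[OF K] by eventually_elim (use z in \<open>simp add: norm_exp_eq_Re\<close>)
  qed measurable
  have L: "laplace K z = (\<integral>s. exp (z * complex_of_real (- s)) \<partial>kernel_measure K)"
    unfolding laplace_kernel[OF K] by simp
  have "Re (laplace K z) = (\<integral>s. Re (exp (z * complex_of_real (- s))) \<partial>kernel_measure K)"
    unfolding L by (rule integral_Re[OF int, symmetric])
  also have "\<dots> = (LINT u:{0..}|lborel. K u *\<^sub>R Re (exp (z * complex_of_real (- u))))"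
    by (rule integral_kernel_measure[OF K]) measurable
  finally show "Re (laplace K z) = (LINT u:{0..}|lborel. K u * Re (exp (z * complex_of_real (- u))))"
    by (simp only: real_scaleR_def)
  have "Im (laplace K z) = (\<integral>s. Im (exp (z * complex_of_real (- s))) \<partial>kernel_measure K)"
    unfolding L by (rule integral_Im[OF int, symmetric])
  also have "\<dots> = (LINT u:{0..}|lborel. K u *\<^sub>R Im (exp (z * complex_of_real (- u))))"
    by (rule integral_kernel_measure[OF K]) measurable
  finally show "Im (laplace K z) = (LINT u:{0..}|lborel. K u * Im (exp (z * complex_of_real (- u))))"
    by (simp only: real_scaleR_def)
qed

text \<open>A mode that does not decay forwards in time is bounded backwards: its modulus exp (Re z
  * t) is at most 1 for t \<le> 0. This makes the modes of roots with positive real part admissible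
  initial functions.\<close>

lemma exp_mode_in_BC:
  assumes z: "0 \<le> Re z"
  shows "(\<lambda>t. Re (exp (z * complex_of_real t))) \<in> BC" "(\<lambda>t. Im (exp (z * complex_of_real t))) \<in> BC"
proof -
  have n: "norm (exp (z * complex_of_real t)) \<le> 1" if "t \<le> 0" for t
    using z that by (simp add: norm_exp_eq_Re mult_nonneg_nonpos)
  have "bounded ((\<lambda>t. Re (exp (z * complex_of_real t))) ` {..0})"
    unfolding bounded_real_image using order_trans[OF abs_Re_le_cmod n] by (intro exI[of _ 1]) blast
  then show "(\<lambda>t. Re (exp (z * complex_of_real t))) \<in> BC"
    by (auto simp: BC_def intro!: continuous_intros)
  have "bounded ((\<lambda>t. Im (exp (z * complex_of_real t))) ` {..0})"
    unfolding bounded_real_image using order_trans[OF abs_Im_le_cmod n] by (intro exI[of _ 1]) blast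
  then show "(\<lambda>t. Im (exp (z * complex_of_real t))) \<in> BC"
    by (auto simp: BC_def intro!: continuous_intros)
qed

theorem theorem3p6:
  fixes M :: "'w measure" and F :: "real \<Rightarrow> 'w measure" and W :: "real \<Rightarrow> 'w \<Rightarrow> real"
    and a b \<sigma>0 \<sigma>1 \<sigma>2 \<mu> :: real and K :: "real \<Rightarrow> real"
    and x :: "(real \<Rightarrow> real) \<Rightarrow> real \<Rightarrow> 'w \<Rightarrow> real"
  assumes "\<sigma>1 \<noteq> 0 \<or> \<sigma>2 \<noteq> 0"
    and "delay_kernel \<mu> K"
    and "filtered_prob_space M F"
    and "wiener_process M F W"
    and "\<And>\<phi>. \<phi> \<in> BC \<Longrightarrow> sdde_solution M F W a b K \<sigma>0 \<sigma>1 \<sigma>2 \<phi> (x \<phi>)"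
    and "alpha0 \<mu> a b K > 0"
    and "\<not> condition_H \<mu> a b K \<sigma>0 \<sigma>1 \<sigma>2"
  shows "\<not> second_moment_bounded M x"
proof
  assume "second_moment_bounded M x"
  then obtain R where R: "\<And>r. 0 < R r"
    "\<And>\<phi> t. \<phi> \<in> BC \<Longrightarrow> 0 \<le> t \<Longrightarrow> second_moment M (x \<phi>) t \<le> ennreal (R ((BC_norm \<phi>)\<^sup>2))"
    unfolding second_moment_bounded_def by blast
  obtain z where z: "z \<in> char_roots \<mu> a b K" and re: "0 < Re z"
    using assms(6) unfolding alpha0_def less_SUP_iff by (auto simp: zero_ereal_def)
  have root: "char_fun a b K z = 0" using z by (simp add: char_roots_def)
  \<comment> \<open>R is evaluated once, at the norm of this \<phi>; the argument then varies only
    the times t and r.\<close>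
  have balance: "\<sigma>0 + \<sigma>1 * \<phi> 0 + \<sigma>2 * (LINT u:{0..}|lborel. K u * \<phi> (- u)) = 0" if "\<phi> \<in> BC" for \<phi>
  proof -
    interpret prob_space M using assms(3) by (simp add: filtered_prob_space_def)
    interpret bounded_sdde_solution M F W a b \<sigma>0 \<sigma>1 \<sigma>2 \<mu> K \<phi> "x \<phi>" "R ((BC_norm \<phi>)\<^sup>2)"
      by unfold_locales (use assms(2-4) assms(5)[OF that] that R in \<open>auto intro: less_imp_le\<close>)
    show ?thesis by (rule mean_noise_0[OF re root])
  qed
  have "(\<lambda>_. 0) \<in> BC" by (auto simp: BC_def bounded_real_image intro: exI[of _ 0])
  from balance[OF this] have s0: "\<sigma>0 = 0" by simp
  have re0: "0 \<le> Re z" using re by simp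
  \<comment> \<open>At time 0 the real mode equals 1 and the imaginary mode 0. The two balances are
    the real and imaginary parts of the equation in \<open>condition_H\<close>.\<close>
  have "\<sigma>1 + \<sigma>2 * Re (laplace K z) = 0" "\<sigma>2 * Im (laplace K z) = 0"
    using balance[OF exp_mode_in_BC(1)[OF re0]] balance[OF exp_mode_in_BC(2)[OF re0]] s0
    unfolding laplace_Re_Im[OF assms(2) re0] by simp_all
  then have "complex_of_real \<sigma>1 + complex_of_real \<sigma>2 * laplace K z = 0"
    by (simp add: complex_eq_iff)
  then show False using assms(7) s0 z by (auto simp: condition_H_def)
qed

end
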